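(* Let $n\ge 1$. (1) If $k$ has odd residual characteristic, the $K$-orbit decomposition of $X$ is given by $$X=\bigsqcup_{\lambda\in\Lambda_n^+}K\cdot x_\lambda,$$ where $x_\lambda=\mathrm{Diag}(\pi^{\lambda_1},\ldots,\pi^{\lambda_n},\pi^{-\lambda_n},\ldots,\pi^{-\lambda_1})\in X$ and $\Lambda_n^+=\{\lambda\in\mathbb{Z}^n\mid \lambda_1\ge\lambda_2\ge\cdots\ge\lambda_n\ge 0\}$. (2) If $k$ has even residual characteristic, then for each $n\ge1$ there exists a $K$-orbit in $X$ which does not contain any diagonal matrix. (3) There are precisely two $G$-orbits in $X$, independently of the residual characteristic of $k$.
   Context: $k$ is a non-archimedean local field of characteristic $0$ with ring of integers $\mathcal{O}_k$ and a fixed prime element $\pi$; $k'/k$ is an unramified quadratic extension with ring of integers $\mathcal{O}_{k'}$. For a matrix $A$ over $k'$, $A^*$ denotes its conjugate transpose with respect to $k'/k$. $j_m$ is the $m\times m$ matrix with $1$'s on the anti-diagonal and $0$ elsewhere, and $\Phi_y(t)$ is the characteristic polynomial of a square matrix $y$. $G=\{g\in GL_{2n}(k')\mid g^*j_{2n}g=j_{2n}\}$, $X=\{x\in G\mid x^*=x,\ \Phi_{xj_{2n}}(t)=(t^2-1)^n\}$, $K=G\cap GL_{2n}(\mathcal{O}_{k'})$. The group $G$ acts on $X$ by $g\cdot x=gxg^*$. *)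

theory Defs
  imports "Jordan_Normal_Form.Char_Poly" "HOL-Library.Disjoint_Sets"
begin

section \<open>Local fields and unramified quadratic extensions\<close>

text \<open>
  A valuation is a map into the integers whose value at 0 carries no information; every condition
  below therefore treats 0 separately, which amounts to \<open>v 0 = \<infinity>\<close>.
\<close>

definition val_ideal :: "('a :: field \<Rightarrow> int) \<Rightarrow> int \<Rightarrow> 'a set" where
  "val_ideal v m = {x. x = 0 \<or> v x \<ge> m}"

abbreviation val_ring :: "('a :: field \<Rightarrow> int) \<Rightarrow> 'a set" where
  "val_ring v \<equiv> val_ideal v 0"

definition residue_field :: "('a :: field \<Rightarrow> int) \<Rightarrow> 'a set set" where
  "residue_field v =
     val_ring v // {(x, y). x \<in> val_ring v \<and> y \<in> val_ring v \<and> x - y \<in> val_ideal v 1}"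

definition residual_char :: "('a :: field \<Rightarrow> int) \<Rightarrow> nat" where
  "residual_char v = (LEAST p. p > 0 \<and> of_nat p \<in> val_ideal v 1)"

text \<open>A field complete with respect to a normalised discrete valuation, with finite residue field.\<close>

locale nonarch_local_field =
  fixes v :: "'a :: field \<Rightarrow> int"
  assumes v_mult: "x \<noteq> 0 \<Longrightarrow> y \<noteq> 0 \<Longrightarrow> v (x * y) = v x + v y"
    and v_add: "x \<noteq> 0 \<Longrightarrow> y \<noteq> 0 \<Longrightarrow> x + y \<noteq> 0 \<Longrightarrow> min (v x) (v y) \<le> v (x + y)"
    and v_normalised: "\<exists>x. x \<noteq> 0 \<and> v x = 1"
    and v_complete:
      "(\<forall>m. \<exists>N. \<forall>i\<ge>N. \<forall>j\<ge>N. X i - X j \<in> val_ideal v m) \<Longrightarrow>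
         \<exists>L. \<forall>m. \<exists>N. \<forall>i\<ge>N. (X :: nat \<Rightarrow> 'a) i - L \<in> val_ideal v m"
    and finite_residue_field: "finite (residue_field v)"

text \<open>
  \<open>\<iota>\<close> embeds \<open>k\<close> into \<open>k'\<close>, and \<open>\<sigma>\<close> is the nontrivial \<open>k\<close>-automorphism of \<open>k'\<close>.  Both valuations
  are normalised, so that \<open>w\<close> restricts to \<open>v\<close> on the nose expresses ramification index 1;
  separability of the residue field extension is automatic for finite residue fields.
\<close>

locale unramified_quadratic_extension =
  k: nonarch_local_field v + k': nonarch_local_field w + \<iota>: field_hom \<iota> + \<sigma>: field_hom \<sigma>
  for v :: "'k :: field_char_0 \<Rightarrow> int"
    and w :: "'l :: field \<Rightarrow> int"
    and \<iota> :: "'k \<Rightarrow> 'l"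
    and \<sigma> :: "'l \<Rightarrow> 'l" +
  assumes quadratic: "vector_space.dim (\<lambda>a x. \<iota> a * x) (UNIV :: 'l set) = 2"
    and unramified: "a \<noteq> 0 \<Longrightarrow> w (\<iota> a) = v a"
    and \<sigma>_fixes: "\<sigma> (\<iota> a) = \<iota> a"
    and \<sigma>_nontrivial: "\<exists>x. \<sigma> x \<noteq> x"

definition prime_element :: "('a :: field \<Rightarrow> int) \<Rightarrow> 'a \<Rightarrow> bool" where
  "prime_element v p \<longleftrightarrow> p \<noteq> 0 \<and> v p = 1"


section \<open>Unitary hermitian matrices\<close>

definition conj_transpose :: "('l \<Rightarrow> 'l) \<Rightarrow> 'l mat \<Rightarrow> 'l mat" where
  "conj_transpose \<sigma> A = map_mat \<sigma> (transpose_mat A)"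

definition antidiag_mat :: "nat \<Rightarrow> 'l :: field mat" where
  "antidiag_mat m = mat m m (\<lambda>(i, j). if i + j + 1 = m then 1 else 0)"

definition GL_over :: "'l :: field set \<Rightarrow> nat \<Rightarrow> 'l mat set" where
  "GL_over R m = {g \<in> carrier_mat m m. elements_mat g \<subseteq> R \<and>
     (\<exists>h \<in> carrier_mat m m. elements_mat h \<subseteq> R \<and> g * h = 1\<^sub>m m \<and> h * g = 1\<^sub>m m)}"

definition unitary_group :: "('l :: field \<Rightarrow> 'l) \<Rightarrow> nat \<Rightarrow> 'l mat set" where
  "unitary_group \<sigma> n = {g \<in> GL_over UNIV (2 * n).
     conj_transpose \<sigma> g * antidiag_mat (2 * n) * g = antidiag_mat (2 * n)}"

definition unitary_hermitian :: "('l :: field \<Rightarrow> 'l) \<Rightarrow> nat \<Rightarrow> 'l mat set" where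
  "unitary_hermitian \<sigma> n = {x \<in> unitary_group \<sigma> n. conj_transpose \<sigma> x = x \<and>
     char_poly (x * antidiag_mat (2 * n)) = ([:0, 1:] ^ 2 - 1) ^ n}"

definition integral_unitary_group :: "('l :: field \<Rightarrow> int) \<Rightarrow> ('l \<Rightarrow> 'l) \<Rightarrow> nat \<Rightarrow> 'l mat set" where
  "integral_unitary_group w \<sigma> n = unitary_group \<sigma> n \<inter> GL_over (val_ring w) (2 * n)"

definition unitary_orbit :: "('l :: field \<Rightarrow> 'l) \<Rightarrow> 'l mat set \<Rightarrow> 'l mat \<Rightarrow> 'l mat set" where
  "unitary_orbit \<sigma> H x = (\<lambda>g. g * x * conj_transpose \<sigma> g) ` H"

definition dominant_weights :: "nat \<Rightarrow> int list set" where
  "dominant_weights n = {l. length l = n \<and> sorted_wrt (\<ge>) l \<and> (\<forall>a \<in> set l. a \<ge> 0)}"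

definition weight_mat :: "'l :: field \<Rightarrow> int list \<Rightarrow> 'l mat" where
  "weight_mat p l =
     mat_diag (2 * length l) (\<lambda>i. p powi ((l @ rev (map uminus l)) ! i))"

end

theory Submission
  imports Defs
begin

text \<open>
  Put \<open>y = x j\<close>. Then \<open>x \<in> X\<close> says exactly that \<open>y\<close> is an involution of trace 0 which is self-adjoint
  for the hermitian form \<open>h\<close> with matrix \<open>j\<close>, and \<open>G\<close> acts on these \<open>y\<close> by conjugation. So \<open>y\<close> is an
  orthogonal splitting \<open>V\<^sub>+ \<oplus> V\<^sub>-\<close> into two nondegenerate \<open>n\<close>-dimensional spaces. Norms from \<open>k'\<close> are
  the elements of even valuation, hence a nondegenerate space has an orthogonal basis whose norms
  are all 1, except the last one, which is 1 or a prime element. The parity of the valuation of the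
  discriminant of \<open>V\<^sub>+\<close> therefore classifies the \<open>G\<close>-orbits.

  For odd residual characteristic one splits off hyperbolic planes of the standard lattice \<open>L\<close>. Let
  \<open>-l\<close> be the minimal valuation of the entries of \<open>x\<close>. If \<open>l > 0\<close>, an integral vector \<open>a\<close> such that
  \<open>h(a, y a)\<close> has valuation \<open>-l\<close> spans with \<open>\<pi>\<^sup>l y a\<close> a unimodular plane stable under \<open>y\<close>; if
  \<open>l = 0\<close>, one combines a vector of unit norm from each of the two eigenspaces. The orbits of the
  \<open>x\<^sub>\<lambda>\<close> are told apart by elementary divisors. For even residual characteristic there is \<open>x \<in> X\<close>
  with \<open>x \<equiv> j\<close> modulo the prime, and then the whole \<open>K\<close>-orbit of \<open>x\<close> is congruent to \<open>j\<close>.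
\<close>


section \<open>Valuations and residue fields\<close>

text \<open>Subspaces never appear as sets. An orthogonal summand of V stable under y is a
  self-adjoint projection \<open>E\<close> commuting with the operator \<open>Y\<close> of y, and in
  characteristic 0 its dimension and those of its two eigenspaces are read off from the traces of
  \<open>E\<close> and of \<open>Y\<close> after \<open>E\<close>. Likewise the condition on the
  characteristic polynomial becomes a condition on one trace, which can be followed while pieces are
  split off.

  The obstacle in (3) is that 2 may fail to be a unit: an integer \<open>\<theta>\<close> of trace 1
  replaces 1/2 in polarisation and in the Newton iteration for norms, and it also supplies the
  matrix for (2). Its existence rests on \<open>\<sigma>\<close> moving some residue class, which is
  derived from the ramification index being 1; that \<open>\<sigma>\<close> is an isometric
  involution is derived too.

  The obstacle in (1) is integrality. In a plane with l > 0 the eigenvectors of y have norms of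
  valuation l, so projecting along them brings in denominators. They must be normalised congruently
  modulo the l-th power of the prime for the hyperbolic pair built from them to be integral.\<close>

context nonarch_local_field
begin

lemma v_one [simp]: "v 1 = 0"
  using v_mult[of 1 1] by simp

lemma v_minus [simp]: "v (- x) = v x"
proof (cases "x = 0")
  case False
  have "v ((-1) * (-1)) = v (-1) + v (-1)"
    by (rule v_mult) auto
  hence "v (-1) = 0" by simp
  with v_mult[of "-1" x] False show ?thesis by simp
qed simp

lemma v_inverse: "x \<noteq> 0 \<Longrightarrow> v (inverse x) = - v x"
  using v_mult[of x "inverse x"] by simp

lemma v_divide: "x \<noteq> 0 \<Longrightarrow> y \<noteq> 0 \<Longrightarrow> v (x / y) = v x - v y"
  by (simp add: divide_inverse v_mult v_inverse)

lemma v_power: "x \<noteq> 0 \<Longrightarrow> v (x ^ m) = int m * v x"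
  by (induction m) (simp_all add: v_mult algebra_simps)

lemma v_power_int: "x \<noteq> 0 \<Longrightarrow> v (x powi m) = m * v x"
  by (cases "m \<ge> 0") (simp_all add: power_int_def v_power v_inverse power_inverse)

lemma zero_in_ideal [simp]: "0 \<in> val_ideal v m"
  by (simp add: val_ideal_def)

lemma ideal_mono: "x \<in> val_ideal v m \<Longrightarrow> l \<le> m \<Longrightarrow> x \<in> val_ideal v l"
  by (auto simp: val_ideal_def)

lemma ideal_add: "x \<in> val_ideal v m \<Longrightarrow> y \<in> val_ideal v m \<Longrightarrow> x + y \<in> val_ideal v m"
  using v_add[of x y] by (cases "x = 0 \<or> y = 0 \<or> x + y = 0") (auto simp: val_ideal_def)

lemma ideal_minus [simp]: "- x \<in> val_ideal v m \<longleftrightarrow> x \<in> val_ideal v m"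
  by (auto simp: val_ideal_def)

lemma ideal_diff: "x \<in> val_ideal v m \<Longrightarrow> y \<in> val_ideal v m \<Longrightarrow> x - y \<in> val_ideal v m"
  using ideal_add[of x m "- y"] by simp

lemma ideal_diff_commute: "x - y \<in> val_ideal v m \<longleftrightarrow> y - x \<in> val_ideal v m"
  using ideal_minus[of "x - y" m] by simp

lemma ideal_mult: "x \<in> val_ideal v l \<Longrightarrow> y \<in> val_ideal v m \<Longrightarrow> x * y \<in> val_ideal v (l + m)"
  by (cases "x = 0 \<or> y = 0") (auto simp: val_ideal_def v_mult)

lemma ideal_mult_left: "x \<in> val_ring v \<Longrightarrow> y \<in> val_ideal v m \<Longrightarrow> x * y \<in> val_ideal v m"
  using ideal_mult[of x 0 y m] by simp

lemma ideal_mult_right: "x \<in> val_ideal v m \<Longrightarrow> y \<in> val_ring v \<Longrightarrow> x * y \<in> val_ideal v m"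
  using ideal_mult[of x m y 0] by simp

lemma ideal_sum: "(\<And>i. i \<in> I \<Longrightarrow> f i \<in> val_ideal v m) \<Longrightarrow> sum f I \<in> val_ideal v m"
  by (induction I rule: infinite_finite_induct) (auto intro: ideal_add)

lemma one_in_ring [simp]: "1 \<in> val_ring v"
  by (simp add: val_ideal_def)

lemma ring_prod: "(\<And>i. i \<in> I \<Longrightarrow> f i \<in> val_ring v) \<Longrightarrow> prod f I \<in> val_ring v"
  by (induction I rule: infinite_finite_induct) (simp_all add: ideal_mult_left)

lemma one_notin_ideal [simp]: "m > 0 \<Longrightarrow> 1 \<notin> val_ideal v m"
  by (simp add: val_ideal_def)

lemma of_nat_in_ring [simp]: "of_nat m \<in> val_ring v"
  by (induction m) (auto intro: ideal_add)

lemma numeral_in_ring [simp]: "numeral m \<in> val_ring v"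
  using of_nat_in_ring[of "numeral m"] by simp

lemma ideal_1_iff: "x \<in> val_ideal v 1 \<longleftrightarrow> x \<in> val_ring v \<and> \<not> (x \<noteq> 0 \<and> v x = 0)"
  by (auto simp: val_ideal_def)

lemma ideal_prime: "x \<in> val_ring v \<Longrightarrow> y \<in> val_ring v \<Longrightarrow> x * y \<in> val_ideal v 1 \<Longrightarrow>
    x \<in> val_ideal v 1 \<or> y \<in> val_ideal v 1"
  by (cases "x = 0 \<or> y = 0") (auto simp: val_ideal_def v_mult)

lemma zero_if_in_all:
  assumes "\<And>m::nat. x \<in> val_ideal v (int m)"
  shows "x = 0"
  using assms[of "nat (v x + 1)"] by (auto simp: val_ideal_def split: if_splits)

lemma v_add_eq: assumes "x \<noteq> 0" "y \<in> val_ideal v (v x + 1)"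
  shows "x + y \<noteq> 0" "v (x + y) = v x"
proof -
  show ne: "x + y \<noteq> 0"
  proof
    assume "x + y = 0"
    hence "y = - x" by (simp add: eq_neg_iff_add_eq_0 add.commute)
    with assms show False by (auto simp: val_ideal_def)
  qed
  show "v (x + y) = v x"
  proof (cases "y = 0")
    case False
    with assms have y: "v y \<ge> v x + 1" by (auto simp: val_ideal_def)
    have "v (x + y) \<ge> v x" using v_add[of x y] assms False ne y by auto
    moreover have "min (v (x + y)) (v (- y)) \<le> v (x + y + - y)"
      by (rule v_add) (use assms False ne in auto)
    ultimately show ?thesis using y by auto
  qed simp
qed

text \<open>The limit inherits the rate of the sequence, because a term differs from every later one
  by an element of its own ideal. The explicit rate lets congruences of Newton iterates pass to the
  limit.\<close>

lemma Cauchy_limit: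
  assumes "\<And>i. X (Suc i) - X i \<in> val_ideal v (m + int i)"
  obtains L where "\<And>i. X i - L \<in> val_ideal v (m + int i)"
proof -
  have d: "X (i + k) - X i \<in> val_ideal v (m + int i)" for i k
  proof (induction k)
    case (Suc k)
    have "X (Suc (i + k)) - X (i + k) \<in> val_ideal v (m + int i)"
      using assms[of "i + k"] by (rule ideal_mono) simp
    from ideal_add[OF this Suc] show ?case by simp
  qed simp
  have d2: "X i - X j \<in> val_ideal v (m + int N)" if "i \<ge> N" "j \<ge> N" for i j N
    using ideal_diff[OF d[of N "i - N"] d[of N "j - N"]] that by simp
  have "\<exists>L. \<forall>m. \<exists>N. \<forall>i\<ge>N. X i - L \<in> val_ideal v m"
  proof (rule v_complete, intro allI)
    fix l
    show "\<exists>N. \<forall>i\<ge>N. \<forall>j\<ge>N. X i - X j \<in> val_ideal v l"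
      by (rule exI[of _ "nat (l - m)"], intro allI impI, rule ideal_mono[OF d2[where N = "nat (l - m)"]]) auto
  qed
  then obtain L where L: "\<And>l. \<exists>N. \<forall>i\<ge>N. X i - L \<in> val_ideal v l" by blast
  have "X i - L \<in> val_ideal v (m + int i)" for i
  proof -
    obtain N where N: "\<forall>k\<ge>N. X k - L \<in> val_ideal v (m + int i)" using L by blast
    define k where "k = max N i"
    have "X i - X k \<in> val_ideal v (m + int i)" by (rule d2) (auto simp: k_def)
    moreover have "X k - L \<in> val_ideal v (m + int i)" using N by (auto simp: k_def)
    ultimately show ?thesis using ideal_add by fastforce
  qed
  thus thesis by (rule that)
qed

text \<open>Counting in the residue field is done on a finite transversal inside the ring:
  \<open>r\<close> picks one element per class and is idempotent.\<close>

lemma residue_representatives: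
  obtains r where "finite (r ` val_ring v)"
    "\<And>x. x \<in> val_ring v \<Longrightarrow> r x \<in> val_ring v"
    "\<And>x. x \<in> val_ring v \<Longrightarrow> x - r x \<in> val_ideal v 1"
    "\<And>x y. x \<in> val_ring v \<Longrightarrow> y \<in> val_ring v \<Longrightarrow> r x = r y \<longleftrightarrow> x - y \<in> val_ideal v 1"
    "\<And>x. x \<in> val_ring v \<Longrightarrow> r (r x) = r x"
proof -
  define R where "R = {(x, y). x \<in> val_ring v \<and> y \<in> val_ring v \<and> x - y \<in> val_ideal v 1}"
  define s where "s c = (SOME y. y \<in> c)" for c :: "'a set"
  define r where "r x = s (R `` {x})" for x
  have R: "R `` {x} = {y \<in> val_ring v. x - y \<in> val_ideal v 1}" if "x \<in> val_ring v" for x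
    using that by (auto simp: R_def)
  have r: "r x \<in> R `` {x}" if "x \<in> val_ring v" for x
    unfolding r_def s_def by (rule someI[of _ x]) (use that in \<open>auto simp: R_def\<close>)
  have cong: "x - y \<in> val_ideal v 1"
    if "x - z \<in> val_ideal v 1" "y - z \<in> val_ideal v 1" for x y z :: 'a
    using ideal_diff[OF that] by simp
  have "r ` val_ring v = s ` residue_field v"
    unfolding residue_field_def R_def[symmetric] quotient_def r_def by auto
  hence 1: "finite (r ` val_ring v)" using finite_residue_field by simp
  have 2: "r x \<in> val_ring v" "x - r x \<in> val_ideal v 1" if "x \<in> val_ring v" for x
    using r[OF that] R[OF that] by auto
  have 3: "r x = r y \<longleftrightarrow> x - y \<in> val_ideal v 1" if xy: "x \<in> val_ring v" "y \<in> val_ring v" for x y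
  proof
    assume "r x = r y"
    thus "x - y \<in> val_ideal v 1" using 2[OF xy(1)] 2[OF xy(2)] cong by metis
  next
    assume a: "x - y \<in> val_ideal v 1"
    have "R `` {x} = R `` {y}" unfolding R[OF xy(1)] R[OF xy(2)]
      using cong ideal_diff_commute a by (metis (no_types, opaque_lifting))
    thus "r x = r y" by (simp add: r_def)
  qed
  have 4: "r (r x) = r x" if x: "x \<in> val_ring v" for x
    using 3[OF 2(1)[OF x] x] 2(2)[OF x] ideal_diff_commute by blast
  show thesis by (rule that[of r]) (use 1 2 3 4 in auto)
qed

text \<open>In residual characteristic 2, \<open>x\<^sup>2 - y\<^sup>2\<close> and
  \<open>(x - y)\<^sup>2\<close> agree modulo the maximal ideal. So squaring is injective on the
  finite set of classes, hence surjective.\<close>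

lemma residue_square:
  assumes two: "2 \<in> val_ideal v 1" and c: "c \<in> val_ring v"
  obtains x where "x \<in> val_ring v" "c - x\<^sup>2 \<in> val_ideal v 1"
proof -
  obtain r where r: "finite (r ` val_ring v)"
    "\<And>x. x \<in> val_ring v \<Longrightarrow> r x \<in> val_ring v"
    "\<And>x. x \<in> val_ring v \<Longrightarrow> x - r x \<in> val_ideal v 1"
    "\<And>x y. x \<in> val_ring v \<Longrightarrow> y \<in> val_ring v \<Longrightarrow> r x = r y \<longleftrightarrow> x - y \<in> val_ideal v 1"
    "\<And>x. x \<in> val_ring v \<Longrightarrow> r (r x) = r x"
    using residue_representatives by blast
  define R where "R = r ` val_ring v"
  have sq: "x\<^sup>2 \<in> val_ring v" if "x \<in> val_ring v" for x
    unfolding power2_eq_square using ideal_mult_left that by blast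
  have R: "x \<in> val_ring v" "r x = x" if "x \<in> R" for x
    using r(2,5) that by (auto simp: R_def)
  have "inj_on (\<lambda>x. r (x\<^sup>2)) R"
  proof (rule inj_onI)
    fix x y assume xy: "x \<in> R" "y \<in> R" "r (x\<^sup>2) = r (y\<^sup>2)"
    have "x\<^sup>2 - y\<^sup>2 \<in> val_ideal v 1" using r(4)[OF sq sq] xy R(1) by blast
    moreover have "2 * (y * (x - y)) \<in> val_ideal v 1"
      by (rule ideal_mult_right[OF two ideal_mult_left]) (use R xy in \<open>auto intro: ideal_diff\<close>)
    ultimately have "x\<^sup>2 - y\<^sup>2 - 2 * (y * (x - y)) \<in> val_ideal v 1" by (rule ideal_diff)
    also have "x\<^sup>2 - y\<^sup>2 - 2 * (y * (x - y)) = (x - y) * (x - y)"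
      by (simp add: power2_eq_square algebra_simps)
    finally have "x - y \<in> val_ideal v 1"
      using ideal_prime[of "x - y" "x - y"] R(1) xy(1,2) ideal_diff by blast
    thus "x = y" using r(4)[of x y] R xy(1,2) by metis
  qed
  moreover have "(\<lambda>x. r (x\<^sup>2)) ` R \<subseteq> R"
    using sq[OF R(1)] by (auto simp: R_def simp del: image_iff)
  moreover have "finite R" using r by (simp add: R_def)
  ultimately have "(\<lambda>x. r (x\<^sup>2)) ` R = R" by (metis endo_inj_surj)
  moreover have "r c \<in> R" using c by (auto simp: R_def)
  ultimately have "r c \<in> (\<lambda>x. r (x\<^sup>2)) ` R" by simp
  then obtain x where x: "x \<in> R" "r c = r (x\<^sup>2)" by (rule imageE)
  show thesis using that[of x] x(2) R(1)[OF x(1)] r(4)[OF c sq] by blast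
qed

text \<open>The pigeonhole principle: squares, and \<open>u + \<delta>\<close> times squares, each fill more than half of
  the residue field.\<close>

lemma residue_binary_form:
  assumes two: "2 \<notin> val_ideal v 1" and d: "\<delta> \<in> val_ring v" "\<delta> \<notin> val_ideal v 1"
    and u: "u \<in> val_ring v"
  obtains a b where "a \<in> val_ring v" "b \<in> val_ring v" "a\<^sup>2 - (u + \<delta> * b\<^sup>2) \<in> val_ideal v 1"
proof -
  obtain r where r: "finite (r ` val_ring v)"
    "\<And>x. x \<in> val_ring v \<Longrightarrow> r x \<in> val_ring v"
    "\<And>x. x \<in> val_ring v \<Longrightarrow> x - r x \<in> val_ideal v 1"
    "\<And>x y. x \<in> val_ring v \<Longrightarrow> y \<in> val_ring v \<Longrightarrow> r x = r y \<longleftrightarrow> x - y \<in> val_ideal v 1"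
    "\<And>x. x \<in> val_ring v \<Longrightarrow> r (r x) = r x"
    using residue_representatives by blast
  define R where "R = r ` val_ring v"
  have sq: "x\<^sup>2 \<in> val_ring v" if "x \<in> val_ring v" for x
    unfolding power2_eq_square using ideal_mult_left that by blast
  have R: "x \<in> val_ring v" "r x = x" if "x \<in> R" for x
    using r(2,5) that by (auto simp: R_def)
  define f where "f x = r (x\<^sup>2)" for x
  define S where "S = f ` R"
  have fR: "finite R" using r by (simp add: R_def)
  hence fS: "finite S" by (simp add: S_def)
  have rR: "r x \<in> R" if "x \<in> val_ring v" for x using that by (auto simp: R_def)
  have SR: "S \<subseteq> R" unfolding S_def f_def using rR[OF sq[OF R(1)]] by blast
  have feq: "x = y \<or> x = r (- y)" if "x \<in> R" "y \<in> R" "f x = f y" for x y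
  proof -
    have "x\<^sup>2 - y\<^sup>2 \<in> val_ideal v 1" using r(4)[OF sq sq] that R(1) unfolding f_def by blast
    also have "x\<^sup>2 - y\<^sup>2 = (x - y) * (x - - y)" by (simp add: power2_eq_square algebra_simps)
    finally have "x - y \<in> val_ideal v 1 \<or> x - - y \<in> val_ideal v 1"
      using ideal_prime[of "x - y" "x - - y"] R(1)[OF that(1)] R(1)[OF that(2)]
        ideal_diff[of x 0 y] ideal_diff[of x 0 "- y"] by simp
    thus ?thesis using r(4)[of x y] r(4)[of x "- y"] R[OF that(1)] R[OF that(2)] by auto
  qed
  have z: "r 0 \<in> R" "f (r 0) = r 0" "r 0 \<in> S"
  proof -
    show "r 0 \<in> R" by (simp add: R_def)
    have r0: "r 0 \<in> val_ideal v 1" using r(3)[of 0] by simp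
    have "(r 0)\<^sup>2 \<in> val_ideal v 1" unfolding power2_eq_square
      using ideal_mult_left[OF _ r0] r(2)[of 0] by simp
    thus "f (r 0) = r 0" unfolding f_def using r(4)[of "(r 0)\<^sup>2" 0] sq[of "r 0"] r(2)[of 0] by simp
    thus "r 0 \<in> S" using \<open>r 0 \<in> R\<close> by (force simp: S_def)
  qed
  \<comment> \<open>\<open>R\<close> is counted by fibres of squaring: the fibre over 0 is a point,
    every other fibre at most a pair \<open>y\<close>, \<open>- y\<close>. This gives
    \<open>card R \<le> 2 * card S - 1\<close>, the strict inequality behind the pigeonhole.\<close>
  have "card R = card (\<Union>s\<in>S. {x \<in> R. f x = s})"
    by (rule arg_cong[of _ _ card]) (auto simp: S_def)
  also have "\<dots> \<le> (\<Sum>s\<in>S. card {x \<in> R. f x = s})" by (rule card_UN_le[OF fS])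
  also have "\<dots> = card {x \<in> R. f x = r 0} + (\<Sum>s\<in>S - {r 0}. card {x \<in> R. f x = s})"
    using fS z by (simp add: sum.remove)
  also have "{x \<in> R. f x = r 0} = {r 0}"
  proof -
    have "r (- r 0) = r 0"
      using r(4)[of "- r 0" 0] r(3)[of 0] r(2)[of 0] by simp
    thus ?thesis using feq[of _ "r 0"] z by auto
  qed
  also have "(\<Sum>s\<in>S - {r 0}. card {x \<in> R. f x = s}) \<le> (\<Sum>s\<in>S - {r 0}. 2)"
  proof (rule sum_mono)
    fix s assume "s \<in> S - {r 0}"
    then obtain y where y: "y \<in> R" "s = f y" by (auto simp: S_def)
    hence "{x \<in> R. f x = s} \<subseteq> {y, r (- y)}" using feq by auto
    hence "card {x \<in> R. f x = s} \<le> card {y, r (- y)}" by (intro card_mono) auto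
    also have "\<dots> \<le> 2" by (simp add: card_insert_if)
    finally show "card {x \<in> R. f x = s} \<le> 2" .
  qed
  also have "card {r 0} + (\<Sum>s\<in>S - {r 0}. 2) < 2 * card S"
    using fS z card_gt_0_iff[of S] by (auto simp: card_Diff_singleton)
  finally have less: "card R < 2 * card S" by simp
  define g where "g s = r (u + \<delta> * s)" for s
  have val: "u + \<delta> * s \<in> val_ring v" if "s \<in> val_ring v" for s
    using u d that by (intro ideal_add ideal_mult_left) auto
  have "inj_on g S"
  proof (rule inj_onI)
    fix s t assume st: "s \<in> S" "t \<in> S" "g s = g t"
    have st': "s \<in> R" "t \<in> R" using st SR by auto
    have "(u + \<delta> * s) - (u + \<delta> * t) \<in> val_ideal v 1"
      using r(4)[OF val val, of s t] st(3) R(1)[OF st'(1)] R(1)[OF st'(2)] by (simp add: g_def)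
    also have "(u + \<delta> * s) - (u + \<delta> * t) = \<delta> * (s - t)" by (simp add: algebra_simps)
    finally have "s - t \<in> val_ideal v 1"
      using ideal_prime[of \<delta> "s - t"] d R(1) st' ideal_diff by blast
    thus "s = t" using r(4)[of s t] R st' by metis
  qed
  hence cg: "card (g ` S) = card S" by (rule card_image)
  have gR: "g ` S \<subseteq> R" unfolding g_def using rR[OF val[OF R(1)]] SR by blast
  have "S \<inter> g ` S \<noteq> {}"
  proof
    assume "S \<inter> g ` S = {}"
    hence "card (S \<union> g ` S) = 2 * card S" using fS cg by (simp add: card_Un_disjoint)
    moreover have "card (S \<union> g ` S) \<le> card R" using SR gR fR by (intro card_mono) auto
    ultimately show False using less by simp
  qed
  then obtain a b where ab: "a \<in> R" "b \<in> R" "f a = g (f b)" by (auto simp: S_def)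
  have b2: "b\<^sup>2 \<in> val_ring v" "a\<^sup>2 \<in> val_ring v" using ab R(1) sq by blast+
  have "a\<^sup>2 - (u + \<delta> * r (b\<^sup>2)) \<in> val_ideal v 1"
    using ab(3) r(4)[OF b2(2) val[OF r(2)[OF b2(1)]]] by (simp add: f_def g_def)
  moreover have "\<delta> * (b\<^sup>2 - r (b\<^sup>2)) \<in> val_ideal v 1"
    by (rule ideal_mult_left[OF d(1) r(3)[OF b2(1)]])
  ultimately have "(a\<^sup>2 - (u + \<delta> * r (b\<^sup>2))) - \<delta> * (b\<^sup>2 - r (b\<^sup>2)) \<in> val_ideal v 1"
    by (rule ideal_diff)
  hence "a\<^sup>2 - (u + \<delta> * b\<^sup>2) \<in> val_ideal v 1" by (simp add: algebra_simps)
  thus thesis using that ab R(1) by blast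
qed

end


section \<open>Norms and traces of the unramified extension\<close>

context unramified_quadratic_extension
begin

lemma of_nat_eq_0_iff_ext [simp]: "of_nat m = (0::'l) \<longleftrightarrow> m = 0"
  by (metis \<iota>.hom_of_nat \<iota>.hom_zero \<iota>.hom_0_iff of_nat_eq_0_iff)

lemma two_neq_0: "(2::'l) \<noteq> 0"
  using of_nat_eq_0_iff_ext[of 2] by simp

lemma \<sigma>_div: "\<sigma> (x / y) = \<sigma> x / \<sigma> y"
  by (simp add: divide_inverse \<sigma>.hom_mult \<sigma>.hom_inverse)

lemma \<sigma>_powi: "\<sigma> (x powi m) = \<sigma> x powi m"
  by (simp add: power_int_def \<sigma>.hom_power \<sigma>.hom_inverse)

lemma \<iota>_ideal: "\<iota> a \<in> val_ideal w m \<longleftrightarrow> a \<in> val_ideal v m"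
  by (cases "a = 0") (simp_all add: val_ideal_def unramified)

text \<open>Applying \<open>\<sigma>\<close> to a relation between 1 and \<open>\<alpha>\<close> and
  subtracting leaves a multiple of \<open>\<sigma> \<alpha> - \<alpha>\<close>. Hence the two are
  independent and span a space of dimension 2.\<close>

lemma two_generators: "\<sigma> \<alpha> \<noteq> \<alpha> \<Longrightarrow> \<exists>a b. x = \<iota> a + \<iota> b * \<alpha>"
proof -
  assume \<alpha>: "\<sigma> \<alpha> \<noteq> \<alpha>"
  interpret V: vector_space "\<lambda>a x. \<iota> a * x"
    by unfold_locales (simp_all add: \<iota>.hom_add \<iota>.hom_mult algebra_simps)
  obtain B where B: "B \<subseteq> UNIV" "V.independent B" "UNIV \<subseteq> V.span B" "card B = V.dim (UNIV::'l set)"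
    using V.basis_exists[of UNIV] by blast
  have cB: "card B = 2" using B quadratic by simp
  have ne: "1 \<noteq> \<alpha>" using \<alpha> by auto
  have ind: "V.independent {1, \<alpha>}"
  proof
    assume "V.dependent {1, \<alpha>}"
    then obtain u where u: "(\<Sum>v\<in>{1, \<alpha>}. \<iota> (u v) * v) = 0" "\<exists>v\<in>{1,\<alpha>}. u v \<noteq> 0"
      using V.dependent_finite[of "{1,\<alpha>}"] by auto
    have e: "\<iota> (u 1) + \<iota> (u \<alpha>) * \<alpha> = 0" using u(1) ne by simp
    hence "\<sigma> (\<iota> (u 1) + \<iota> (u \<alpha>) * \<alpha>) = 0" by simp
    hence "\<iota> (u 1) + \<iota> (u \<alpha>) * \<sigma> \<alpha> = 0" by (simp add: \<sigma>.hom_add \<sigma>.hom_mult \<sigma>_fixes)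
    with e have "\<iota> (u \<alpha>) * (\<sigma> \<alpha> - \<alpha>) = 0"
      by (metis add_diff_cancel_left diff_self right_diff_distrib)
    hence "u \<alpha> = 0" using \<alpha> by simp
    with e u(2) show False by auto
  qed
  have "V.span {1, \<alpha>} = UNIV"
  proof -
    interpret F: finite_dimensional_vector_space "\<lambda>a x. \<iota> a * x" B
      by unfold_locales (use B cB card.infinite in \<open>fastforce+\<close>)
    show ?thesis using F.card_ge_dim_independent[OF _ ind, of UNIV] quadratic ne by auto
  qed
  hence "x \<in> V.span {1, \<alpha>}" by simp
  thus ?thesis
    unfolding V.span_insert V.span_empty by (auto simp: algebra_simps)
qed

lemma moved: obtains \<alpha> where "\<sigma> \<alpha> \<noteq> \<alpha>"
  using \<sigma>_nontrivial by blast

text \<open>\<open>\<sigma>\<close> maps \<open>\<alpha>\<close> to the other root of its quadratic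
  equation over the base field, which is \<open>\<iota> d - \<alpha>\<close>; a second application
  returns to \<open>\<alpha>\<close>.\<close>

lemma \<sigma>_\<sigma> [simp]: "\<sigma> (\<sigma> x) = x"
proof -
  obtain \<alpha> where \<alpha>: "\<sigma> \<alpha> \<noteq> \<alpha>" by (rule moved)
  obtain c d where cd: "\<alpha> * \<alpha> = \<iota> c + \<iota> d * \<alpha>" using two_generators[OF \<alpha>] by blast
  have "\<sigma> (\<alpha> * \<alpha>) = \<sigma> (\<iota> c + \<iota> d * \<alpha>)" by (simp add: cd)
  hence "\<sigma> \<alpha> * \<sigma> \<alpha> = \<iota> c + \<iota> d * \<sigma> \<alpha>" by (simp add: \<sigma>.hom_add \<sigma>.hom_mult \<sigma>_fixes)
  with cd have "(\<sigma> \<alpha> - \<alpha>) * (\<sigma> \<alpha> + \<alpha> - \<iota> d) = 0" by (simp add: algebra_simps)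
  hence "\<sigma> \<alpha> + \<alpha> - \<iota> d = 0" using \<alpha> by (simp only: mult_eq_0_iff) auto
  hence e: "\<sigma> \<alpha> = \<iota> d - \<alpha>" by (simp add: algebra_simps)
  have "\<sigma> (\<sigma> \<alpha>) = \<alpha>" by (subst e) (simp add: \<sigma>.hom_minus \<sigma>_fixes e)
  moreover obtain a b where "x = \<iota> a + \<iota> b * \<alpha>" using two_generators[OF \<alpha>] by blast
  ultimately show ?thesis by (simp add: \<sigma>.hom_add \<sigma>.hom_mult \<sigma>_fixes)
qed

lemma fixed_in_base: assumes "\<sigma> x = x" obtains a where "x = \<iota> a"
proof -
  obtain \<alpha> where \<alpha>: "\<sigma> \<alpha> \<noteq> \<alpha>" by (rule moved)
  obtain a b where ab: "x = \<iota> a + \<iota> b * \<alpha>" using two_generators[OF \<alpha>] by blast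
  hence "\<iota> b * (\<sigma> \<alpha> - \<alpha>) = 0" using assms by (simp add: \<sigma>.hom_add \<sigma>.hom_mult \<sigma>_fixes algebra_simps)
  hence "b = 0" using \<alpha> by simp
  thus thesis using ab that by simp
qed

text \<open>A complete subfield is closed: the approximations from k are Cauchy for \<open>v\<close>
  because \<open>w\<close> restricts to \<open>v\<close>.\<close>

lemma base_closed:
  assumes "\<And>m::nat. \<exists>a. x - \<iota> a \<in> val_ideal w (int m)"
  obtains a where "x = \<iota> a"
proof -
  from assms obtain X where X: "\<And>m::nat. x - \<iota> (X m) \<in> val_ideal w (int m)" by metis
  have "X (Suc i) - X i \<in> val_ideal v (0 + int i)" for i
  proof -
    have "x - \<iota> (X (Suc i)) \<in> val_ideal w (int i)" using X[of "Suc i"] k'.ideal_mono by fastforce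
    from k'.ideal_diff[OF X[of i] this] have "\<iota> (X (Suc i) - X i) \<in> val_ideal w (int i)"
      by (simp add: \<iota>.hom_minus)
    thus ?thesis by (simp add: \<iota>_ideal)
  qed
  then obtain L where L: "\<And>i. X i - L \<in> val_ideal v (0 + int i)" using k.Cauchy_limit by blast
  have "x - \<iota> L = 0"
  proof (rule k'.zero_if_in_all)
    fix m
    have "\<iota> (X m - L) \<in> val_ideal w (int m)" using L[of m] by (simp add: \<iota>_ideal)
    from k'.ideal_add[OF X[of m] this] show "x - \<iota> L \<in> val_ideal w (int m)" by (simp add: \<iota>.hom_minus)
  qed
  thus thesis using that by simp
qed

text \<open>If \<open>\<sigma> x\<close> were closer to 0 than \<open>x\<close>, then \<open>x\<close> would be the limit of the elements
  \<open>(x\<^sup>m\<^sup>+\<^sup>1 + (\<sigma> x)\<^sup>m\<^sup>+\<^sup>1) / (x\<^sup>m + (\<sigma> x)\<^sup>m)\<close> of the base field, hence fixed by \<open>\<sigma>\<close>.\<close>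

lemma w_\<sigma>_le: assumes "x \<noteq> 0" shows "w (\<sigma> x) \<le> w x"
proof (rule ccontr)
  assume "\<not> w (\<sigma> x) \<le> w x"
  define r where "r = \<sigma> x / x"
  have r0: "r \<noteq> 0" using assms by (simp add: r_def)
  have wr: "w r \<ge> 1" using \<open>\<not> w (\<sigma> x) \<le> w x\<close> assms by (simp add: r_def k'.v_divide)
  have rm: "r ^ m \<in> val_ideal w (int m)" for m
    using r0 wr mult_left_mono[of 1 "w r" "int m"] by (auto simp: val_ideal_def k'.v_power)
  have sx: "\<sigma> x = r * x" using assms by (simp add: r_def)
  have unit: "1 + r ^ m \<noteq> 0" "w (1 + r ^ m) = 0" if "m \<ge> 1" for m
    using k'.v_add_eq[of 1 "r ^ m"] k'.ideal_mono[OF rm[of m], of 1] that by auto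
  have "\<exists>a. x - \<iota> a \<in> val_ideal w (int m)" for m
  proof -
    \<comment> \<open>The distance of \<open>x\<close> from the quotient \<open>q\<close> has
      valuation at least \<open>w x + l\<close>. The summand \<open>nat (- w x)\<close> makes up for
      a negative \<open>w x\<close>, and \<open>Suc\<close> makes \<open>1 + r ^ l\<close> a
      unit.\<close>
    define l where "l = Suc (m + nat (- w x))"
    define q where "q = (x ^ Suc l + \<sigma> x ^ Suc l) / (x ^ l + \<sigma> x ^ l)"
    have "\<sigma> q = q" by (simp add: q_def \<sigma>_div \<sigma>.hom_add \<sigma>.hom_power \<sigma>.hom_mult add.commute)
    then obtain a where a: "q = \<iota> a" by (rule fixed_in_base)
    have "x ^ l + \<sigma> x ^ l = x ^ l * (1 + r ^ l)" unfolding sx by (simp add: algebra_simps)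
    moreover have "x ^ Suc l + \<sigma> x ^ Suc l = x ^ l * (x * (1 + r ^ Suc l))"
      unfolding sx by (simp add: algebra_simps)
    ultimately have "q = x * (1 + r ^ Suc l) / (1 + r ^ l)" using assms by (simp add: q_def)
    hence "x - q = x * r ^ l * (1 - r) / (1 + r ^ l)"
      using unit[of l] by (simp add: l_def field_simps)
    hence *: "x - \<iota> a = x * (r ^ l * (1 - r)) / (1 + r ^ l)" using a by simp
    have "inverse (1 + r ^ l) \<in> val_ring w" using unit[of l] by (simp add: val_ideal_def k'.v_inverse l_def)
    moreover have "1 - r \<in> val_ring w"
      using k'.ideal_mono[OF rm[of 1], of 0] by (intro k'.ideal_diff) auto
    moreover have "x \<in> val_ideal w (w x)" by (simp add: val_ideal_def)
    ultimately have "x * (r ^ l * (1 - r)) * inverse (1 + r ^ l) \<in> val_ideal w (w x + int l)"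
      by (intro k'.ideal_mult_right k'.ideal_mult rm)
    hence "x - \<iota> a \<in> val_ideal w (w x + int l)" using * by (simp add: divide_inverse)
    hence "x - \<iota> a \<in> val_ideal w (int m)" by (rule k'.ideal_mono) (simp add: l_def)
    thus ?thesis by blast
  qed
  then obtain a where "x = \<iota> a" by (rule base_closed)
  hence "\<sigma> x = x" by (simp add: \<sigma>_fixes)
  thus False using \<open>\<not> w (\<sigma> x) \<le> w x\<close> by simp
qed

lemma w_\<sigma> [simp]: "w (\<sigma> x) = w x"
proof (cases "x = 0")
  case False
  thus ?thesis using w_\<sigma>_le[of x] w_\<sigma>_le[of "\<sigma> x"] by simp
qed simp

lemma \<sigma>_ideal [simp]: "\<sigma> x \<in> val_ideal w m \<longleftrightarrow> x \<in> val_ideal w m"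
  by (auto simp: val_ideal_def)

section \<open>Residual action of the automorphism, integral traces and norms\<close>

lemma uniformizer: obtains q where "q \<noteq> 0" "w q = 1" "\<sigma> q = q"
proof -
  obtain t where "t \<noteq> 0" "v t = 1" using k.v_normalised by blast
  thus thesis using that[of "\<iota> t"] by (simp add: unramified \<sigma>_fixes)
qed

text \<open>Ramification index 1 enters here. If \<open>\<sigma>\<close> were trivial on residues,
  each class would meet k; as a prime \<open>t\<close> of k is also prime in k', successive
  approximation by powers of \<open>t\<close> would put every integer of k' into k, against
  \<open>\<sigma>_nontrivial\<close>.\<close>

lemma residually_moved: obtains \<alpha> where "\<alpha> \<in> val_ring w" "\<alpha> - \<sigma> \<alpha> \<notin> val_ideal w 1"
proof (rule ccontr)
  assume "\<not> thesis"
  with that have triv: "\<And>x. x \<in> val_ring w \<Longrightarrow> x - \<sigma> x \<in> val_ideal w 1" by blast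
  obtain t where t: "t \<noteq> 0" "v t = 1" using k.v_normalised by blast
  have wt: "\<iota> t \<noteq> 0" "w (\<iota> t) = 1" using t by (simp_all add: unramified)
  have res: "\<exists>a. x - \<iota> a \<in> val_ideal w 1" if x: "x \<in> val_ring w" for x
  proof (cases "(2::'k) \<in> val_ideal v 1")
    case False
    have u: "(2::'l) \<noteq> 0" "w 2 = 0"
    proof -
      have "\<iota> 2 \<notin> val_ideal w 1" using False by (simp add: \<iota>_ideal)
      thus "(2::'l) \<noteq> 0" "w 2 = 0"
        using k'.ideal_1_iff[of 2] by (auto simp: \<iota>.hom_numeral)
    qed
    obtain a where a: "x + \<sigma> x = \<iota> a"
      using fixed_in_base[of "x + \<sigma> x"] by (auto simp: \<sigma>.hom_add add.commute)
    have "x - \<iota> (a / 2) = (x - \<sigma> x) * inverse 2"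
      using u by (simp add: \<iota>.hom_div \<iota>.hom_numeral a[symmetric] field_simps)
    also have "\<dots> \<in> val_ideal w 1"
      by (rule k'.ideal_mult_right[OF triv[OF x]]) (use u k'.v_inverse[of 2] in \<open>simp add: val_ideal_def\<close>)
    finally show ?thesis by blast
  next
    case True
    obtain c where c: "x * \<sigma> x = \<iota> c"
      using fixed_in_base[of "x * \<sigma> x"] by (auto simp: \<sigma>.hom_mult mult.commute)
    have "\<iota> c \<in> val_ring w" unfolding c[symmetric] using x by (intro k'.ideal_mult_left) auto
    hence "c \<in> val_ring v" by (simp add: \<iota>_ideal)
    then obtain a where a: "a \<in> val_ring v" "c - a\<^sup>2 \<in> val_ideal v 1"
      using k.residue_square[OF True] by blast
    have ia: "\<iota> a \<in> val_ring w" "\<iota> (c - a\<^sup>2) \<in> val_ideal w 1" using a by (simp_all add: \<iota>_ideal)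
    have two: "2 \<in> val_ideal w 1" using True \<iota>_ideal[of 2 1] by (simp add: \<iota>.hom_numeral)
    have "x * (x - \<sigma> x) + \<iota> (c - a\<^sup>2) - 2 * (\<iota> a * (x - \<iota> a)) \<in> val_ideal w 1"
      by (intro k'.ideal_add k'.ideal_diff k'.ideal_mult_left[OF x triv[OF x]] ia(2)
        k'.ideal_mult_right[OF two] k'.ideal_mult_left[OF ia(1)] x ia(1))
    also have "x * (x - \<sigma> x) + \<iota> (c - a\<^sup>2) - 2 * (\<iota> a * (x - \<iota> a)) = (x - \<iota> a) * (x - \<iota> a)"
      by (simp add: \<iota>.hom_minus \<iota>.hom_mult c[symmetric] power2_eq_square algebra_simps)
    finally have "x - \<iota> a \<in> val_ideal w 1"
      using k'.ideal_prime k'.ideal_diff[OF x ia(1)] by blast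
    thus ?thesis by blast
  qed
  have fixed: "\<sigma> x = x" if x: "x \<in> val_ring w" for x
  proof -
    have "\<exists>a. x - \<iota> a \<in> val_ideal w (int m)" for m
    proof (induction m)
      case 0
      show ?case using x by (intro exI[of _ 0]) simp
    next
      case (Suc m)
      then obtain a where a: "x - \<iota> a \<in> val_ideal w (int m)" by blast
      define y where "y = (x - \<iota> a) / \<iota> t ^ m"
      have "y \<in> val_ring w" using a wt by (cases "x = \<iota> a") (simp_all add: y_def val_ideal_def k'.v_divide k'.v_power)
      then obtain b where b: "y - \<iota> b \<in> val_ideal w 1" using res by blast
      have "\<iota> t ^ m \<in> val_ideal w (int m)" using wt by (simp add: val_ideal_def k'.v_power)
      from k'.ideal_mult[OF this b]
      have "\<iota> t ^ m * (y - \<iota> b) \<in> val_ideal w (int (Suc m))" by (simp add: add.commute)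
      also have "\<iota> t ^ m * (y - \<iota> b) = x - \<iota> (a + t ^ m * b)"
      proof -
        have "\<iota> t ^ m * y = x - \<iota> a" using wt by (simp add: y_def)
        thus ?thesis by (simp add: right_diff_distrib \<iota>.hom_add \<iota>.hom_mult \<iota>.hom_power)
      qed
      finally show ?case by blast
    qed
    then obtain a where "x = \<iota> a" by (rule base_closed)
    thus ?thesis by (simp add: \<sigma>_fixes)
  qed
  obtain x where x: "\<sigma> x \<noteq> x" by (rule moved)
  define y where "y = x * \<iota> t powi (- w x)"
  have "x \<noteq> 0" using x by auto
  hence "y \<in> val_ring w" using wt by (simp add: y_def val_ideal_def k'.v_mult k'.v_power_int)
  hence "\<sigma> y = y" by (rule fixed)
  moreover have "\<sigma> y = \<sigma> x * \<iota> t powi (- w x)"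
    by (simp add: y_def \<sigma>.hom_mult \<sigma>_powi \<sigma>_fixes)
  ultimately show False using x wt by (simp add: y_def)
qed

text \<open>If 2 is a unit, 1/2 serves. Otherwise \<open>\<alpha> + \<sigma> \<alpha>\<close> is
  congruent to \<open>\<alpha> - \<sigma> \<alpha>\<close> for a residually moved
  \<open>\<alpha>\<close>, hence a unit fixed by \<open>\<sigma>\<close>, and
  \<open>\<alpha>\<close> can be divided by it.\<close>

lemma trace_one: obtains \<theta> where "\<theta> \<in> val_ring w" "\<theta> + \<sigma> \<theta> = 1"
proof (cases "(2::'l) \<in> val_ideal w 1")
  case False
  hence u: "(2::'l) \<noteq> 0" "w 2 = 0" using k'.ideal_1_iff[of 2] by auto
  show thesis
    by (rule that[of "1/2"]) (use u in \<open>simp_all add: val_ideal_def k'.v_divide \<sigma>_div \<sigma>.hom_numeral\<close>)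
next
  case True
  obtain \<alpha> where \<alpha>: "\<alpha> \<in> val_ring w" "\<alpha> - \<sigma> \<alpha> \<notin> val_ideal w 1" by (rule residually_moved)
  have "2 * \<sigma> \<alpha> \<in> val_ideal w 1" by (rule k'.ideal_mult_right[OF True]) (use \<alpha> in simp)
  hence n: "\<alpha> + \<sigma> \<alpha> \<notin> val_ideal w 1" using \<alpha> k'.ideal_diff[of "\<alpha> + \<sigma> \<alpha>" 1 "2 * \<sigma> \<alpha>"]
    by (auto simp: algebra_simps)
  have "\<alpha> + \<sigma> \<alpha> \<in> val_ring w" using \<alpha> by (intro k'.ideal_add) auto
  hence u: "\<alpha> + \<sigma> \<alpha> \<noteq> 0" "w (\<alpha> + \<sigma> \<alpha>) = 0" using n k'.ideal_1_iff by auto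
  have "\<alpha> / (\<alpha> + \<sigma> \<alpha>) \<in> val_ring w"
    using \<alpha>(1) u by (cases "\<alpha> = 0") (simp_all add: val_ideal_def k'.v_divide)
  moreover have "\<alpha> / (\<alpha> + \<sigma> \<alpha>) + \<sigma> (\<alpha> / (\<alpha> + \<sigma> \<alpha>)) = 1"
    using u by (simp add: \<sigma>_div \<sigma>.hom_add add.commute[of "\<sigma> \<alpha>"] add_divide_distrib[symmetric])
  ultimately show thesis by (rule that)
qed

text \<open>In residual characteristic 2, \<open>u\<close> is residually the square, hence the norm,
  of an element of k. Otherwise \<open>\<eta> = \<alpha> - \<sigma> \<alpha>\<close> has its square
  \<open>d\<close> in k, the norm of \<open>a + b * \<eta>\<close> is
  \<open>a\<^sup>2 - d * b\<^sup>2\<close>, and \<open>residue_binary_form\<close> makes it meet the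
  class of \<open>u\<close>.\<close>

lemma residue_norm:
  assumes u: "\<sigma> u = u" "u \<noteq> 0" "w u = 0"
  obtains a where "a \<in> val_ring w" "u - a * \<sigma> a \<in> val_ideal w 1"
proof -
  obtain c where c: "u = \<iota> c" using fixed_in_base[OF u(1)] by blast
  have cv: "c \<in> val_ring v" using u \<iota>_ideal[of c 0] by (simp add: c val_ideal_def)
  show thesis
  proof (cases "(2::'k) \<in> val_ideal v 1")
    case True
    obtain x where x: "x \<in> val_ring v" "c - x\<^sup>2 \<in> val_ideal v 1"
      using k.residue_square[OF True cv] by blast
    have "\<iota> (c - x\<^sup>2) \<in> val_ideal w 1" using x by (simp add: \<iota>_ideal)
    hence "u - \<iota> x * \<sigma> (\<iota> x) \<in> val_ideal w 1"
      by (simp add: c \<iota>.hom_minus \<iota>.hom_mult power2_eq_square \<sigma>_fixes)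
    moreover have "\<iota> x \<in> val_ring w" using x by (simp add: \<iota>_ideal)
    ultimately show thesis using that by blast
  next
    case False
    obtain \<alpha> where \<alpha>: "\<alpha> \<in> val_ring w" "\<alpha> - \<sigma> \<alpha> \<notin> val_ideal w 1" by (rule residually_moved)
    define \<eta> where "\<eta> = \<alpha> - \<sigma> \<alpha>"
    have s\<eta>: "\<sigma> \<eta> = - \<eta>" by (simp add: \<eta>_def \<sigma>.hom_minus)
    obtain d where d: "\<eta> * \<eta> = \<iota> d"
      using fixed_in_base[of "\<eta> * \<eta>"] by (auto simp: \<sigma>.hom_mult s\<eta>)
    have \<eta>: "\<eta> \<in> val_ring w" "\<eta> \<notin> val_ideal w 1"
      using \<alpha> by (auto simp: \<eta>_def intro!: k'.ideal_diff)
    have "\<iota> d \<in> val_ring w" "\<iota> d \<notin> val_ideal w 1"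
      unfolding d[symmetric] using \<eta> k'.ideal_mult_left[OF \<eta>(1) \<eta>(1)] k'.ideal_prime[OF \<eta>(1) \<eta>(1)] by auto
    hence "d \<in> val_ring v" "d \<notin> val_ideal v 1" by (simp_all add: \<iota>_ideal)
    then obtain a b where ab: "a \<in> val_ring v" "b \<in> val_ring v" "a\<^sup>2 - (c + d * b\<^sup>2) \<in> val_ideal v 1"
      using k.residue_binary_form[OF False _ _ cv] by blast
    have i: "\<iota> a \<in> val_ring w" "\<iota> b \<in> val_ring w" "\<iota> (a\<^sup>2 - (c + d * b\<^sup>2)) \<in> val_ideal w 1"
      using ab by (simp_all add: \<iota>_ideal)
    have "- \<iota> (a\<^sup>2 - (c + d * b\<^sup>2)) = u - (\<iota> a + \<iota> b * \<eta>) * \<sigma> (\<iota> a + \<iota> b * \<eta>)"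
      by (simp add: c \<iota>.hom_minus \<iota>.hom_add \<iota>.hom_mult \<sigma>.hom_add \<sigma>.hom_mult \<sigma>_fixes s\<eta>
        d[symmetric] power2_eq_square algebra_simps)
    hence "u - (\<iota> a + \<iota> b * \<eta>) * \<sigma> (\<iota> a + \<iota> b * \<eta>) \<in> val_ideal w 1"
      using i(3) k'.ideal_minus by metis
    moreover have "\<iota> a + \<iota> b * \<eta> \<in> val_ring w"
      by (intro k'.ideal_add k'.ideal_mult_left i \<eta>(1))
    ultimately show thesis using that by blast
  qed
qed

text \<open>Newton iteration for the norm \<open>N a = a \<sigma> a\<close>: adding \<open>\<theta> (u - N a) / \<sigma> a\<close> to \<open>a\<close>, where \<open>\<theta>\<close> has trace 1,
  changes the norm by \<open>u - N a\<close> up to a quadratic error.\<close>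

lemma norm_Hensel:
  assumes u: "\<sigma> u = u" and a0: "a0 \<noteq> 0" "w a0 = 0"
    and m: "m \<ge> 1" and close: "u - a0 * \<sigma> a0 \<in> val_ideal w m"
  obtains a where "a * \<sigma> a = u" "a - a0 \<in> val_ideal w m"
proof -
  obtain \<theta> where \<theta>: "\<theta> \<in> val_ring w" "\<theta> + \<sigma> \<theta> = 1" by (rule trace_one)
  define c where "c a = \<theta> * (u - a * \<sigma> a) / \<sigma> a" for a
  define X where "X = rec_nat a0 (\<lambda>_ a. a + c a)"
  have X0: "X 0 = a0" and XS: "\<And>i. X (Suc i) = X i + c (X i)" by (simp_all add: X_def)
  have c_in: "c a \<in> val_ideal w l" if "a \<noteq> 0" "w a = 0" "u - a * \<sigma> a \<in> val_ideal w l" for a l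
  proof -
    have "inverse (\<sigma> a) \<in> val_ring w" using that by (simp add: val_ideal_def k'.v_inverse)
    hence "\<theta> * (u - a * \<sigma> a) * inverse (\<sigma> a) \<in> val_ideal w l"
      by (intro k'.ideal_mult_right k'.ideal_mult_left \<theta> that)
    thus ?thesis by (simp add: c_def divide_inverse)
  qed
  have step: "u - (a + c a) * \<sigma> (a + c a) = - (c a * \<sigma> (c a))" if "a \<noteq> 0" for a
  proof -
    have "a * \<sigma> (c a) + c a * \<sigma> a = (\<theta> + \<sigma> \<theta>) * (u - a * \<sigma> a)"
      using that by (simp add: c_def \<sigma>_div \<sigma>.hom_mult \<sigma>.hom_minus u mult.commute[of "\<sigma> a"] distrib_right)
    hence "a * \<sigma> (c a) + c a * \<sigma> a = u - a * \<sigma> a" using \<theta> by simp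
    thus ?thesis by (simp add: \<sigma>.hom_add algebra_simps)
  qed
  have inv: "X i \<noteq> 0 \<and> w (X i) = 0 \<and> u - X i * \<sigma> (X i) \<in> val_ideal w (m + int i)" for i
  proof (induction i)
    case 0
    thus ?case using a0 close by (simp add: X0)
  next
    case (Suc i)
    have ci: "c (X i) \<in> val_ideal w (m + int i)" using c_in Suc by blast
    have 1: "X i + c (X i) \<noteq> 0" "w (X i + c (X i)) = 0"
      using k'.v_add_eq[of "X i" "c (X i)"] Suc k'.ideal_mono[OF ci, of 1] m by auto
    have "c (X i) * \<sigma> (c (X i)) \<in> val_ideal w (m + int i + (m + int i))"
      by (intro k'.ideal_mult) (use ci in simp_all)
    hence "c (X i) * \<sigma> (c (X i)) \<in> val_ideal w (m + int (Suc i))"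
      by (rule k'.ideal_mono) (use m in simp)
    hence "u - (X i + c (X i)) * \<sigma> (X i + c (X i)) \<in> val_ideal w (m + int (Suc i))"
      using step[of "X i"] Suc by simp
    thus ?case using 1 by (simp add: XS)
  qed
  have "X (Suc i) - X i \<in> val_ideal w (m + int i)" for i
    using c_in inv[of i] by (simp add: XS)
  then obtain L where L: "\<And>i. X i - L \<in> val_ideal w (m + int i)" using k'.Cauchy_limit by blast
  have Lr: "L \<in> val_ring w"
  proof -
    have "X 0 - (X 0 - L) \<in> val_ring w"
      by (intro k'.ideal_diff k'.ideal_mono[OF L[of 0]]) (use m a0 in \<open>auto simp: X0 val_ideal_def\<close>)
    thus ?thesis by simp
  qed
  have "u - L * \<sigma> L = 0"
  proof (rule k'.zero_if_in_all)
    fix i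
    have Xr: "X i \<in> val_ring w" using inv[of i] by (simp add: val_ideal_def)
    have "u - X i * \<sigma> (X i) + (X i - L) * \<sigma> (X i) + L * \<sigma> (X i - L) \<in> val_ideal w (m + int i)"
      by (intro k'.ideal_add k'.ideal_mult_right[OF L] k'.ideal_mult_left[OF Lr])
        (use inv[of i] Xr L in auto)
    also have "u - X i * \<sigma> (X i) + (X i - L) * \<sigma> (X i) + L * \<sigma> (X i - L) = u - L * \<sigma> L"
      by (simp add: \<sigma>.hom_minus algebra_simps)
    finally show "u - L * \<sigma> L \<in> val_ideal w (int i)" by (rule k'.ideal_mono) (use m in simp)
  qed
  moreover have "L - a0 \<in> val_ideal w m" using L[of 0] k'.ideal_diff_commute by (simp add: X0)
  ultimately show thesis using that by simp
qed

lemma unit_norm: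
  assumes u: "\<sigma> u = u" "u \<noteq> 0" "w u = 0"
  obtains a where "a * \<sigma> a = u" "a \<noteq> 0" "w a = 0"
proof -
  obtain a0 where a0: "a0 \<in> val_ring w" "u - a0 * \<sigma> a0 \<in> val_ideal w 1" by (rule residue_norm[OF u])
  have "a0 \<notin> val_ideal w 1"
  proof
    assume "a0 \<in> val_ideal w 1"
    hence "a0 * \<sigma> a0 \<in> val_ideal w 1" using a0 by (intro k'.ideal_mult_right) auto
    hence "u \<in> val_ideal w 1" using k'.ideal_add[OF a0(2)] by fastforce
    thus False using u by (simp add: val_ideal_def)
  qed
  hence "a0 \<noteq> 0" "w a0 = 0" using a0 k'.ideal_1_iff by auto
  then obtain a where a: "a * \<sigma> a = u" using norm_Hensel[OF u(1) _ _ _ a0(2)] by auto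
  hence "a \<noteq> 0" using u by auto
  moreover have "w a = 0" using a u k'.v_mult[of a "\<sigma> a"] \<open>a \<noteq> 0\<close> by auto
  ultimately show thesis using a that by blast
qed

lemma even_norm:
  assumes u: "\<sigma> u = u" "u \<noteq> 0" "even (w u)"
  obtains a where "a * \<sigma> a = u" "a \<noteq> 0"
proof -
  obtain q where q: "q \<noteq> 0" "w q = 1" "\<sigma> q = q" by (rule uniformizer)
  define b where "b = q powi (w u div 2)"
  have b: "b \<noteq> 0" "\<sigma> b = b" "w b = w u div 2"
    using q by (simp_all add: b_def k'.v_power_int \<sigma>_powi)
  have "w (u / (b * b)) = 0" using b u by (auto simp: k'.v_divide k'.v_mult elim: evenE)
  then obtain a where a: "a * \<sigma> a = u / (b * b)" "a \<noteq> 0"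
    using unit_norm[of "u / (b * b)"] b u by (auto simp: \<sigma>_div \<sigma>.hom_mult)
  show thesis by (rule that[of "a * b"]) (use a b in \<open>simp_all add: \<sigma>.hom_mult field_simps\<close>)
qed

end


section \<open>Self-adjoint involutions on functions\<close>

definition comb :: "'a \<Rightarrow> (nat \<Rightarrow> 'a) \<Rightarrow> 'a \<Rightarrow> (nat \<Rightarrow> 'a) \<Rightarrow> nat \<Rightarrow> 'a :: semiring_0" where
  "comb a x b y = (\<lambda>i. a * x i + b * y i)"

definition scal :: "'a \<Rightarrow> (nat \<Rightarrow> 'a) \<Rightarrow> nat \<Rightarrow> 'a :: semiring_0" where
  "scal a x = (\<lambda>i. a * x i)"

definition unit_fun :: "nat \<Rightarrow> nat \<Rightarrow> 'a :: zero_neq_one" where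
  "unit_fun i = (\<lambda>k. if k = i then 1 else 0)"

definition lin_op :: "((nat \<Rightarrow> 'a) \<Rightarrow> nat \<Rightarrow> 'a :: semiring_0) \<Rightarrow> bool" where
  "lin_op T \<longleftrightarrow> (\<forall>a x b y. T (comb a x b y) = comb a (T x) b (T y))"

lemma comb_apply: "comb a x b y i = a * x i + b * y i"
  by (simp add: comb_def)

lemma scal_comb: "scal a x = comb a x 0 x" for a :: "'a :: semiring_0"
  by (simp add: comb_def scal_def)

lemma scal_scal: "scal a (scal b x) = scal (a * b) x" for a :: "'a :: semiring_0"
  by (simp add: scal_def mult.assoc)

lemma lin_opD: "lin_op T \<Longrightarrow> T (comb a x b y) = comb a (T x) b (T y)"
  by (simp add: lin_op_def)

lemma lin_op_scal: "lin_op T \<Longrightarrow> T (scal a x) = scal a (T x)"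
  by (simp add: scal_comb lin_opD)

section \<open>The hermitian form on coordinate vectors and its integral values\<close>

locale unitary_setting = unramified_quadratic_extension v w \<iota> \<sigma>
  for v :: "'k :: field_char_0 \<Rightarrow> int" and w :: "'l :: field \<Rightarrow> int" and \<iota> \<sigma> +
  fixes n :: nat
begin

abbreviation N :: nat where "N \<equiv> 2 * n"

definition supp :: "(nat \<Rightarrow> 'l) \<Rightarrow> bool" where
  "supp x \<longleftrightarrow> (\<forall>i\<ge>N. x i = 0)"

definition h :: "(nat \<Rightarrow> 'l) \<Rightarrow> (nat \<Rightarrow> 'l) \<Rightarrow> 'l" where
  "h x y = (\<Sum>i<N. \<sigma> (x i) * y (N - Suc i))"

text \<open>On a self-adjoint projection this is the dimension of its range; on \<open>Y\<close>
  after the projection it is the difference of the dimensions of the two eigenspaces in that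
  range.\<close>

definition tr :: "((nat \<Rightarrow> 'l) \<Rightarrow> nat \<Rightarrow> 'l) \<Rightarrow> 'l" where
  "tr T = (\<Sum>i<N. T (unit_fun i) i)"

definition integral :: "(nat \<Rightarrow> 'l) \<Rightarrow> bool" where
  "integral x \<longleftrightarrow> (\<forall>i. x i \<in> val_ring w)"

lemma h_comb_right: "h x (comb a y b z) = a * h x y + b * h x z"
  by (simp add: h_def comb_def sum.distrib sum_distrib_left algebra_simps)

lemma h_comb_left: "h (comb a y b z) x = \<sigma> a * h y x + \<sigma> b * h z x"
  by (simp add: h_def comb_def \<sigma>.hom_add \<sigma>.hom_mult sum.distrib sum_distrib_left algebra_simps)

lemma h_scal_right: "h x (scal a y) = a * h x y"
  by (simp add: scal_comb h_comb_right)

lemma h_scal_left: "h (scal a y) x = \<sigma> a * h y x"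
  by (simp add: scal_comb h_comb_left)

lemma h_zero_right [simp]: "h x (\<lambda>_. 0) = 0"
  by (simp add: h_def)

lemma h_hermitian: "\<sigma> (h x y) = h y x"
proof -
  have "h y x = (\<Sum>i<N. \<sigma> (y (N - Suc i)) * x (N - Suc (N - Suc i)))"
    unfolding h_def by (subst sum.nat_diff_reindex[symmetric]) simp
  also have "\<dots> = (\<Sum>i<N. \<sigma> (y (N - Suc i)) * x i)"
    by (rule sum.cong) (auto simp: Suc_diff_Suc)
  finally show ?thesis by (simp add: h_def \<sigma>.hom_sum \<sigma>.hom_mult mult.commute)
qed

lemma h_unit_left: "i < N \<Longrightarrow> h (unit_fun i) x = x (N - Suc i)"
proof -
  assume i: "i < N"
  have "h (unit_fun i) x = (\<Sum>k<N. if k = i then x (N - Suc k) else 0)"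
    unfolding h_def by (rule sum.cong) (auto simp: unit_fun_def)
  thus ?thesis using i by simp
qed

lemma h_ideal: "integral x \<Longrightarrow> (\<And>i. y i \<in> val_ideal w m) \<Longrightarrow> h x y \<in> val_ideal w m"
  unfolding h_def by (rule k'.ideal_sum) (auto simp: integral_def intro!: k'.ideal_mult_left)

lemma integral_unit: "integral (unit_fun i)"
  by (simp add: integral_def unit_fun_def)

lemma integral_comb: "a \<in> val_ring w \<Longrightarrow> b \<in> val_ring w \<Longrightarrow> integral x \<Longrightarrow> integral y \<Longrightarrow>
    integral (comb a x b y)"
  unfolding integral_def comb_def by (blast intro: k'.ideal_add k'.ideal_mult_left)

lemma integral_scal: "a \<in> val_ring w \<Longrightarrow> integral x \<Longrightarrow> integral (scal a x)"
  unfolding integral_def scal_def by (blast intro: k'.ideal_mult_left)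

lemma supp_comb: "supp x \<Longrightarrow> supp y \<Longrightarrow> supp (comb a x b y)"
  by (simp add: supp_def comb_def)

lemma supp_eqI:
  assumes "supp x" "supp y" "\<And>i. i < N \<Longrightarrow> h (unit_fun i) x = h (unit_fun i) y"
  shows "x = y"
proof
  fix i
  show "x i = y i"
  proof (cases "i < N")
    case True
    thus ?thesis using assms(3)[of "N - Suc i"] h_unit_left[of "N - Suc i"]
      by (simp add: Suc_diff_Suc)
  qed (use assms(1,2) in \<open>simp add: supp_def\<close>)
qed

text \<open>Each coordinate of \<open>T y\<close> is a value of \<open>h\<close> at a unit vector;
  moving \<open>T\<close> to that vector by adjointness leaves \<open>y\<close> bare, to be expanded
  in coordinates. So finitely many entries control the whole form, and a minimal valuation
  exists.\<close>

lemma h_expand: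
  assumes adj: "\<And>x y. h (T x) y = h x (T y)"
  shows "h x (T y) = (\<Sum>i<N. \<Sum>k<N. \<sigma> (x i) * (y k * h (unit_fun i) (T (unit_fun k))))"
proof -
  have *: "T y (N - Suc i) = (\<Sum>k<N. y k * h (unit_fun i) (T (unit_fun k)))" if i: "i < N" for i
  proof -
    have "T y (N - Suc i) = h (unit_fun i) (T y)" using i by (simp add: h_unit_left)
    also have "\<dots> = \<sigma> (h y (T (unit_fun i)))" by (simp add: h_hermitian adj)
    also have "\<dots> = (\<Sum>k<N. y k * \<sigma> (h (unit_fun k) (T (unit_fun i))))"
      by (simp add: h_def[of y] \<sigma>.hom_sum \<sigma>.hom_mult h_unit_left)
    also have "\<dots> = (\<Sum>k<N. y k * h (unit_fun i) (T (unit_fun k)))"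
      by (simp add: h_hermitian adj)
    finally show ?thesis .
  qed
  show ?thesis unfolding h_def[of x] by (rule sum.cong) (simp_all add: * sum_distrib_left)
qed

text \<open>Polarisation: a hermitian form attains its minimal valuation on the diagonal, because the
  trace of the ring of integers is surjective. This also holds in residual characteristic 2.\<close>

lemma hermitian_minimum:
  assumes lin: "lin_op T" and adj: "\<And>x y. h (T x) y = h x (T y)"
    and T0: "supp (T x0)" "T x0 \<noteq> (\<lambda>_. 0)"
  obtains m x where "integral x" "h x (T x) \<noteq> 0" "w (h x (T x)) = m"
    "\<And>x y. integral x \<Longrightarrow> integral y \<Longrightarrow> h x (T y) \<in> val_ideal w m"
proof -
  define t where "t i k = h (unit_fun i) (T (unit_fun k))" for i k
  have t_sym: "\<sigma> (t i k) = t k i" for i k by (simp add: t_def h_hermitian adj)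
  define S where "S = (\<lambda>(i, k). w (t i k)) ` {(i, k). i < N \<and> k < N \<and> t i k \<noteq> 0}"
  have "{(i, k). i < N \<and> k < N \<and> t i k \<noteq> 0} \<subseteq> {..<N} \<times> {..<N}" by auto
  hence fS: "finite S" unfolding S_def by (intro finite_imageI) (rule finite_subset, auto)
  have "S \<noteq> {}"
  proof
    assume "S = {}"
    hence "h (unit_fun i) (T x0) = 0" if "i < N" for i
      unfolding h_expand[OF adj, of "unit_fun i" x0] t_def[symmetric]
      by (intro sum.neutral) (auto simp: S_def)
    hence "T x0 = (\<lambda>_. 0)" by (intro supp_eqI T0(1)) (auto simp: supp_def)
    thus False using T0 by simp
  qed
  define m where "m = Min S"
  have "m \<in> S" unfolding m_def by (rule Min_in) fact+
  then obtain i k where ik: "i < N" "k < N" "t i k \<noteq> 0" "w (t i k) = m"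
    by (auto simp: S_def)
  have tm: "t i k \<in> val_ideal w m" if "i < N" "k < N" for i k
  proof (cases "t i k = 0")
    case False
    hence "w (t i k) \<in> S" using that by (force simp: S_def)
    thus ?thesis using fS by (simp add: val_ideal_def m_def)
  qed simp
  have all: "h x (T y) \<in> val_ideal w m" if "integral x" "integral y" for x y
    unfolding h_expand[OF adj, of x y] t_def[symmetric]
    by (intro k'.ideal_sum k'.ideal_mult_left tm) (use that in \<open>auto simp: integral_def\<close>)
  show thesis
  proof (cases "\<exists>l<N. t l l \<noteq> 0 \<and> w (t l l) = m")
    case True
    then obtain l where "t l l \<noteq> 0" "w (t l l) = m" by blast
    thus thesis using that[of "unit_fun l" m] all integral_unit by (simp add: t_def)
  next
    case False
    have diag: "t l l \<in> val_ideal w (m + 1)" if "l < N" for l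
      using tm[OF that that] False that by (auto simp: val_ideal_def)
    obtain \<theta> where \<theta>: "\<theta> \<in> val_ring w" "\<theta> + \<sigma> \<theta> = 1" by (rule trace_one)
    obtain q where q: "q \<noteq> 0" "w q = 1" "\<sigma> q = q" by (rule uniformizer)
    \<comment> \<open>Scaled so that the two cross terms of \<open>h x (T x)\<close> become
      \<open>\<theta> * q powi m\<close> and its conjugate. They add up to \<open>q powi m\<close>,
      which dominates the diagonal terms of valuation above \<open>m\<close>.\<close>
    define a where "a = \<theta> * (q powi m / t i k)"
    have a: "a \<in> val_ring w" unfolding a_def
      by (rule k'.ideal_mult_left[OF \<theta>(1)]) (use ik q in \<open>simp add: val_ideal_def k'.v_divide k'.v_power_int\<close>)
    define x where "x = comb 1 (unit_fun i) a (unit_fun k)"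
    have x: "integral x" unfolding x_def by (intro integral_comb a integral_unit) simp
    have at: "a * t i k = \<theta> * q powi m" using ik by (simp add: a_def)
    have "\<sigma> a * t k i = \<sigma> (a * t i k)" by (simp add: \<sigma>.hom_mult t_sym)
    also have "\<dots> = \<sigma> \<theta> * q powi m" by (simp add: at \<sigma>.hom_mult \<sigma>_powi q)
    finally have at': "\<sigma> a * t k i = \<sigma> \<theta> * q powi m" .
    have "h x (T x) = t i i + a * t i k + (\<sigma> a * t k i + \<sigma> a * a * t k k)"
      by (simp add: x_def lin_opD[OF lin] h_comb_left h_comb_right t_def algebra_simps)
    also have "\<dots> = (\<theta> + \<sigma> \<theta>) * q powi m + (t i i + \<sigma> a * a * t k k)"
      unfolding at at' by (simp add: algebra_simps)
    finally have e: "h x (T x) = q powi m + (t i i + \<sigma> a * a * t k k)" by (simp add: \<theta>)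
    have "t i i + \<sigma> a * a * t k k \<in> val_ideal w (m + 1)"
      by (intro k'.ideal_add k'.ideal_mult_left diag ik a) (simp add: a)
    from k'.v_add_eq[of "q powi m", OF _] this q
    have "h x (T x) \<noteq> 0" "w (h x (T x)) = m" by (simp_all add: e k'.v_power_int)
    thus thesis using that x all by blast
  qed
qed

end

section \<open>Stable orthogonal summands and their eigenvectors\<close>

locale hermitian_involution = unitary_setting v w \<iota> \<sigma> n
  for v :: "'k :: field_char_0 \<Rightarrow> int" and w :: "'l :: field \<Rightarrow> int" and \<iota> \<sigma> n +
  fixes Y :: "(nat \<Rightarrow> 'l) \<Rightarrow> nat \<Rightarrow> 'l"
  assumes Y_lin: "lin_op Y"
    and Y_supp: "supp (Y x)"
    and Y_adj: "h (Y x) y = h x (Y y)"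
    and Y_Y: "supp x \<Longrightarrow> Y (Y x) = x"
begin

text \<open>Stands for an orthogonal summand stable under \<open>Y\<close>: the range of
  \<open>E\<close>, whose orthogonal complement is the kernel.\<close>

definition projection :: "((nat \<Rightarrow> 'l) \<Rightarrow> nat \<Rightarrow> 'l) \<Rightarrow> bool" where
  "projection E \<longleftrightarrow> lin_op E \<and> (\<forall>x. supp (E x)) \<and> (\<forall>x. E (E x) = E x) \<and> (\<forall>x. Y (E x) = E (Y x)) \<and>
     (\<forall>x y. h (E x) y = h x (E y))"

lemma projectionD:
  assumes "projection E"
  shows "lin_op E" "supp (E x)" "E (E x) = E x" "E (Y x) = Y (E x)" "h (E x) y = h x (E y)"
  using assms by (auto simp: projection_def)

text \<open>The projection onto the whole space. Vectors are functions on all of \<open>nat\<close>,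
  so the identity would leave values from \<open>N\<close> onwards in place.\<close>

definition cutoff :: "(nat \<Rightarrow> 'l) \<Rightarrow> nat \<Rightarrow> 'l" where
  "cutoff x = (\<lambda>i. if i < N then x i else 0)"

lemma Y_cutoff: "Y (cutoff x) = Y x"
proof (rule supp_eqI[OF Y_supp Y_supp])
  have "h z (cutoff x) = h z x" for z by (simp add: h_def cutoff_def)
  thus "h (unit_fun i) (Y (cutoff x)) = h (unit_fun i) (Y x)" for i
    by (simp flip: Y_adj)
qed

lemma projection_cutoff: "projection cutoff"
  unfolding projection_def Y_cutoff
  using Y_supp by (auto simp: cutoff_def lin_op_def comb_def supp_def h_def fun_eq_iff)

lemma tr_cutoff: "tr cutoff = of_nat N" "tr (\<lambda>x. Y (cutoff x)) = tr Y"
  by (simp_all add: tr_def Y_cutoff) (simp add: cutoff_def unit_fun_def)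

text \<open>For \<open>E b = b\<close> and \<open>h b b \<noteq> 0\<close> this projects onto the
  complement of \<open>b\<close> in the range of \<open>E\<close>; adjointness gives
  \<open>h b x = h b (E x)\<close>.\<close>

definition split_off :: "((nat \<Rightarrow> 'l) \<Rightarrow> nat \<Rightarrow> 'l) \<Rightarrow> (nat \<Rightarrow> 'l) \<Rightarrow> (nat \<Rightarrow> 'l) \<Rightarrow> nat \<Rightarrow> 'l" where
  "split_off E b x = comb 1 (E x) (- (h b x / h b b)) b"

text \<open>The trace of the rank one operator sending \<open>z\<close> to
  \<open>scal (h x z) y\<close>; for \<open>x = y = b\<close> it tells by how much splitting off
  \<open>b\<close> lowers a trace.\<close>

lemma h_unit_right_sum: "(\<Sum>i<N. h x (unit_fun i) * y i) = h x y"
proof -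
  have "(\<Sum>i<N. h x (unit_fun i) * y i) =
      (\<Sum>i<N. \<sigma> (x (N - Suc i)) * y i)"
    by (rule sum.cong) (simp_all add: h_hermitian[of "unit_fun _", symmetric] h_unit_left)
  also have "\<dots> = h x y"
    unfolding h_def by (subst (2) sum.nat_diff_reindex[symmetric]) (auto intro!: sum.cong simp: Suc_diff_Suc)
  finally show ?thesis .
qed

context
  fixes E b \<epsilon>
  assumes E: "projection E" and b: "E b = b" "h b b \<noteq> 0" "Y b = scal \<epsilon> b" and \<epsilon>: "\<epsilon> = 1 \<or> \<epsilon> = -1"
begin

lemma supp_b: "supp b"
  using projectionD(2)[OF E, of b] b(1) by simp

lemma \<sigma>_hbb: "\<sigma> (h b b) = h b b" by (simp add: h_hermitian)

lemma \<sigma>_\<epsilon>: "\<sigma> \<epsilon> = \<epsilon>" using \<epsilon> by (auto simp: \<sigma>.hom_uminus)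

lemma projection_split_off: "projection (split_off E b)"
proof -
  note P = projectionD[OF E]
  have hb: "h b (E x) = h b x" for x using P(5)[of b x] b by simp
  have "lin_op (split_off E b)"
    using b(2) by (simp add: lin_op_def split_off_def lin_opD[OF P(1)] h_comb_right)
      (simp add: comb_def fun_eq_iff field_simps)
  moreover have "split_off E b (split_off E b x) = split_off E b x" for x
    using b by (simp add: split_off_def lin_opD[OF P(1)] h_comb_right P(3) hb)
      (simp add: comb_def fun_eq_iff)
  moreover have "Y (split_off E b x) = split_off E b (Y x)" for x
  proof -
    have "h b (Y x) = \<epsilon> * h b x" by (simp add: Y_adj[symmetric] b h_scal_left \<sigma>_\<epsilon>)
    thus ?thesis by (simp add: split_off_def lin_opD[OF Y_lin] P(4) b(3))
        (simp add: comb_def scal_def fun_eq_iff)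
  qed
  moreover have "h (split_off E b x) y = h x (split_off E b y)" for x y
    by (simp add: split_off_def h_comb_left h_comb_right P(5) \<sigma>_div \<sigma>_hbb h_hermitian \<sigma>.hom_uminus mult.commute)
  moreover have "supp (split_off E b x)" for x
    unfolding split_off_def by (intro supp_comb P supp_b)
  ultimately show ?thesis by (simp add: projection_def)
qed

lemma tr_split_off: "tr (split_off E b) = tr E - 1"
proof -
  have "tr (split_off E b) = tr E - (\<Sum>i<N. h b (unit_fun i) * b i) / h b b"
    by (simp add: tr_def split_off_def comb_def sum_subtractf sum_divide_distrib)
  thus ?thesis using b by (simp add: h_unit_right_sum)
qed

lemma tr_Y_split_off: "tr (\<lambda>x. Y (split_off E b x)) = tr (\<lambda>x. Y (E x)) - \<epsilon>"
proof -
  have "tr (\<lambda>x. Y (split_off E b x)) = tr (\<lambda>x. Y (E x)) - \<epsilon> * ((\<Sum>i<N. h b (unit_fun i) * b i) / h b b)"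
    by (simp add: tr_def split_off_def lin_opD[OF Y_lin] b(3)) (simp add: comb_def scal_def sum_subtractf
        sum_divide_distrib sum_distrib_left algebra_simps)
  thus ?thesis using b by (simp add: h_unit_right_sum)
qed

lemma split_off_kernel: "E z = (\<lambda>_. 0) \<Longrightarrow> split_off E b z = (\<lambda>_. 0)"
  using projectionD(5)[OF E, of b z] b by (simp add: split_off_def comb_def)

lemma split_off_self: "split_off E b b = (\<lambda>_. 0)"
  using b by (simp add: split_off_def comb_def)

lemma orthogonal_kernel: "E z = (\<lambda>_. 0) \<Longrightarrow> h z b = 0" "E z = (\<lambda>_. 0) \<Longrightarrow> h b z = 0"
proof -
  assume "E z = (\<lambda>_. 0)"
  thus *: "h b z = 0" using projectionD(5)[OF E, of b z] b by simp
  show "h z b = 0" using h_hermitian[of b z] * by simp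
qed

lemma split_off_range: "split_off E b z = z \<Longrightarrow> E z = z"
  using projectionD(1,3)[OF E] b by (metis split_off_def lin_opD)

end

text \<open>\<open>2 * \<epsilon>\<close> times the projection onto the
  \<open>\<epsilon>\<close>-eigenspace of \<open>Y\<close> in the range of \<open>E\<close>, for
  \<open>\<epsilon>\<close> equal to 1 or -1.\<close>

definition eigenpart :: "((nat \<Rightarrow> 'l) \<Rightarrow> nat \<Rightarrow> 'l) \<Rightarrow> 'l \<Rightarrow> (nat \<Rightarrow> 'l) \<Rightarrow> nat \<Rightarrow> 'l" where
  "eigenpart E \<epsilon> x = comb 1 (Y (E x)) \<epsilon> (E x)"

context
  fixes E and \<epsilon> :: 'l
  assumes E: "projection E" and \<epsilon>: "\<epsilon> = 1 \<or> \<epsilon> = -1"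
begin

lemma eigenpart_lin: "lin_op (eigenpart E \<epsilon>)"
  by (simp add: eigenpart_def lin_op_def lin_opD[OF Y_lin] lin_opD[OF projectionD(1)[OF E]])
    (simp add: comb_def algebra_simps)

lemma eigenpart_adj: "h (eigenpart E \<epsilon> x) y = h x (eigenpart E \<epsilon> y)"
  using \<epsilon> by (auto simp: eigenpart_def h_comb_left h_comb_right projectionD[OF E] Y_adj \<sigma>.hom_uminus)

lemma eigenpart_supp: "supp (eigenpart E \<epsilon> x)"
  unfolding eigenpart_def by (intro supp_comb Y_supp projectionD[OF E])

lemma eigenpart_range: "E (eigenpart E \<epsilon> x) = eigenpart E \<epsilon> x"
  by (simp add: eigenpart_def lin_opD[OF projectionD(1)[OF E]] projectionD(3,4)[OF E])

lemma eigenpart_eigen: "Y (eigenpart E \<epsilon> x) = scal \<epsilon> (eigenpart E \<epsilon> x)"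
  using \<epsilon> by (auto simp: eigenpart_def lin_opD[OF Y_lin] Y_Y[OF projectionD(2)[OF E]])
    (auto simp: comb_def scal_def fun_eq_iff)

lemma eigenpart_norm: "h (eigenpart E \<epsilon> x) (eigenpart E \<epsilon> x) = 2 * \<epsilon> * h x (eigenpart E \<epsilon> x)"
proof -
  have "eigenpart E \<epsilon> (eigenpart E \<epsilon> x) = scal (2 * \<epsilon>) (eigenpart E \<epsilon> x)"
    by (subst eigenpart_def) (simp add: eigenpart_range eigenpart_eigen,
      simp add: comb_def scal_def algebra_simps)
  thus ?thesis by (simp add: eigenpart_adj h_scal_right)
qed

text \<open>The expression in the hypothesis is the trace of \<open>eigenpart E \<epsilon>\<close>,
  that is \<open>2 * \<epsilon>\<close> times the dimension of the eigenspace. Later hypotheses of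
  this shape are dimension conditions.\<close>

lemma eigenpart_nonzero:
  assumes "tr (\<lambda>x. Y (E x)) + \<epsilon> * tr E \<noteq> 0"
  obtains x where "eigenpart E \<epsilon> x \<noteq> (\<lambda>_. 0)"
proof (rule ccontr)
  assume "\<not> thesis"
  with that have z: "\<And>x. eigenpart E \<epsilon> x = (\<lambda>_. 0)" by blast
  have "tr (\<lambda>x. Y (E x)) + \<epsilon> * tr E = tr (eigenpart E \<epsilon>)"
    by (simp add: tr_def eigenpart_def comb_def sum.distrib sum_distrib_left)
  thus False using assms z by (simp add: tr_def)
qed

text \<open>By polarisation the values \<open>h x (eigenpart E \<epsilon> x)\<close> do not all
  vanish, and up to the factor \<open>2 * \<epsilon>\<close> they are the norms of the eigenvectors
  \<open>eigenpart E \<epsilon> x\<close>.\<close>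

lemma eigenvector:
  assumes "tr (\<lambda>x. Y (E x)) + \<epsilon> * tr E \<noteq> 0"
  obtains b where "E b = b" "Y b = scal \<epsilon> b" "h b b \<noteq> 0"
proof -
  obtain x0 where "eigenpart E \<epsilon> x0 \<noteq> (\<lambda>_. 0)" by (rule eigenpart_nonzero[OF assms])
  then obtain x where "h x (eigenpart E \<epsilon> x) \<noteq> 0"
    by (rule hermitian_minimum[OF eigenpart_lin eigenpart_adj eigenpart_supp])
  thus thesis using that[of "eigenpart E \<epsilon> x"] eigenpart_range eigenpart_eigen eigenpart_norm[of x] \<epsilon> two_neq_0
    by auto
qed

end

lemma rescale:
  assumes "h b b \<noteq> 0" "d \<noteq> 0" "\<sigma> d = d" "even (w (h b b) - w d)"
  obtains c where "c \<noteq> 0" "h (scal c b) (scal c b) = d"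
proof -
  obtain c where c: "c * \<sigma> c = d / h b b" "c \<noteq> 0"
    using even_norm[of "d / h b b"] assms by (auto simp: \<sigma>_div h_hermitian k'.v_divide)
  show thesis by (rule that[of c])
      (use c assms in \<open>simp_all add: h_scal_left h_scal_right field_simps\<close>)
qed

lemma eigen_scal: "E b = b \<Longrightarrow> Y b = scal \<epsilon> b \<Longrightarrow> lin_op E \<Longrightarrow>
    E (scal c b) = scal c b \<and> Y (scal c b) = scal \<epsilon> (scal c b)"
  by (simp add: lin_op_scal[OF Y_lin] lin_op_scal scal_scal mult.commute)

text \<open>The two inequalities exclude eigenspaces of dimension 0 and 1. So there are two
  orthogonal anisotropic eigenvectors, and a binary hermitian form over k' represents 1 whatever the
  parities of its diagonal entries.\<close>

lemma eigenvector_norm_one: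
  assumes E: "projection E" and \<epsilon>: "\<epsilon> = 1 \<or> \<epsilon> = -1"
    and "tr (\<lambda>x. Y (E x)) + \<epsilon> * tr E \<noteq> 0" "tr (\<lambda>x. Y (E x)) + \<epsilon> * tr E \<noteq> 2 * \<epsilon>"
  obtains b where "E b = b" "Y b = scal \<epsilon> b" "h b b = 1"
proof -
  note lin = projectionD(1)[OF E]
  have scaled: thesis if "E b = b" "Y b = scal \<epsilon> b" "h b b \<noteq> 0" "even (w (h b b))" for b
  proof -
    obtain c where "h (scal c b) (scal c b) = 1" using rescale[of b 1] \<open>h b b \<noteq> 0\<close> \<open>even (w (h b b))\<close> by auto
    thus thesis using \<open>\<And>b. E b = b \<Longrightarrow> Y b = scal \<epsilon> b \<Longrightarrow> h b b = 1 \<Longrightarrow> thesis\<close> eigen_scal[OF that(1,2) lin] by blast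
  qed
  obtain b1 where b1: "E b1 = b1" "Y b1 = scal \<epsilon> b1" "h b1 b1 \<noteq> 0"
    by (rule eigenvector[OF E \<epsilon> assms(3)])
  define E' where "E' = split_off E b1"
  have E': "projection E'" unfolding E'_def by (rule projection_split_off[OF E b1(1,3,2) \<epsilon>])
  have "tr (\<lambda>x. Y (E' x)) + \<epsilon> * tr E' = tr (\<lambda>x. Y (E x)) + \<epsilon> * tr E - 2 * \<epsilon>"
    unfolding E'_def tr_split_off[OF E b1(1,3,2) \<epsilon>] tr_Y_split_off[OF E b1(1,3,2) \<epsilon>] by (simp add: algebra_simps)
  hence "tr (\<lambda>x. Y (E' x)) + \<epsilon> * tr E' \<noteq> 0" using assms(4) by simp
  then obtain b2 where b2': "E' b2 = b2" "Y b2 = scal \<epsilon> b2" "h b2 b2 \<noteq> 0"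
    by (rule eigenvector[OF E' \<epsilon>])
  have b2: "E b2 = b2"
    by (rule split_off_range[OF E b1(1,3,2) \<epsilon> b2'(1)[unfolded E'_def]])
  have orth: "h b1 b2 = 0" "h b2 b1 = 0"
  proof -
    have "h b1 b2 = h b1 (E' b2)" by (simp only: b2'(1))
    also have "\<dots> = h (E' b1) b2" by (rule projectionD(5)[OF E', symmetric])
    also have "\<dots> = 0" using split_off_self[OF E b1(1,3,2) \<epsilon>] by (simp add: E'_def h_def)
    finally show "h b1 b2 = 0" .
    thus "h b2 b1 = 0" using h_hermitian[of b1 b2] by simp
  qed
  show thesis
  proof (cases "even (w (h b1 b1)) \<or> even (w (h b2 b2))")
    case True
    thus thesis using scaled b1 b2 b2' by blast
  next
    case False
    text \<open>Once \<open>d\<^sup>2 s\<^sub>2\<close> has negative valuation, \<open>(1 - d\<^sup>2 s\<^sub>2) / s\<^sub>1\<close> has even valuation, hence is a norm.\<close>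
    define s1 where "s1 = h b1 b1"
    define s2 where "s2 = h b2 b2"
    obtain q where q: "q \<noteq> 0" "w q = 1" "\<sigma> q = q" by (rule uniformizer)
    define d where "d = q powi (- (\<bar>w s2\<bar>))"
    have d: "d \<noteq> 0" "\<sigma> d = d" "w d = - \<bar>w s2\<bar>"
      using q by (simp_all add: d_def \<sigma>_powi k'.v_power_int)
    have s0: "s1 \<noteq> 0" "s2 \<noteq> 0" "\<sigma> s1 = s1" "\<sigma> s2 = s2"
      using b1 b2' by (simp_all add: s1_def s2_def h_hermitian)
    have odds: "odd (w s1)" "odd (w s2)" using False by (simp_all add: s1_def s2_def)
    have wdd: "w (d * d * s2) = w s2 - 2 * \<bar>w s2\<bar>" using d s0 by (simp add: k'.v_mult)
    have "w s2 \<noteq> 0" using odds by auto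
    hence "w (d * d * s2) \<le> -1" using wdd by linarith
    hence *: "- (d * d * s2) + 1 \<noteq> 0" "w (- (d * d * s2) + 1) = w s2 - 2 * \<bar>w s2\<bar>"
      using k'.v_add_eq[of "- (d * d * s2)" 1] d s0 wdd by (auto simp: val_ideal_def)
    obtain c where c: "c * \<sigma> c = (- (d * d * s2) + 1) / s1"
    proof (rule even_norm)
      show "even (w ((- (d * d * s2) + 1) / s1))" using * s0 odds by (simp add: k'.v_divide)
      show "\<sigma> ((- (d * d * s2) + 1) / s1) = (- (d * d * s2) + 1) / s1"
        by (simp only: \<sigma>_div \<sigma>.hom_add \<sigma>.hom_uminus \<sigma>.hom_mult d s0 \<sigma>.hom_one)
    qed (use * s0 in auto)
    define b where "b = comb c b1 d b2"
    have "h b b = c * \<sigma> c * s1 + d * d * s2"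
      by (simp add: b_def h_comb_left h_comb_right orth d s1_def[symmetric] s2_def[symmetric] algebra_simps)
    hence "h b b = 1" using c s0 by simp
    moreover have "E b = b" by (simp add: b_def lin_opD[OF lin] b1 b2)
    moreover have "Y b = scal \<epsilon> b" by (simp add: b_def lin_opD[OF Y_lin] b1 b2')
        (simp add: comb_def scal_def algebra_simps)
    ultimately show thesis using that by blast
  qed
qed

end

section \<open>Orthogonal eigenbases\<close>

context hermitian_involution
begin

text \<open>Gram-Schmidt with bookkeeping: \<open>P\<close> is the demand on the vector in place
  \<open>i\<close>, and \<open>K\<close> constrains the trace of \<open>Y\<close> on the complement
  left after \<open>i\<close> steps, so that a step knows which eigenvalues remain.\<close>

lemma orthogonal_system:
  assumes K0: "K 0 (tr Y)"
    and step: "\<And>E i. projection E \<Longrightarrow> i < R \<Longrightarrow> tr E = of_nat N - of_nat i \<Longrightarrow>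
      K i (tr (\<lambda>x. Y (E x))) \<Longrightarrow> \<exists>b e. (e = 1 \<or> e = -1) \<and> E b = b \<and> Y b = scal e b \<and> h b b \<noteq> 0 \<and>
        P i e b \<and> K (Suc i) (tr (\<lambda>x. Y (E x)) - e)"
  obtains b e where
    "\<And>i. i < R \<Longrightarrow> (e i = 1 \<or> e i = -1) \<and> supp (b i) \<and> Y (b i) = scal (e i) (b i) \<and>
       h (b i) (b i) \<noteq> 0 \<and> P i (e i) (b i)"
    "\<And>i k. i < R \<Longrightarrow> k < R \<Longrightarrow> i \<noteq> k \<Longrightarrow> h (b i) (b k) = 0"
proof -
  have "\<exists>E b e. projection E \<and> tr E = of_nat N - of_nat r \<and> K r (tr (\<lambda>x. Y (E x))) \<and>
      (\<forall>i<r. (e i = 1 \<or> e i = -1) \<and> supp (b i) \<and> Y (b i) = scal (e i) (b i) \<and>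
         h (b i) (b i) \<noteq> 0 \<and> P i (e i) (b i) \<and> E (b i) = (\<lambda>_. 0)) \<and>
      (\<forall>i<r. \<forall>k<r. i \<noteq> k \<longrightarrow> h (b i) (b k) = 0)" if "r \<le> R" for r
    using that
  proof (induction r)
    case 0
    show ?case using projection_cutoff tr_cutoff K0 by (intro exI[of _ cutoff]) simp
  next
    case (Suc r)
    then obtain E b e where IH: "projection E" "tr E = of_nat N - of_nat r" "K r (tr (\<lambda>x. Y (E x)))"
      "\<And>i. i < r \<Longrightarrow> (e i = 1 \<or> e i = -1) \<and> supp (b i) \<and> Y (b i) = scal (e i) (b i) \<and>
         h (b i) (b i) \<noteq> 0 \<and> P i (e i) (b i) \<and> E (b i) = (\<lambda>_. 0)"
      "\<And>i k. i < r \<Longrightarrow> k < r \<Longrightarrow> i \<noteq> k \<Longrightarrow> h (b i) (b k) = 0"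
      using Suc_leD[OF Suc.prems] by blast
    obtain c f where c: "f = 1 \<or> f = -1" "E c = c" "Y c = scal f c" "h c c \<noteq> 0" "P r f c"
      "K (Suc r) (tr (\<lambda>x. Y (E x)) - f)"
      using step[OF IH(1) _ IH(2,3)] Suc.prems by auto
    note S = IH(1) c(2,4,3,1)
    define E' where "E' = split_off E c"
    have sc: "supp c" by (rule supp_b[OF S])
    have 1: "projection E'" unfolding E'_def by (rule projection_split_off[OF S])
    have 2: "tr E' = of_nat N - of_nat (Suc r)"
      unfolding E'_def tr_split_off[OF S] by (simp add: IH(2))
    have 3: "K (Suc r) (tr (\<lambda>x. Y (E' x)))"
      unfolding E'_def tr_Y_split_off[OF S] by (rule c)
    define b' where "b' = b(r := c)"
    define e' where "e' = e(r := f)"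
    have 4: "(e' i = 1 \<or> e' i = -1) \<and> supp (b' i) \<and> Y (b' i) = scal (e' i) (b' i) \<and>
         h (b' i) (b' i) \<noteq> 0 \<and> P i (e' i) (b' i) \<and> E' (b' i) = (\<lambda>_. 0)" if i: "i < Suc r" for i
    proof (cases "i = r")
      case True
      thus ?thesis using c sc split_off_self[OF S] by (simp add: b'_def e'_def E'_def)
    next
      case False
      hence i: "i < r" using i by simp
      have "E' (b i) = (\<lambda>_. 0)" unfolding E'_def using split_off_kernel[OF S] IH(4)[OF i] by blast
      thus ?thesis using IH(4)[OF i] i by (simp add: b'_def e'_def)
    qed
    have 5: "h (b' i) (b' k) = 0" if ik: "i < Suc r" "k < Suc r" "i \<noteq> k" for i k
    proof -
      have o: "h (b l) c = 0" "h c (b l) = 0" if "l < r" for l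
        using orthogonal_kernel[OF S, of "b l"] IH(4)[OF that] by auto
      show ?thesis using ik o IH(5)[of i k] by (auto simp: b'_def less_Suc_eq)
    qed
    show ?case using 1 2 3 4 5 by blast
  qed
  from this[OF order.refl] obtain b e where
    "\<And>i. i < R \<Longrightarrow> (e i = 1 \<or> e i = -1) \<and> supp (b i) \<and> Y (b i) = scal (e i) (b i) \<and>
       h (b i) (b i) \<noteq> 0 \<and> P i (e i) (b i)"
    "\<And>i k. i < R \<Longrightarrow> k < R \<Longrightarrow> i \<noteq> k \<Longrightarrow> h (b i) (b k) = 0" by blast
  thus thesis by (rule that)
qed

text \<open>The trace of \<open>Y\<close> is left open, as this basis serves to compute it together
  with the characteristic polynomial. The traces for the two signs differ by
  \<open>2 * tr E\<close>, so while \<open>tr E\<close> is nonzero one eigenvalue is still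
  available.\<close>

lemma eigenbasis:
  obtains b e where
    "\<And>i. i < N \<Longrightarrow> (e i = 1 \<or> e i = -1) \<and> supp (b i) \<and> Y (b i) = scal (e i) (b i) \<and> h (b i) (b i) \<noteq> 0"
    "\<And>i k. i < N \<Longrightarrow> k < N \<Longrightarrow> i \<noteq> k \<Longrightarrow> h (b i) (b k) = 0"
proof (rule orthogonal_system[of "\<lambda>_ _. True" "N" "\<lambda>_ _ _. True"])
  fix E i
  assume E: "projection E" and i: "i < N" and t: "tr E = of_nat N - of_nat i"
  have "tr E = of_nat (N - i)" using i unfolding t by (subst of_nat_diff) auto
  moreover have "of_nat (N - i) \<noteq> (0::'l)" using i by (simp only: of_nat_eq_0_iff_ext)
  ultimately have ne: "2 * tr E \<noteq> 0" using two_neq_0 by (metis mult_eq_0_iff)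
  have "tr (\<lambda>x. Y (E x)) + 1 * tr E \<noteq> 0 \<or> tr (\<lambda>x. Y (E x)) + (-1) * tr E \<noteq> 0"
  proof (rule ccontr)
    assume "\<not> ?thesis"
    hence "tr (\<lambda>x. Y (E x)) + tr E = 0" "tr (\<lambda>x. Y (E x)) - tr E = 0" by auto
    moreover have "2 * tr E = (tr (\<lambda>x. Y (E x)) + tr E) - (tr (\<lambda>x. Y (E x)) - tr E)"
      by (simp only: mult_2) (simp add: algebra_simps)
    ultimately show False using ne by simp
  qed
  then obtain e where e: "e = 1 \<or> e = -1" "tr (\<lambda>x. Y (E x)) + e * tr E \<noteq> 0" by blast
  obtain b where "E b = b" "Y b = scal e b" "h b b \<noteq> 0" by (rule eigenvector[OF E e])
  thus "\<exists>b e. (e = 1 \<or> e = -1) \<and> E b = b \<and> Y b = scal e b \<and> h b b \<noteq> 0 \<and> True \<and> True"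
    using e by blast
qed auto

text \<open>Places \<open>n - 1\<close> and \<open>N - 1\<close> are the last of their blocks: there
  the remaining eigenspace is a line, whose norm can be adjusted only within its parity, so 1 and
  \<open>q\<close> must both be allowed.\<close>

lemma normalised_eigenbasis:
  assumes n: "n \<noteq> 0" and trY: "tr Y = 0" and q: "q \<noteq> 0" "w q = 1" "\<sigma> q = q"
  obtains b where
    "\<And>i. i < N \<Longrightarrow> supp (b i) \<and> Y (b i) = scal (if i < n then 1 else -1) (b i)"
    "\<And>i. i < N \<Longrightarrow> i \<noteq> n - 1 \<Longrightarrow> i \<noteq> N - 1 \<Longrightarrow> h (b i) (b i) = 1"
    "h (b (n - 1)) (b (n - 1)) \<in> {1, q}" "h (b (N - 1)) (b (N - 1)) \<in> {1, q}"
    "\<And>i k. i < N \<Longrightarrow> k < N \<Longrightarrow> i \<noteq> k \<Longrightarrow> h (b i) (b k) = 0"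
proof -
  define s :: "nat \<Rightarrow> 'l" where "s i = (if i < n then 1 else -1)" for i
  have sums: "(\<Sum>k<i. s k) = (if i < n then of_nat i else of_nat N - of_nat i)" for i
    by (induction i) (auto simp: s_def not_less_eq less_Suc_eq of_nat_Suc)
  define P where "P i e b \<longleftrightarrow> e = s i \<and> (if i = n - 1 \<or> i = N - 1 then h b b \<in> {1, q} else h b b = 1)" for i e b
  define K where "K i t \<longleftrightarrow> t = - (\<Sum>k<i. s k)" for i t
  have K0: "K 0 (tr Y)" by (simp add: K_def trY)
  have step: "\<exists>b e. (e = 1 \<or> e = -1) \<and> E b = b \<and> Y b = scal e b \<and> h b b \<noteq> 0 \<and>
        P i e b \<and> K (Suc i) (tr (\<lambda>x. Y (E x)) - e)"
    if E: "projection E" and i: "i < N" and t: "tr E = of_nat N - of_nat i"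
      and K: "K i (tr (\<lambda>x. Y (E x)))" for E i
  proof -
    have e: "s i = 1 \<or> s i = -1" by (simp add: s_def)
    have K': "K (Suc i) (tr (\<lambda>x. Y (E x)) - s i)" using K by (simp add: K_def)
    \<comment> \<open>\<open>n - i\<close> or \<open>N - i\<close> is the dimension still left in
      the eigenspace of \<open>s i\<close>; it is 1 exactly at the last place of a block.\<close>
    have tot: "tr (\<lambda>x. Y (E x)) + s i * tr E = s i * (2 * of_nat (if i < n then n - i else N - i))"
      using K i unfolding K_def sums t by (auto simp: s_def of_nat_diff algebra_simps)
    have ne0: "tr (\<lambda>x. Y (E x)) + s i * tr E \<noteq> 0"
      unfolding tot using e i two_neq_0 by (auto split: if_splits)
    show ?thesis
    proof (cases "i = n - 1 \<or> i = N - 1")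
      case False
      have "tr (\<lambda>x. Y (E x)) + s i * tr E \<noteq> 2 * s i"
      proof
        assume "tr (\<lambda>x. Y (E x)) + s i * tr E = 2 * s i"
        hence "s i * (2 * of_nat (if i < n then n - i else N - i)) = s i * (2 * 1)" unfolding tot by simp
        hence "of_nat (if i < n then n - i else N - i) = (1 :: 'l)" using e two_neq_0 by auto
        hence "of_nat ((if i < n then n - i else N - i) - 1) = (0 :: 'l)"
          using i by (subst of_nat_diff) auto
        thus False using False i by (auto simp: of_nat_eq_0_iff_ext split: if_splits simp del: of_nat_diff)
      qed
      then obtain b where b: "E b = b" "Y b = scal (s i) b" "h b b = 1"
        by (rule eigenvector_norm_one[OF E e ne0])
      thus ?thesis using e K' False by (intro exI[of _ b] exI[of _ "s i"]) (simp add: P_def)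
    next
      case True
      obtain b where b: "E b = b" "Y b = scal (s i) b" "h b b \<noteq> 0" by (rule eigenvector[OF E e ne0])
      have "\<exists>d\<in>{1, q}. even (w (h b b) - w d)" using q by auto
      then obtain d where d: "d \<in> {1, q}" "even (w (h b b) - w d)" by blast
      have "d \<noteq> 0" "\<sigma> d = d" using d(1) q by auto
      then obtain c where c: "h (scal c b) (scal c b) = d" using rescale[OF b(3) _ _ d(2)] by blast
      have "E (scal c b) = scal c b \<and> Y (scal c b) = scal (s i) (scal c b)"
        by (rule eigen_scal[OF b(1,2) projectionD(1)[OF E]])
      thus ?thesis using e K' True c d(1) q by (intro exI[of _ "scal c b"] exI[of _ "s i"]) (auto simp: P_def)
    qed
  qed
  show thesis
  proof (rule orthogonal_system[of K "N" P])
    fix b e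
    assume be:
      "\<And>i. i < N \<Longrightarrow> (e i = 1 \<or> e i = -1) \<and> supp (b i) \<and> Y (b i) = scal (e i) (b i) \<and>
         h (b i) (b i) \<noteq> 0 \<and> P i (e i) (b i)"
      "\<And>i k. i < N \<Longrightarrow> k < N \<Longrightarrow> i \<noteq> k \<Longrightarrow> h (b i) (b k) = 0"
    show thesis
    proof (rule that[of b])
      show "supp (b i) \<and> Y (b i) = scal (if i < n then 1 else -1) (b i)" if "i < N" for i
        using be(1)[OF that] by (simp add: P_def s_def)
      show "h (b i) (b i) = 1" if "i < N" "i \<noteq> n - 1" "i \<noteq> N - 1" for i
        using be(1)[OF that(1)] that by (simp add: P_def)
      show "h (b (n - 1)) (b (n - 1)) \<in> {1, q}" using be(1)[of "n - 1"] n by (simp add: P_def)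
      show "h (b (N - 1)) (b (N - 1)) \<in> {1, q}" using be(1)[of "N - 1"] n by (simp add: P_def)
    qed (use be(2) in blast)
  qed (use K0 step in blast)+
qed

end


section \<open>Matrices\<close>

declare index_mult_mat(1) [simp del]

lemma index_mult_sum: "A \<in> carrier_mat m k \<Longrightarrow> B \<in> carrier_mat k l \<Longrightarrow> i < m \<Longrightarrow> j < l \<Longrightarrow>
    (A * B) $$ (i, j) = (\<Sum>r<k. A $$ (i, r) * B $$ (r, j))"
  by (auto simp: index_mult_mat(1) scalar_prod_def lessThan_atLeast0 intro!: sum.cong)

lemma det_mat_diag: "det (mat_diag m f) = prod f {..<m}" for f :: "nat \<Rightarrow> 'a :: idom"
proof -
  have "det (mat_diag m f) = prod_list (diag_mat (mat_diag m f))"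
    by (rule det_upper_triangular[of _ m]) (auto simp: upper_triangular_def mat_diag_def)
  also have "diag_mat (mat_diag m f) = map f [0..<m]"
    by (auto simp: diag_mat_def mat_diag_def intro!: map_cong)
  finally show ?thesis by (simp add: prod.list_conv_set_nth lessThan_atLeast0
      flip: prod.distinct_set_conv_list)
qed

lemma inverse_matrix:
  fixes A :: "'a :: field mat"
  assumes "A \<in> carrier_mat m m" "B \<in> carrier_mat m m" "A * B = 1\<^sub>m m"
  shows "B * A = 1\<^sub>m m"
  by (rule mat_mult_left_right_inverse[OF assms])

context unitary_setting
begin

abbreviation ct :: "'l mat \<Rightarrow> 'l mat" where "ct \<equiv> conj_transpose \<sigma>"
abbreviation J :: "'l mat" where "J \<equiv> antidiag_mat N"
abbreviation M :: "'l mat set" where "M \<equiv> carrier_mat N N"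
abbreviation G :: "'l mat set" where "G \<equiv> unitary_group \<sigma> n"
abbreviation X :: "'l mat set" where "X \<equiv> unitary_hermitian \<sigma> n"

definition colf :: "'l mat \<Rightarrow> nat \<Rightarrow> nat \<Rightarrow> 'l" where
  "colf A k = (\<lambda>i. if i < N then A $$ (i, k) else 0)"

definition Mop :: "'l mat \<Rightarrow> (nat \<Rightarrow> 'l) \<Rightarrow> nat \<Rightarrow> 'l" where
  "Mop A x = (\<lambda>i. if i < N then \<Sum>k<N. A $$ (i, k) * x k else 0)"

definition of_cols :: "(nat \<Rightarrow> nat \<Rightarrow> 'l) \<Rightarrow> 'l mat" where
  "of_cols b = mat N N (\<lambda>(i, k). b k i)"

lemma J_carrier [simp]: "J \<in> M"
  by (simp add: antidiag_mat_def)

lemma ct_dim [simp]: "dim_row (ct A) = dim_col A" "dim_col (ct A) = dim_row A"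
  by (simp_all add: conj_transpose_def)

lemma ct_carrier [simp]: "A \<in> carrier_mat k l \<Longrightarrow> ct A \<in> carrier_mat l k"
  by (simp add: conj_transpose_def)

lemma ct_index: "A \<in> carrier_mat k l \<Longrightarrow> i < l \<Longrightarrow> j < k \<Longrightarrow> ct A $$ (i, j) = \<sigma> (A $$ (j, i))"
  by (auto simp: conj_transpose_def)

lemma ct_ct [simp]: "ct (ct A) = A"
  by (rule eq_matI) (auto simp: conj_transpose_def)

lemma ct_mult: "A \<in> carrier_mat k l \<Longrightarrow> B \<in> carrier_mat l m \<Longrightarrow> ct (A * B) = ct B * ct A"
  by (rule eq_matI) (auto simp: ct_index[of _ k m] index_mult_sum[of A k l B m] index_mult_sum[of "ct B" m l "ct A" k]
    ct_index[of A k l] ct_index[of B l m] \<sigma>.hom_sum \<sigma>.hom_mult mult.commute intro!: sum.cong)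

lemma ct_mult_M: "A \<in> M \<Longrightarrow> B \<in> M \<Longrightarrow> ct (A * B) = ct B * ct A"
  by (rule ct_mult)

lemma ct_one [simp]: "ct (1\<^sub>m m) = 1\<^sub>m m"
  by (rule eq_matI) (auto simp: conj_transpose_def)

lemma ct_J [simp]: "ct J = J"
  by (rule eq_matI) (auto simp: conj_transpose_def antidiag_mat_def add.commute)

lemma det_ct: "A \<in> carrier_mat m m \<Longrightarrow> det (ct A) = \<sigma> (det A)"
  by (simp add: conj_transpose_def det_transpose)

lemma mult_J_index: "A \<in> M \<Longrightarrow> i < N \<Longrightarrow> j < N \<Longrightarrow> (A * J) $$ (i, j) = A $$ (i, N - Suc j)"
proof -
  assume a: "A \<in> M" "i < N" "j < N"
  have "(A * J) $$ (i, j) = (\<Sum>r<N. A $$ (i, r) * J $$ (r, j))"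
    by (rule index_mult_sum[OF a(1) J_carrier a(2,3)])
  also have "\<dots> = (\<Sum>r<N. if r = N - Suc j then A $$ (i, r) else 0)"
    by (rule sum.cong) (use a in \<open>auto simp: antidiag_mat_def\<close>)
  also have "\<dots> = A $$ (i, N - Suc j)" using a by simp
  finally show ?thesis .
qed

lemma J_mult_index: "A \<in> M \<Longrightarrow> i < N \<Longrightarrow> j < N \<Longrightarrow> (J * A) $$ (i, j) = A $$ (N - Suc i, j)"
proof -
  assume a: "A \<in> M" "i < N" "j < N"
  have "(J * A) $$ (i, j) = (\<Sum>r<N. J $$ (i, r) * A $$ (r, j))"
    by (rule index_mult_sum[OF J_carrier a])
  also have "\<dots> = (\<Sum>r<N. if r = N - Suc i then A $$ (r, j) else 0)"
    by (rule sum.cong) (use a in \<open>auto simp: antidiag_mat_def\<close>)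
  also have "\<dots> = A $$ (N - Suc i, j)" using a by simp
  finally show ?thesis .
qed

lemma JJ [simp]: "J * J = 1\<^sub>m N"
  by (rule eq_matI) (auto simp: J_mult_index[OF J_carrier], auto simp: antidiag_mat_def)

lemma JJ_left [simp]: "A \<in> M \<Longrightarrow> J * (J * A) = A"
  by (simp flip: assoc_mult_mat[OF J_carrier J_carrier])

lemmas M_assoc = assoc_mult_mat[of _ "N" "N" _ "N" _ "N"]

lemma M_mult [simp]: "A \<in> M \<Longrightarrow> B \<in> M \<Longrightarrow> A * B \<in> M"
  by simp

lemma M_one [simp]: "A \<in> M \<Longrightarrow> 1\<^sub>m N * A = A" "A \<in> M \<Longrightarrow> A * 1\<^sub>m N = A"
  by simp_all

text \<open>Invertibility is automatic: the relation itself exhibits \<open>J * ct g * J\<close> as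
  the inverse.\<close>

lemma unitary_iff: "g \<in> G \<longleftrightarrow> g \<in> M \<and> ct g * J * g = J"
proof
  assume "g \<in> G"
  thus "g \<in> M \<and> ct g * J * g = J" by (simp add: unitary_group_def GL_over_def)
next
  assume g: "g \<in> M \<and> ct g * J * g = J"
  hence i: "J * ct g * J \<in> M" and "(J * ct g * J) * g = 1\<^sub>m N"
    by (simp_all add: M_assoc)
  moreover from this have "g * (J * ct g * J) = 1\<^sub>m N" using g inverse_matrix by blast
  ultimately have "g \<in> GL_over UNIV N" using g unfolding GL_over_def by blast
  thus "g \<in> G" using g by (simp add: unitary_group_def)
qed

lemma unitary_inverse:
  assumes "g \<in> G"
  shows "g \<in> M" "J * ct g * J * g = 1\<^sub>m N" "g * (J * ct g * J) = 1\<^sub>m N" "g * J * ct g = J"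
    "J * ct g * J \<in> G"
proof -
  show g: "g \<in> M" using assms by (simp add: unitary_iff)
  show 1: "J * ct g * J * g = 1\<^sub>m N" using assms by (simp add: unitary_iff M_assoc)
  show 2: "g * (J * ct g * J) = 1\<^sub>m N" by (rule inverse_matrix[OF _ g 1]) (simp add: g)
  have "g * J * ct g = g * (J * ct g * J) * J" using g by (simp add: M_assoc)
  thus 3: "g * J * ct g = J" unfolding 2 by simp
  show "J * ct g * J \<in> G"
  proof -
    have "ct (J * ct g * J) * J * (J * ct g * J) = J * (g * J * ct g) * J"
      using g by (simp add: ct_mult_M M_assoc)
    also have "\<dots> = J" unfolding 3 by simp
    finally show ?thesis using g by (simp add: unitary_iff)
  qed
qed

lemma unitary_mult: assumes "g \<in> G" "g' \<in> G" shows "g * g' \<in> G"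
proof -
  have g: "g \<in> M" "g' \<in> M" and u: "ct g * J * g = J" "ct g' * J * g' = J"
    using assms by (simp_all add: unitary_iff)
  have "ct (g * g') * J * (g * g') = ct g' * ((ct g * J * g) * g')"
    using g by (simp add: ct_mult_M M_assoc)
  also have "\<dots> = J" unfolding u using g u by (simp add: M_assoc)
  finally show ?thesis using g by (simp add: unitary_iff)
qed

lemma one_unitary: "1\<^sub>m N \<in> G"
  by (simp add: unitary_iff)

lemma h_matrix:
  assumes A: "A \<in> M" and B: "B \<in> M" and ik: "i < N" "k < N"
  shows "(ct A * J * B) $$ (i, k) = h (colf A i) (colf B k)"
proof -
  have JB: "(J * B) \<in> M" using B by simp
  have "(ct A * J * B) $$ (i, k) = (ct A * (J * B)) $$ (i, k)"
    using A B by (simp add: M_assoc)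
  also have "\<dots> = (\<Sum>r<N. ct A $$ (i, r) * (J * B) $$ (r, k))"
    by (rule index_mult_sum[OF ct_carrier[OF A] JB ik])
  also have "\<dots> = h (colf A i) (colf B k)" unfolding h_def
    by (rule sum.cong) (use A ik in \<open>simp_all add: ct_index[OF A] J_mult_index[OF B] colf_def\<close>)
  finally show ?thesis .
qed

lemma colf_of_cols: "k < N \<Longrightarrow> supp (b k) \<Longrightarrow> colf (of_cols b) k = b k"
  by (auto simp: colf_def of_cols_def supp_def fun_eq_iff)

lemma of_cols_dim [simp]: "dim_row (of_cols b) = N" "dim_col (of_cols b) = N"
  by (simp_all add: of_cols_def)

lemma of_cols_carrier [simp]: "of_cols b \<in> M"
  by (simp add: of_cols_def)

lemma colf_eqI:
  assumes "A \<in> M" "B \<in> M" "\<And>k. k < N \<Longrightarrow> colf A k = colf B k"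
  shows "A = B"
proof (rule eq_matI)
  fix i j assume "i < dim_row B" "j < dim_col B"
  thus "A $$ (i, j) = B $$ (i, j)" using assms(1,2) fun_cong[OF assms(3)[of j], of i] by (simp add: colf_def)
qed (use assms in auto)

lemma colf_mult: "A \<in> M \<Longrightarrow> B \<in> M \<Longrightarrow> k < N \<Longrightarrow> colf (A * B) k = Mop A (colf B k)"
  by (auto simp: colf_def Mop_def fun_eq_iff index_mult_sum[of A "N" "N" B]
    intro!: sum.cong)

lemma colf_mult_diag: "A \<in> M \<Longrightarrow> k < N \<Longrightarrow> colf (A * mat_diag N f) k = scal (f k) (colf A k)"
proof -
  assume a: "A \<in> M" "k < N"
  have "(A * mat_diag N f) $$ (i, k) = f k * A $$ (i, k)" if i: "i < N" for i
  proof -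
    have "(A * mat_diag N f) $$ (i, k) = (\<Sum>r<N. A $$ (i, r) * mat_diag N f $$ (r, k))"
      by (rule index_mult_sum[OF a(1) mat_diag_dim i a(2)])
    also have "\<dots> = (\<Sum>r<N. if r = k then f k * A $$ (i, r) else 0)"
      by (rule sum.cong) (use a in \<open>auto simp: mat_diag_def\<close>)
    finally show ?thesis using a by simp
  qed
  thus ?thesis by (auto simp: colf_def scal_def fun_eq_iff)
qed

lemma Mop_lin: "lin_op (Mop A)"
  by (simp add: lin_op_def Mop_def comb_def fun_eq_iff sum.distrib sum_distrib_left algebra_simps)

lemma Mop_supp: "supp (Mop A x)"
  by (simp add: supp_def Mop_def)

lemma Mop_mult: "A \<in> M \<Longrightarrow> B \<in> M \<Longrightarrow> Mop (A * B) x = Mop A (Mop B x)"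
proof -
  assume a: "A \<in> M" "B \<in> M"
  have "Mop (A * B) x i = Mop A (Mop B x) i" if i: "i < N" for i
  proof -
    have "Mop (A * B) x i = (\<Sum>k<N. \<Sum>r<N. A $$ (i, r) * B $$ (r, k) * x k)"
      using i by (simp add: Mop_def index_mult_sum[OF a] sum_distrib_right)
    also have "\<dots> = (\<Sum>r<N. \<Sum>k<N. A $$ (i, r) * B $$ (r, k) * x k)" by (rule sum.swap)
    also have "\<dots> = Mop A (Mop B x) i" using i by (simp add: Mop_def sum_distrib_left mult.assoc)
    finally show ?thesis .
  qed
  thus ?thesis by (auto simp: Mop_def fun_eq_iff)
qed

lemma Mop_one: "supp x \<Longrightarrow> Mop (1\<^sub>m N) x = x"
proof -
  assume x: "supp x"
  have "(\<Sum>k<N. 1\<^sub>m N $$ (i, k) * x k) = x i" if i: "i < N" for i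
  proof -
    have "(\<Sum>k<N. 1\<^sub>m N $$ (i, k) * x k) = (\<Sum>k<N. if k = i then x k else 0)"
      by (rule sum.cong) (use i in auto)
    thus ?thesis using i by simp
  qed
  thus ?thesis using x by (auto simp: Mop_def supp_def fun_eq_iff)
qed

lemma h_Mop: "A \<in> M \<Longrightarrow> h (Mop A x) y = h x (Mop (J * ct A * J) y)"
proof -
  assume A: "A \<in> M"
  have "h (Mop A x) y = (\<Sum>i<N. \<Sum>k<N. \<sigma> (A $$ (i, k)) * \<sigma> (x k) * y (N - Suc i))"
    by (simp add: h_def Mop_def \<sigma>.hom_sum \<sigma>.hom_mult sum_distrib_right)
  also have "\<dots> = (\<Sum>k<N. \<Sum>i<N. \<sigma> (A $$ (i, k)) * \<sigma> (x k) * y (N - Suc i))" by (rule sum.swap)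
  also have "\<dots> = (\<Sum>k<N. \<sigma> (x k) * (\<Sum>i<N. \<sigma> (A $$ (N - Suc i, k)) * y i))"
  proof (rule sum.cong[OF refl])
    fix k assume "k \<in> {..<N}"
    have "(\<Sum>i<N. \<sigma> (A $$ (i, k)) * y (N - Suc i)) =
        (\<Sum>i<N. \<sigma> (A $$ (N - Suc i, k)) * y (N - Suc (N - Suc i)))"
      by (subst sum.nat_diff_reindex[symmetric]) simp
    also have "\<dots> = (\<Sum>i<N. \<sigma> (A $$ (N - Suc i, k)) * y i)"
      by (rule sum.cong) (auto simp: Suc_diff_Suc)
    finally have "(\<Sum>i<N. \<sigma> (A $$ (i, k)) * y (N - Suc i)) =
        (\<Sum>i<N. \<sigma> (A $$ (N - Suc i, k)) * y i)" .
    thus "(\<Sum>i<N. \<sigma> (A $$ (i, k)) * \<sigma> (x k) * y (N - Suc i)) =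
        \<sigma> (x k) * (\<Sum>i<N. \<sigma> (A $$ (N - Suc i, k)) * y i)"
      by (simp only: sum_distrib_left[symmetric] mult.commute[of _ "\<sigma> (x k)"] mult.assoc)
  qed
  also have "\<dots> = h x (Mop (J * ct A * J) y)"
    unfolding h_def
  proof (rule sum.cong[OF refl])
    fix k assume k: "k \<in> {..<N}"
    have "(J * ct A * J) $$ (N - Suc k, i) = \<sigma> (A $$ (N - Suc i, k))" if "i < N" for i
      using k that A by (simp add: mult_J_index J_mult_index ct_index[OF A] Suc_diff_Suc)
    thus "\<sigma> (x k) * (\<Sum>i<N. \<sigma> (A $$ (N - Suc i, k)) * y i) =
        \<sigma> (x k) * Mop (J * ct A * J) y (N - Suc k)"
      using k by (simp add: Mop_def)
  qed
  finally show ?thesis .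
qed

lemma tr_Mop: "tr (Mop A) = (\<Sum>i<N. A $$ (i, i))"
proof -
  have "Mop A (unit_fun i) i = A $$ (i, i)" if i: "i < N" for i
  proof -
    have "(\<Sum>k<N. A $$ (i, k) * unit_fun i k) = (\<Sum>k<N. if k = i then A $$ (i, k) else 0)"
      by (rule sum.cong) (auto simp: unit_fun_def)
    thus ?thesis using i by (simp add: Mop_def)
  qed
  thus ?thesis by (simp add: tr_def)
qed

lemma trace_mult: assumes "A \<in> M" "B \<in> M" shows "tr (Mop (A * B)) = tr (Mop (B * A))"
proof -
  have "tr (Mop (A * B)) = (\<Sum>i<N. \<Sum>k<N. A $$ (i, k) * B $$ (k, i))"
    using assms by (simp add: tr_Mop index_mult_sum[OF assms])
  also have "\<dots> = (\<Sum>k<N. \<Sum>i<N. A $$ (i, k) * B $$ (k, i))" by (rule sum.swap)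
  also have "\<dots> = tr (Mop (B * A))"
    using assms by (simp add: tr_Mop index_mult_sum[OF assms(2,1)] mult.commute)
  finally show ?thesis .
qed

lemma hermitian_involutionI:
  assumes x: "x \<in> M" "ct x = x" "x * J * x = J"
  shows "hermitian_involution v w \<iota> \<sigma> n (Mop (x * J))"
proof unfold_locales
  have xJ: "x * J \<in> M" using x by simp
  show "lin_op (Mop (x * J))" by (rule Mop_lin)
  show "supp (Mop (x * J) y)" for y by (rule Mop_supp)
  have "J * ct (x * J) * J = x * J" using x by (simp add: ct_mult_M M_assoc)
  thus "h (Mop (x * J) y) z = h y (Mop (x * J) z)" for y z by (simp add: h_Mop[OF xJ])
  have "x * J * (x * J) = x * J * x * J" using x(1) by (simp add: M_assoc)
  also have "\<dots> = 1\<^sub>m N" unfolding x(3) by simp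
  finally show "Mop (x * J) (Mop (x * J) y) = y" if "supp y" for y
    using that by (simp add: Mop_mult[OF xJ xJ, symmetric] Mop_one)
qed

lemma orthogonal_basis_matrix:
  assumes "\<And>i. i < N \<Longrightarrow> supp (b i) \<and> h (b i) (b i) \<noteq> 0"
    and "\<And>i k. i < N \<Longrightarrow> k < N \<Longrightarrow> i \<noteq> k \<Longrightarrow> h (b i) (b k) = 0"
  shows "ct (of_cols b) * J * of_cols b = mat_diag N (\<lambda>i. h (b i) (b i))"
    and "\<exists>C\<in>M. C * of_cols b = 1\<^sub>m N \<and> of_cols b * C = 1\<^sub>m N \<and>
      C = mat_diag N (\<lambda>i. inverse (h (b i) (b i))) * (ct (of_cols b) * J)"
proof -
  have c: "ct (of_cols b) * J * of_cols b \<in> M" by simp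
  show 1: "ct (of_cols b) * J * of_cols b = mat_diag N (\<lambda>i. h (b i) (b i))"
    by (rule eq_matI) (use assms c in \<open>auto simp: h_matrix colf_of_cols mat_diag_def\<close>)
  define C where "C = mat_diag N (\<lambda>i. inverse (h (b i) (b i))) * (ct (of_cols b) * J)"
  have C: "C \<in> M" by (simp add: C_def)
  have "C * of_cols b = mat_diag N (\<lambda>i. inverse (h (b i) (b i))) * (ct (of_cols b) * J * of_cols b)"
    unfolding C_def by (rule assoc_mult_mat[of _ "N" "N" _ "N" _ "N"]) simp_all
  also have "\<dots> = mat_diag N (\<lambda>i. inverse (h (b i) (b i)) * h (b i) (b i))"
    unfolding 1 mat_diag_diag ..
  also have "\<dots> = 1\<^sub>m N" using assms(1) by (auto simp: mat_diag_def)
  finally have CB: "C * of_cols b = 1\<^sub>m N" .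
  show "\<exists>C\<in>M. C * of_cols b = 1\<^sub>m N \<and> of_cols b * C = 1\<^sub>m N \<and>
      C = mat_diag N (\<lambda>i. inverse (h (b i) (b i))) * (ct (of_cols b) * J)"
    using C CB inverse_matrix[OF C of_cols_carrier CB] C_def by blast
qed

lemma orthogonal_expansion:
  assumes b: "\<And>i. i < N \<Longrightarrow> supp (b i) \<and> h (b i) (b i) \<noteq> 0"
    and "\<And>i k. i < N \<Longrightarrow> k < N \<Longrightarrow> i \<noteq> k \<Longrightarrow> h (b i) (b k) = 0" and x: "supp x"
  shows "h y x = (\<Sum>l<N. h (b l) x / h (b l) (b l) * h y (b l))"
proof (cases "n = 0")
  case False
  define D where "D = mat_diag N (\<lambda>i. inverse (h (b i) (b i)))"
  define B where "B = of_cols b"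
  have "\<exists>C\<in>M. C * B = 1\<^sub>m N \<and> B * C = 1\<^sub>m N \<and> C = D * (ct B * J)"
    unfolding B_def D_def by (rule orthogonal_basis_matrix(2)[OF assms(1,2)])
  then obtain C where C: "C \<in> M" "B * C = 1\<^sub>m N" "C = D * (ct B * J)" by blast
  have M: "B \<in> M" "D \<in> M" by (simp_all add: B_def D_def)
  \<comment> \<open>All columns of \<open>Y\<close> are \<open>y\<close> and all columns of
    \<open>Z\<close> are \<open>x\<close>, so the claim is the entry \<open>(0, 0)\<close> of the
    matrix identity obtained by inserting \<open>B * C\<close>. That entry exists only for
    \<open>n \<noteq> 0\<close>.\<close>
  define Y where "Y = of_cols (\<lambda>_. y)"
  define Z where "Z = of_cols (\<lambda>_. x)"
  have YZ: "Y \<in> M" "Z \<in> M" by (simp_all add: Y_def Z_def)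
  have hy: "h y z = h (colf Y 0) z" for z using False
    by (simp add: h_def Y_def colf_def of_cols_def)
  have cZ: "colf Z 0 = x" using False x by (simp add: Z_def colf_of_cols)
  have cB: "colf B l = b l" if "l < N" for l using b[OF that] that by (simp add: B_def colf_of_cols)
  have "h y x = (ct Y * J * Z) $$ (0, 0)" using h_matrix[OF YZ, of 0 0] False by (simp add: hy cZ)
  also have "ct Y * J * Z = (ct Y * J * B) * (D * (ct B * J * Z))"
  proof -
    have "ct Y * J * Z = ct Y * J * (B * C) * Z" using YZ C by simp
    also have "\<dots> = (ct Y * J * B) * (D * (ct B * J * Z))" unfolding C(3) using YZ M by (simp add: M_assoc)
    finally show ?thesis .
  qed
  also have "\<dots> $$ (0, 0) = (\<Sum>l<N. (ct Y * J * B) $$ (0, l) * (D * (ct B * J * Z)) $$ (l, 0))"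
    by (rule index_mult_sum[of _ "N" "N" _ "N"]) (use YZ M False in auto)
  also have "\<dots> = (\<Sum>l<N. h (b l) x / h (b l) (b l) * h y (b l))"
  proof (rule sum.cong[OF refl])
    fix l assume l: "l \<in> {..<N}"
    have "(D * (ct B * J * Z)) $$ (l, 0) = (\<Sum>r<N. D $$ (l, r) * (ct B * J * Z) $$ (r, 0))"
      by (rule index_mult_sum[of _ "N" "N" _ "N"]) (use YZ M l False in auto)
    also have "\<dots> = (\<Sum>r<N. if r = l then inverse (h (b l) (b l)) * h (b l) x else 0)"
      by (rule sum.cong) (use l False YZ M in \<open>auto simp: D_def mat_diag_def h_matrix cB cZ\<close>)
    finally have "(D * (ct B * J * Z)) $$ (l, 0) = h (b l) x / h (b l) (b l)"
      using l by (simp add: divide_inverse)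
    moreover have "(ct Y * J * B) $$ (0, l) = h y (b l)"
      using l False YZ M by (simp add: h_matrix cB hy)
    ultimately show "(ct Y * J * B) $$ (0, l) * (D * (ct B * J * Z)) $$ (l, 0) = h (b l) x / h (b l) (b l) * h y (b l)"
      by simp
  qed
  finally show ?thesis .
next
  case True
  show ?thesis unfolding h_def by (simp add: True)
qed

end


section \<open>The discriminant of the positive eigenspace\<close>

context unitary_setting
begin

lemma of_nat_eq_iff_ext: "of_nat a = (of_nat b :: 'l) \<longleftrightarrow> a = b"
proof -
  have "of_nat a = (of_nat b :: 'l) \<longleftrightarrow> \<iota> (of_nat a) = \<iota> (of_nat b)" by (simp add: \<iota>.hom_of_nat)
  also have "\<dots> \<longleftrightarrow> a = b" by simp
  finally show ?thesis .
qed

lemma eigenvalue_matrix: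
  assumes A: "A \<in> M" and b: "\<And>i. i < N \<Longrightarrow> supp (b i) \<and> Mop A (b i) = scal (e i) (b i)"
  shows "A * of_cols b = of_cols b * mat_diag N e"
  by (rule colf_eqI) (use A b in \<open>simp_all add: colf_mult[OF A] colf_mult_diag colf_of_cols\<close>)

text \<open>With \<open>card P\<close> eigenvalues 1 and \<open>card Q\<close> eigenvalues -1, the
  trace is \<open>card P - card Q\<close>, and 1 is a root of order \<open>card P\<close>. Both
  conditions say \<open>card P = n\<close>: the trace because of characteristic 0, the polynomial
  because 1 and -1 differ.\<close>

lemma hermitian_trace_char_poly:
  assumes x: "x \<in> M" "ct x = x" "x * J * x = J"
  shows "char_poly (x * J) = ([:0, 1:] ^ 2 - 1) ^ n \<longleftrightarrow> tr (Mop (x * J)) = 0"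
proof -
  interpret HI: hermitian_involution v w \<iota> \<sigma> n "Mop (x * J)"
    by (rule hermitian_involutionI[OF x])
  have xJ: "x * J \<in> M" using x by simp
  obtain b e where b: "\<And>i. i < N \<Longrightarrow> (e i = 1 \<or> e i = -1) \<and> supp (b i) \<and>
        Mop (x * J) (b i) = scal (e i) (b i) \<and> h (b i) (b i) \<noteq> 0"
    "\<And>i k. i < N \<Longrightarrow> k < N \<Longrightarrow> i \<noteq> k \<Longrightarrow> h (b i) (b k) = 0"
    by (rule HI.eigenbasis) blast
  define B where "B = of_cols b"
  define D where "D = mat_diag N e"
  have M: "B \<in> M" "D \<in> M" by (simp_all add: B_def D_def)
  have "\<exists>C\<in>M. C * B = 1\<^sub>m N \<and> B * C = 1\<^sub>m N \<and>
      C = mat_diag N (\<lambda>i. inverse (h (b i) (b i))) * (ct B * J)"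
    unfolding B_def by (rule orthogonal_basis_matrix(2)) (use b in auto)
  then obtain C where C: "C \<in> M" "C * B = 1\<^sub>m N" "B * C = 1\<^sub>m N" by blast
  have AB: "x * J * B = B * D" unfolding B_def D_def by (rule eigenvalue_matrix[OF xJ]) (use b in blast)
  have BDC: "x * J = B * D * C"
  proof -
    have "x * J = x * J * (B * C)" using C xJ by simp
    also have "\<dots> = (x * J * B) * C" using xJ M C(1) by (simp add: M_assoc)
    finally show ?thesis unfolding AB .
  qed
  have "similar_mat (x * J) D"
    unfolding similar_mat_def similar_mat_wit_def
    by (rule exI[of _ B], rule exI[of _ C]) (use xJ M C BDC in \<open>simp add: Let_def\<close>)
  hence "char_poly (x * J) = char_poly D" by (rule char_poly_similar)
  also have "\<dots> = (\<Prod>a\<leftarrow>diag_mat D. [:- a, 1:])"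
    by (rule char_poly_upper_triangular[of _ "N"]) (use M in \<open>auto simp: D_def mat_diag_def upper_triangular_def\<close>)
  also have "diag_mat D = map e [0..<N]"
    by (auto simp: diag_mat_def D_def mat_diag_def intro!: map_cong)
  also have "(\<Prod>a\<leftarrow>map e [0..<N]. [:- a, 1:]) = (\<Prod>i<N. [:- e i, 1:])"
    by (simp add: prod.list_conv_set_nth lessThan_atLeast0 flip: prod.distinct_set_conv_list)
  finally have cp: "char_poly (x * J) = (\<Prod>i<N. [:- e i, 1:])" .
  define P where "P = {i\<in>{..<N}. e i = 1}"
  define Q where "Q = {i\<in>{..<N}. e i \<noteq> 1}"
  have PQ: "{..<N} = P \<union> Q" "P \<inter> Q = {}" "finite P" "finite Q" by (auto simp: P_def Q_def)
  have eP: "e i = 1" if "i \<in> P" for i using that by (simp add: P_def)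
  have eQ: "e i = -1" if "i \<in> Q" for i using that b(1)[of i] by (auto simp: Q_def)
  have card: "card P + card Q = N" using card_Un_disjoint[OF PQ(3,4,2)] by (simp flip: PQ(1))
  have "(\<Prod>i<N. [:- e i, 1:]) = (\<Prod>i\<in>P. [:- e i, 1:]) * (\<Prod>i\<in>Q. [:- e i, 1:])"
    unfolding PQ(1) by (rule prod.union_disjoint[OF PQ(3,4,2)])
  hence cp': "char_poly (x * J) = [:-1, 1:] ^ card P * [:1, 1:] ^ card Q"
    unfolding cp by (simp add: eP eQ)
  have "tr (Mop (x * J)) = tr (Mop (D * C * B))"
    unfolding BDC using trace_mult[OF M(1) M_mult[OF M(2) C(1)]] M C(1) by (simp add: M_assoc)
  also have "D * C * B = D" using M C by (simp add: M_assoc)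
  also have "tr (Mop D) = (\<Sum>i<N. e i)"
    unfolding tr_Mop by (rule sum.cong) (simp_all add: D_def mat_diag_def)
  also have "\<dots> = (\<Sum>i\<in>P. e i) + (\<Sum>i\<in>Q. e i)"
    unfolding PQ(1) by (rule sum.union_disjoint[OF PQ(3,4,2)])
  finally have t: "tr (Mop (x * J)) = of_nat (card P) - of_nat (card Q)" by (simp add: eP eQ)
  have target: "([:0, 1:] ^ 2 - 1) ^ n = [:-1, 1:] ^ n * [:1, 1:: 'l:] ^ n"
  proof -
    have "[:0, 1:] ^ 2 - 1 = [:-1, 1:] * [:1, 1:: 'l:]" by (simp add: power2_eq_square one_pCons)
    thus ?thesis by (simp only: power_mult_distrib)
  qed
  have ord: "order 1 ([:-1, 1:] ^ k * [:1, 1:: 'l:] ^ l) = k" for k l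
  proof -
    have "order 1 ([:1, 1:: 'l:] ^ l) = 0" by (rule order_0I) (simp add: poly_power two_neq_0)
    moreover have "order 1 ([:-1, 1:: 'l:] ^ k) = k" by (rule order_power_n_n)
    ultimately show ?thesis by (subst order_mult) auto
  qed
  show ?thesis
  proof
    assume "char_poly (x * J) = ([:0, 1:] ^ 2 - 1) ^ n"
    hence "card P = n" using ord[of "card P" "card Q"] ord[of n n] unfolding cp' target by simp
    thus "tr (Mop (x * J)) = 0" using card by (simp add: t)
  next
    assume "tr (Mop (x * J)) = 0"
    hence "card P = card Q" unfolding t by (simp add: of_nat_eq_iff_ext)
    hence "card P = n" "card Q = n" using card by simp_all
    thus "char_poly (x * J) = ([:0, 1:] ^ 2 - 1) ^ n" unfolding cp' target by simp
  qed
qed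

lemma hermitian_iff: "x \<in> X \<longleftrightarrow> x \<in> M \<and> ct x = x \<and> x * J * x = J \<and> tr (Mop (x * J)) = 0"
  using hermitian_trace_char_poly[of x] by (auto simp: unitary_hermitian_def unitary_iff)

lemma action_hermitian: assumes g: "g \<in> G" and x: "x \<in> X" shows "g * x * ct g \<in> X"
proof -
  note x' = x[unfolded hermitian_iff]
  have xM: "x \<in> M" and cx: "ct x = x" and xx: "x * J * x = J" and t: "tr (Mop (x * J)) = 0" using x' by auto
  note g' = unitary_inverse[OF g]
  have gM: "g \<in> M" by (rule g')
  have gu: "ct g * J * g = J" using g by (simp add: unitary_iff)
  have "ct (g * x * ct g) = g * ct x * ct g"
    using gM xM by (simp add: ct_mult_M M_assoc)
  moreover have "(g * x * ct g) * J * (g * x * ct g) = J"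
  proof -
    have "(g * x * ct g) * J * (g * x * ct g) = g * (x * (ct g * J * g) * x) * ct g"
      using gM xM by (simp add: M_assoc)
    also have "\<dots> = J" unfolding gu xx by (rule g')
    finally show ?thesis .
  qed
  moreover have "tr (Mop (g * x * ct g * J)) = 0"
  proof -
    have "g * x * ct g * J = g * (x * J * (J * ct g * J))" using gM xM by (simp add: M_assoc)
    hence "tr (Mop (g * x * ct g * J)) = tr (Mop (x * J * (J * ct g * J) * g))"
      using trace_mult[of g "x * J * (J * ct g * J)"] gM xM by simp
    also have "x * J * (J * ct g * J) * g = x * J * (J * ct g * J * g)" using gM xM by (simp add: M_assoc)
    also have "\<dots> = x * J" unfolding g' using xM by simp
    finally show ?thesis using t by simp
  qed
  ultimately show ?thesis using gM xM by (simp add: hermitian_iff cx)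
qed

text \<open>Stated for any \<open>H\<close> closed under products and inverses,
  \<open>J * ct g * J\<close> being the inverse, to serve both the full group and the integral
  one.\<close>

lemma orbit_eq:
  assumes H: "H \<subseteq> G" "\<And>g g'. g \<in> H \<Longrightarrow> g' \<in> H \<Longrightarrow> g * g' \<in> H" "\<And>g. g \<in> H \<Longrightarrow> J * ct g * J \<in> H"
    and g: "g \<in> H" and x: "x \<in> M"
  shows "unitary_orbit \<sigma> H (g * x * ct g) = unitary_orbit \<sigma> H x"
proof -
  have comp: "f * (f' * y * ct f') * ct f = (f * f') * y * ct (f * f')"
    if "f \<in> M" "f' \<in> M" "y \<in> M" for f f' y
    using that by (simp add: ct_mult_M M_assoc)
  have HM: "f \<in> M" if "f \<in> H" for f using that H(1) unitary_iff by blast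
  define g' where "g' = J * ct g * J"
  have g': "g' \<in> H" "g' * g = 1\<^sub>m N"
    using H g unitary_inverse[of g] by (auto simp: g'_def)
  show ?thesis
  proof
    show "unitary_orbit \<sigma> H (g * x * ct g) \<subseteq> unitary_orbit \<sigma> H x"
      using comp[OF HM HM x] g H(2) by (auto simp: unitary_orbit_def)
    show "unitary_orbit \<sigma> H x \<subseteq> unitary_orbit \<sigma> H (g * x * ct g)"
    proof
      fix z assume "z \<in> unitary_orbit \<sigma> H x"
      then obtain f where f: "f \<in> H" "z = f * x * ct f" by (auto simp: unitary_orbit_def)
      have "(f * g') * (g * x * ct g) * ct (f * g') = ((f * g') * g) * x * ct ((f * g') * g)"
        by (rule comp) (use f g g' HM x in auto)
      also have "(f * g') * g = f" using f g g' HM by (simp add: M_assoc)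
      finally show "z \<in> unitary_orbit \<sigma> H (g * x * ct g)"
        using f H(2)[OF f(1) g'(1)] unfolding unitary_orbit_def by (intro image_eqI[of _ _ "f * g'"]) simp_all
    qed
  qed
qed

lemma G_orbit_eq: "g \<in> G \<Longrightarrow> x \<in> M \<Longrightarrow> unitary_orbit \<sigma> G (g * x * ct g) = unitary_orbit \<sigma> G x"
  by (rule orbit_eq) (auto intro: unitary_mult unitary_inverse)

lemma orbit_refl: "x \<in> M \<Longrightarrow> 1\<^sub>m N \<in> H \<Longrightarrow> x \<in> unitary_orbit \<sigma> H x"
  unfolding unitary_orbit_def by (intro image_eqI[of _ _ "1\<^sub>m N"]) simp_all

text \<open>The first \<open>n\<close> norms multiply to \<open>d\<close>, so \<open>d\<close> is
  the discriminant of the positive eigenspace up to norms. The negative one can carry the same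
  \<open>d\<close> because the discriminant of the whole space is a unit.\<close>

definition disc_basis :: "'l mat \<Rightarrow> 'l \<Rightarrow> (nat \<Rightarrow> nat \<Rightarrow> 'l) \<Rightarrow> bool" where
  "disc_basis x d b \<longleftrightarrow>
     (\<forall>i<N. supp (b i) \<and> Mop (x * J) (b i) = scal (if i < n then 1 else -1) (b i) \<and>
        h (b i) (b i) = (if i = n - 1 \<or> i = N - 1 then d else 1)) \<and>
     (\<forall>i<N. \<forall>k<N. i \<noteq> k \<longrightarrow> h (b i) (b k) = 0)"

lemma w_det_J: "det J \<noteq> 0" "w (det J) = 0"
proof -
  have 1: "det J * det J = 1" by (simp flip: det_mult[OF J_carrier J_carrier])
  thus "det J \<noteq> 0" by auto
  with k'.v_mult[of "det J" "det J"] 1 show "w (det J) = 0" by simp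
qed

text \<open>The Gram determinant is \<open>d * d'\<close> and also the norm of \<open>det B\<close>
  times the unit \<open>det J\<close>. So \<open>w d + w d'\<close> is even, which among 1 and
  \<open>q\<close> forces \<open>d = d'\<close>.\<close>

lemma disc_basis_exists:
  assumes x: "x \<in> X" and n: "n \<noteq> 0" and q: "q \<noteq> 0" "w q = 1" "\<sigma> q = q"
  obtains d b where "d = 1 \<or> d = q" "disc_basis x d b"
proof -
  have x': "x \<in> M" "ct x = x" "x * J * x = J" "tr (Mop (x * J)) = 0" using x by (simp_all add: hermitian_iff)
  interpret HI: hermitian_involution v w \<iota> \<sigma> n "Mop (x * J)"
    by (rule hermitian_involutionI[OF x'(1,2,3)])
  obtain b where b:
    "\<And>i. i < N \<Longrightarrow> supp (b i) \<and> Mop (x * J) (b i) = scal (if i < n then 1 else -1) (b i)"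
    "\<And>i. i < N \<Longrightarrow> i \<noteq> n - 1 \<Longrightarrow> i \<noteq> N - 1 \<Longrightarrow> h (b i) (b i) = 1"
    "h (b (n - 1)) (b (n - 1)) \<in> {1, q}" "h (b (N - 1)) (b (N - 1)) \<in> {1, q}"
    "\<And>i k. i < N \<Longrightarrow> k < N \<Longrightarrow> i \<noteq> k \<Longrightarrow> h (b i) (b k) = 0"
    by (rule HI.normalised_eigenbasis[OF n x'(4) q]) blast
  define d where "d = h (b (n - 1)) (b (n - 1))"
  define d' where "d' = h (b (N - 1)) (b (N - 1))"
  have dd: "d \<in> {1, q}" "d' \<in> {1, q}" using b by (simp_all add: d_def d'_def)
  have nz: "h (b i) (b i) \<noteq> 0" if "i < N" for i
  proof (cases "i = n - 1 \<or> i = N - 1")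
    case True
    thus ?thesis using b(3,4) q by auto
  qed (use b(2) that in auto)
  define B where "B = of_cols b"
  have BM: "B \<in> M" by (simp add: B_def)
  have gram: "ct B * J * B = mat_diag N (\<lambda>i. h (b i) (b i))"
    unfolding B_def by (rule orthogonal_basis_matrix(1)) (use b nz in auto)
  have "det (ct B * J * B) = \<sigma> (det B) * det J * det B"
    using BM by (simp add: det_mult[of _ "N"] det_ct)
  hence e: "\<sigma> (det B) * det J * det B = (\<Prod>i<N. h (b i) (b i))" unfolding gram det_mat_diag by simp
  also have "\<dots> = (\<Prod>i<N. (if i = n - 1 then d else 1) * (if i = N - 1 then d' else 1))"
    by (rule prod.cong) (use n b(2) in \<open>auto simp: d_def d'_def\<close>)
  also have "\<dots> = d * d'" using n by (simp add: prod.distrib)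
  finally have e': "\<sigma> (det B) * det J * det B = d * d'" .
  have "d * d' \<noteq> 0" using dd q by auto
  hence "det B \<noteq> 0" using e' by auto
  hence "w (d * d') = 2 * w (det B)" unfolding e'[symmetric] using w_det_J by (simp add: k'.v_mult)
  hence "w d + w d' = 2 * w (det B)" using \<open>d * d' \<noteq> 0\<close> k'.v_mult[of d d'] by simp
  hence "even (w d + w d')" by simp
  hence "d = d'" using dd q by auto
  hence "disc_basis x d b" unfolding disc_basis_def using b d_def d'_def by auto
  thus thesis using that dd by blast
qed

text \<open>The map carrying one basis to the other is an isometry since the Gram matrices agree,
  and it intertwines the involutions since the eigenvalues agree.\<close>

lemma disc_basis_same_orbit:
  assumes b: "disc_basis x d b" and b': "disc_basis x' d b'" and d: "d \<noteq> 0" and x: "x \<in> M" "x' \<in> M"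
  shows "\<exists>g\<in>G. x' = g * x * ct g"
proof -
  define B where "B = of_cols b"
  define B' where "B' = of_cols b'"
  define D where "D = mat_diag N (\<lambda>i. if i < n then 1 else - 1 :: 'l)"
  define S where "S = mat_diag N (\<lambda>i. if i = n - 1 \<or> i = N - 1 then d else 1)"
  have M: "B \<in> M" "B' \<in> M" "D \<in> M" "S \<in> M" by (simp_all add: B_def B'_def D_def S_def)
  have gram: "ct (of_cols b) * J * of_cols b = S"
    "\<exists>C\<in>M. C * of_cols b = 1\<^sub>m N \<and> of_cols b * C = 1\<^sub>m N"
    if b: "disc_basis x d b" for x b
  proof -
    have o: "supp (b i) \<and> h (b i) (b i) \<noteq> 0" if "i < N" for i
      using b d that by (auto simp: disc_basis_def)
    have o2: "h (b i) (b k) = 0" if "i < N" "k < N" "i \<noteq> k" for i k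
      using b that by (simp add: disc_basis_def)
    have "ct (of_cols b) * J * of_cols b = mat_diag N (\<lambda>i. h (b i) (b i))"
      by (rule orthogonal_basis_matrix(1)) (use o o2 in auto)
    also have "\<dots> = S" unfolding S_def
      by (rule eq_matI) (use b in \<open>auto simp: mat_diag_def disc_basis_def\<close>)
    finally show "ct (of_cols b) * J * of_cols b = S" .
    show "\<exists>C\<in>M. C * of_cols b = 1\<^sub>m N \<and> of_cols b * C = 1\<^sub>m N"
    proof -
      have "\<exists>C\<in>M. C * of_cols b = 1\<^sub>m N \<and> of_cols b * C = 1\<^sub>m N \<and>
          C = mat_diag N (\<lambda>i. inverse (h (b i) (b i))) * (ct (of_cols b) * J)"
        by (rule orthogonal_basis_matrix(2)) (use o o2 in auto)
      thus ?thesis by blast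
    qed
  qed
  obtain C where C: "C \<in> M" "C * B = 1\<^sub>m N" "B * C = 1\<^sub>m N" using gram(2)[OF b] unfolding B_def by blast
  have gB: "ct B * J * B = S" "ct B' * J * B' = S" using gram(1)[OF b] gram(1)[OF b'] by (simp_all add: B_def B'_def)
  have xB: "x * J * B = B * D" unfolding B_def D_def
    by (rule eigenvalue_matrix) (use x b in \<open>auto simp: disc_basis_def\<close>)
  have xB': "x' * J * B' = B' * D" unfolding B'_def D_def
    by (rule eigenvalue_matrix) (use x b' in \<open>auto simp: disc_basis_def\<close>)
  define g where "g = B' * C"
  have gM: "g \<in> M" using M C by (simp add: g_def)
  have cC: "ct C * ct B = 1\<^sub>m N"
  proof -
    have "ct C * ct B = ct (B * C)" using M C(1) by (simp add: ct_mult_M)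
    also have "\<dots> = 1\<^sub>m N" unfolding C by simp
    finally show ?thesis .
  qed
  have "ct g * J * g = ct C * (ct B' * J * B') * C"
    using M C(1) by (simp add: g_def ct_mult_M M_assoc)
  also have "\<dots> = (ct C * ct B) * J * (B * C)" unfolding gB(2) gB(1)[symmetric] using M C(1) by (simp add: M_assoc)
  also have "\<dots> = J" unfolding cC C(3) by simp
  finally have g: "g \<in> G" using gM by (simp add: unitary_iff)
  have "g * x * J = g * x * J * (B * C)" using gM x C by (simp add: M_assoc)
  also have "\<dots> = B' * (C * (x * J * B) * C)" unfolding g_def using M C(1) x by (simp add: M_assoc)
  also have "\<dots> = B' * ((C * B) * D * C)" unfolding xB using M C(1) by (simp add: M_assoc)
  also have "\<dots> = (B' * D) * C" unfolding C(2) using M C(1) by (simp add: M_assoc)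
  also have "\<dots> = x' * J * g" unfolding xB'[symmetric] g_def using M C(1) x by (simp add: M_assoc)
  finally have "g * x * J * J * ct g = x' * J * g * J * ct g" by simp
  hence "g * x * ct g = x' * J * (g * J * ct g)" using gM x by (simp add: M_assoc)
  also have "\<dots> = x'" unfolding unitary_inverse(4)[OF g] using x by (simp add: M_assoc)
  finally show ?thesis using g by auto
qed

lemma disc_basis_action:
  assumes b: "disc_basis x d b" and g: "g \<in> G" and x: "x \<in> M"
  shows "disc_basis (g * x * ct g) d (\<lambda>i. Mop g (b i))"
proof -
  note g' = unitary_inverse[OF g]
  have gM: "g \<in> M" by (rule g')
  have hg: "h (Mop g y) (Mop g z) = h y z" if "supp z" for y z
    using that gM by (simp add: h_Mop[OF gM] Mop_mult[symmetric] g' Mop_one)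
  have "g * x * ct g * J * g = g * x * (ct g * J * g)" using gM x by (simp add: M_assoc)
  also have "ct g * J * g = J" using g by (simp add: unitary_iff)
  finally have e: "g * x * ct g * J * g = g * (x * J)" using gM x by (simp add: M_assoc)
  have "Mop (g * x * ct g * J) (Mop g y) = Mop g (Mop (x * J) y)" for y
  proof -
    have "Mop (g * x * ct g * J) (Mop g y) = Mop (g * x * ct g * J * g) y"
      using gM x by (intro Mop_mult[symmetric]) simp_all
    also have "\<dots> = Mop g (Mop (x * J) y)" unfolding e using gM x by (intro Mop_mult) simp_all
    finally show ?thesis .
  qed
  thus ?thesis using b by (auto simp: disc_basis_def hg Mop_supp lin_op_scal[OF Mop_lin])
qed

text \<open>The \<open>c k\<close> have no components along the \<open>b l\<close> of eigenvalue -1.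
  So their Gram matrix is \<open>ct U * (S * U)\<close> with a square coordinate matrix
  \<open>U\<close>, and its determinant is \<open>d\<close> times the norm of \<open>det U\<close>,
  which has even valuation.\<close>

lemma discriminant_parity:
  assumes b: "disc_basis x d b" and d: "d \<noteq> 0" and n: "n \<noteq> 0" and x: "x \<in> X"
    and c: "\<And>k. k < n \<Longrightarrow> supp (c k) \<and> Mop (x * J) (c k) = c k \<and> h (c k) (c k) \<noteq> 0"
    and orth: "\<And>i k. i < n \<Longrightarrow> k < n \<Longrightarrow> i \<noteq> k \<Longrightarrow> h (c i) (c k) = 0"
  shows "even (w (\<Prod>k<n. h (c k) (c k)) - w d)"
proof -
  have x': "x \<in> M" "ct x = x" "x * J * x = J" using x by (simp_all add: hermitian_iff)
  interpret HI: hermitian_involution v w \<iota> \<sigma> n "Mop (x * J)"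
    by (rule hermitian_involutionI[OF x'])
  define s where "s l = h (b l) (b l)" for l
  have s: "s l = (if l = n - 1 \<or> l = N - 1 then d else 1)" if "l < N" for l
    using b that by (simp add: disc_basis_def s_def)
  have s0: "s l \<noteq> 0" if "l < N" for l using s[OF that] d by simp
  have ss: "\<sigma> (s l) = s l" for l by (simp add: s_def h_hermitian)
  define u where "u l k = h (b l) (c k) / s l" for l k
  have u0: "u l k = 0" if "l < N" "\<not> l < n" "k < n" for l k
  proof -
    have "h (b l) (c k) = h (b l) (Mop (x * J) (c k))" using c that by simp
    also have "\<dots> = h (Mop (x * J) (b l)) (c k)" by (rule HI.Y_adj[symmetric])
    also have "Mop (x * J) (b l) = scal (-1) (b l)" using b that by (simp add: disc_basis_def)
    also have "h (scal (-1) (b l)) (c k) = - h (b l) (c k)" by (simp add: h_scal_left \<sigma>.hom_uminus)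
    finally have "2 * h (b l) (c k) = 0" by simp
    hence "h (b l) (c k) = 0" using two_neq_0 by (simp only: mult_eq_0_iff) auto
    thus ?thesis by (simp add: u_def)
  qed
  define U where "U = mat n n (\<lambda>(l, k). u l k)"
  define S where "S = mat_diag n s"
  have M: "U \<in> carrier_mat n n" "S \<in> carrier_mat n n" by (simp_all add: U_def S_def)
  have "mat_diag n (\<lambda>k. h (c k) (c k)) = ct U * (S * U)"
  proof (rule eq_matI)
    fix i k assume "i < dim_row (ct U * (S * U))" "k < dim_col (ct U * (S * U))"
    hence ik: "i < n" "k < n" using M by auto
    have "(ct U * (S * U)) $$ (i, k) = (\<Sum>l<n. \<sigma> (u l i) * (s l * u l k))"
    proof -
      have "(ct U * (S * U)) $$ (i, k) = (\<Sum>l<n. ct U $$ (i, l) * (S * U) $$ (l, k))"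
        by (rule index_mult_sum[of _ n n _ n]) (use ik M in auto)
      thus ?thesis using ik by (simp add: ct_index[OF M(1)] S_def mat_diag_mult_left[OF M(1)]) (simp add: U_def)
    qed
    also have "\<dots> = (\<Sum>l<N. \<sigma> (u l i) * (s l * u l k))"
      by (rule sum.mono_neutral_left) (use ik u0 in auto)
    also have "\<dots> = (\<Sum>l<N. h (b l) (c k) / h (b l) (b l) * h (c i) (b l))"
    proof (rule sum.cong[OF refl])
      fix l assume l: "l \<in> {..<N}"
      have "\<sigma> (u l i) * s l = h (c i) (b l)" using l s0[of l] by (simp add: u_def \<sigma>_div ss h_hermitian)
      show "\<sigma> (u l i) * (s l * u l k) = h (b l) (c k) / h (b l) (b l) * h (c i) (b l)"
      proof -
        have "\<sigma> (u l i) * (s l * u l k) = (\<sigma> (u l i) * s l) * u l k" by (simp only: mult.assoc)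
        also have "\<dots> = u l k * h (c i) (b l)" using \<open>\<sigma> (u l i) * s l = h (c i) (b l)\<close> by simp
        finally show ?thesis by (simp add: u_def s_def)
      qed
    qed
    also have "\<dots> = h (c i) (c k)"
      by (rule orthogonal_expansion[symmetric]) (use b c ik s0 in \<open>auto simp: disc_basis_def s_def\<close>)
    finally show "mat_diag n (\<lambda>k. h (c k) (c k)) $$ (i, k) = (ct U * (S * U)) $$ (i, k)"
      using ik orth by (auto simp: mat_diag_def)
  qed (use M in \<open>auto simp: mat_diag_def\<close>)
  hence "det (mat_diag n (\<lambda>k. h (c k) (c k))) = \<sigma> (det U) * (det S * det U)"
    using M by (simp add: det_mult[of _ n] det_ct)
  moreover have "det S = d"
  proof -
    have "det S = (\<Prod>l<n. if l = n - 1 then d else 1)"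
      unfolding S_def det_mat_diag by (rule prod.cong) (use s in auto)
    thus ?thesis using n by simp
  qed
  ultimately have e: "(\<Prod>k<n. h (c k) (c k)) = \<sigma> (det U) * (d * det U)" by (simp add: det_mat_diag)
  moreover have "(\<Prod>k<n. h (c k) (c k)) \<noteq> 0" using c by auto
  ultimately have "det U \<noteq> 0" by auto
  thus ?thesis unfolding e using d by (simp add: k'.v_mult)
qed

end


section \<open>Weight matrices\<close>

lemma symmetric_list_nth:
  fixes l :: "int list"
  assumes "length l = n" "i < 2 * n"
  shows "(l @ rev (map uminus l)) ! (2 * n - Suc i) = - (l @ rev (map uminus l)) ! i"
proof (cases "i < n")
  case True
  hence "\<not> 2 * n - Suc i < n" "2 * n - Suc i - n < n" "n - Suc (2 * n - Suc i - n) = i" by auto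
  thus ?thesis using assms True by (simp add: nth_append rev_nth)
next
  case False
  hence "2 * n - Suc i < n" "n - Suc (i - n) = 2 * n - Suc i" "i - n < n" using assms by auto
  thus ?thesis using assms False by (simp add: nth_append rev_nth)
qed

locale unitary_uniformized = unitary_setting v w \<iota> \<sigma> n
  for v :: "'k :: field_char_0 \<Rightarrow> int" and w :: "'l :: field \<Rightarrow> int" and \<iota> \<sigma> n +
  fixes q :: 'l
  assumes q: "q \<noteq> 0" "w q = 1" "\<sigma> q = q" and n: "n \<noteq> 0"
begin

definition entry :: "int list \<Rightarrow> nat \<Rightarrow> 'l" where
  "entry l i = q powi ((l @ rev (map uminus l)) ! i)"

lemma weight_mat_entry: "length l = n \<Longrightarrow> weight_mat q l = mat_diag N (entry l)"
  by (simp add: weight_mat_def entry_def[abs_def])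

lemma entry_nz: "entry l i \<noteq> 0"
  using q by (simp add: entry_def)

lemma entry_fixed: "\<sigma> (entry l i) = entry l i"
  using q by (simp add: entry_def \<sigma>_powi)

lemma w_entry: "w (entry l i) = (l @ rev (map uminus l)) ! i"
  using q by (simp add: entry_def k'.v_power_int)

lemma entry_flip: "length l = n \<Longrightarrow> i < N \<Longrightarrow> entry l (N - Suc i) * entry l i = 1"
  using q symmetric_list_nth[of l n i] by (simp add: entry_def power_int_minus)

lemma weight_J_index: "length l = n \<Longrightarrow> i < N \<Longrightarrow> j < N \<Longrightarrow>
    (weight_mat q l * J) $$ (i, j) = (if i = N - Suc j then entry l i else 0)"
  by (auto simp: mult_J_index weight_mat_entry) (auto simp: mat_diag_def)

lemma weight_Mop: "length l = n \<Longrightarrow> i < N \<Longrightarrow>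
    Mop (weight_mat q l * J) x i = entry l i * x (N - Suc i)"
proof -
  assume l: "length l = n" and i: "i < N"
  have "Mop (weight_mat q l * J) x i = (\<Sum>k<N. if k = N - Suc i then entry l i * x k else 0)"
  proof -
    have "(\<Sum>k<N. (weight_mat q l * J) $$ (i, k) * x k) =
        (\<Sum>k<N. if k = N - Suc i then entry l i * x k else 0)"
      by (rule sum.cong) (use i in \<open>auto simp: weight_J_index[OF l i]\<close>)
    thus ?thesis using i by (simp add: Mop_def)
  qed
  thus ?thesis using i by simp
qed

lemma weight_hermitian: assumes l: "length l = n" shows "weight_mat q l \<in> X"
proof -
  have M: "weight_mat q l \<in> M" by (simp add: weight_mat_entry[OF l])
  have "ct (weight_mat q l) = weight_mat q l" unfolding weight_mat_entry[OF l]
    by (rule eq_matI) (auto simp: conj_transpose_def mat_diag_def entry_fixed)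
  moreover have "weight_mat q l * J * weight_mat q l = J"
  proof (rule eq_matI)
    fix i j assume ij: "i < dim_row J" "j < dim_col J"
    hence ij: "i < N" "j < N" by (simp_all add: antidiag_mat_def)
    have "weight_mat q l * J * weight_mat q l = mat N N (\<lambda>(i, j). (weight_mat q l * J) $$ (i, j) * entry l j)"
      by (subst (2) weight_mat_entry[OF l], rule mat_diag_mult_right) (use M in simp)
    hence "(weight_mat q l * J * weight_mat q l) $$ (i, j) = (weight_mat q l * J) $$ (i, j) * entry l j"
      using ij by simp
    also have "\<dots> = J $$ (i, j)"
      unfolding weight_J_index[OF l ij] using ij entry_flip[OF l, of j] by (auto simp: antidiag_mat_def)
    finally show "(weight_mat q l * J * weight_mat q l) $$ (i, j) = J $$ (i, j)" .
  qed (use M in \<open>auto simp: antidiag_mat_def\<close>)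
  moreover have "tr (Mop (weight_mat q l * J)) = 0"
    unfolding tr_Mop
  proof (rule sum.neutral, rule ballI)
    fix i assume i: "i \<in> {..<N}"
    have "i \<noteq> N - Suc i" using i[unfolded lessThan_iff] by presburger
    thus "(weight_mat q l * J) $$ (i, i) = 0" using i by (simp add: weight_J_index[OF l])
  qed
  ultimately show ?thesis using M by (simp add: hermitian_iff)
qed

text \<open>The operator of \<open>weight_mat q l * J\<close> exchanges the unit vectors at
  \<open>k\<close> and \<open>N - Suc k\<close> up to mutually inverse factors; this vector of their
  plane is fixed by it.\<close>

definition weight_eigenvector :: "int list \<Rightarrow> nat \<Rightarrow> nat \<Rightarrow> 'l" where
  "weight_eigenvector l k = comb (entry l k) (unit_fun k) 1 (unit_fun (N - Suc k))"

lemma weight_eigenvector: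
  assumes l: "length l = n" and k: "k < n"
  shows "supp (weight_eigenvector l k)"
    and "Mop (weight_mat q l * J) (weight_eigenvector l k) = weight_eigenvector l k"
    and "j < n \<Longrightarrow> h (weight_eigenvector l k) (weight_eigenvector l j) = (if k = j then 2 * entry l k else 0)"
proof -
  show s: "supp (weight_eigenvector l k)"
    using k by (auto simp: supp_def weight_eigenvector_def comb_def unit_fun_def)
  show "Mop (weight_mat q l * J) (weight_eigenvector l k) = weight_eigenvector l k"
  proof
    fix i
    show "Mop (weight_mat q l * J) (weight_eigenvector l k) i = weight_eigenvector l k i"
    proof (cases "i < N")
      case True
      have f: "entry l (N - Suc k) * entry l k = 1" by (rule entry_flip[OF l]) (use k in simp)
      consider "i = k" | "i = N - Suc k" | "i \<noteq> k" "i \<noteq> N - Suc k" by blast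
      thus ?thesis
      proof cases
        case 1
        thus ?thesis using True k by (simp add: weight_Mop[OF l] weight_eigenvector_def comb_def unit_fun_def)
      next
        case 2
        hence "N - Suc i = k" "i \<noteq> k" using True k by auto
        thus ?thesis using True 2 f by (simp add: weight_Mop[OF l] weight_eigenvector_def comb_def unit_fun_def)
      next
        case 3
        hence "N - Suc i \<noteq> k" "N - Suc i \<noteq> N - Suc k" using True k by auto
        thus ?thesis using True 3 by (simp add: weight_Mop[OF l] weight_eigenvector_def comb_def unit_fun_def)
      qed
    qed (use s Mop_supp in \<open>simp add: supp_def\<close>)
  qed
  assume j: "j < n"
  have uu: "h (unit_fun a) (unit_fun b) = (if N - Suc a = b then 1 else 0)" if "a < N" for a b
    unfolding h_unit_left[OF that] by (simp add: unit_fun_def)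
  have k': "k < N" "N - Suc k < N" using k by auto
  have ne: "N - Suc k \<noteq> j" "k \<noteq> N - Suc j" "(N - Suc k = N - Suc j) = (k = j)"
    "N - Suc (N - Suc k) = k" using j k by auto
  have v: "h (unit_fun k) (unit_fun j) = 0" "h (unit_fun (N - Suc k)) (unit_fun (N - Suc j)) = 0"
    using uu[OF k'(1), of j] uu[OF k'(2), of "N - Suc j"] ne by simp_all
  have v': "h (unit_fun k) (unit_fun (N - Suc j)) = (if k = j then 1 else 0)"
    unfolding uu[OF k'(1)] using ne(3) by simp
  have v'': "h (unit_fun (N - Suc k)) (unit_fun j) = (if k = j then 1 else 0)"
    unfolding uu[OF k'(2)] using ne(4) by simp
  show "h (weight_eigenvector l k) (weight_eigenvector l j) = (if k = j then 2 * entry l k else 0)"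
    by (simp add: weight_eigenvector_def h_comb_left h_comb_right entry_fixed v v' v'')
qed

lemma weight_disc_parity:
  assumes l: "length l = n" and b: "disc_basis (weight_mat q l) d b" and d: "d \<noteq> 0"
  shows "even (int n * w 2 + sum_list l - w d)"
proof -
  have "even (w (\<Prod>k<n. h (weight_eigenvector l k) (weight_eigenvector l k)) - w d)"
    by (rule discriminant_parity[OF b d n weight_hermitian[OF l]])
      (use weight_eigenvector[OF l] two_neq_0 entry_nz in auto)
  moreover have "(\<Prod>k<n. h (weight_eigenvector l k) (weight_eigenvector l k)) = (\<Prod>k<n. 2 * entry l k)"
    by (rule prod.cong) (use weight_eigenvector(3)[OF l] in auto)
  moreover have "w (\<Prod>k<m. 2 * entry l k) = int m * w 2 + (\<Sum>k<m. l ! k)" if "m \<le> n" for m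
    using that
  proof (induction m)
    case (Suc m)
    have "w (\<Prod>k<Suc m. 2 * entry l k) = w (\<Prod>k<m. 2 * entry l k) + (w 2 + w (entry l m))"
      using two_neq_0 entry_nz by (simp add: k'.v_mult)
    also have "w (entry l m) = l ! m" using Suc.prems l by (simp add: w_entry nth_append)
    finally show ?case using Suc by (simp add: algebra_simps)
  qed simp
  moreover have "(\<Sum>k<n. l ! k) = sum_list l" using l by (simp add: sum_list_sum_nth lessThan_atLeast0)
  ultimately show ?thesis by simp
qed

lemma two_unitary_orbits: "card (unitary_orbit \<sigma> G ` X) = 2"
proof -
  \<comment> \<open>Weights of sum 0 and 1: their discriminants have opposite parities whatever
    \<open>w 2\<close> is, so both values 1 and \<open>q\<close> of \<open>d\<close> occur.\<close>
  define l0 where "l0 = replicate n (0::int)"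
  define l1 where "l1 = 1 # replicate (n - 1) (0::int)"
  have l: "length l0 = n" "length l1 = n" "sum_list l0 = 0" "sum_list l1 = 1"
    using n by (simp_all add: l0_def l1_def sum_list_replicate)
  define x0 where "x0 = weight_mat q l0"
  define x1 where "x1 = weight_mat q l1"
  have X: "x0 \<in> X" "x1 \<in> X" using weight_hermitian l by (simp_all add: x0_def x1_def)
  have XM: "x \<in> M" if "x \<in> X" for x using that by (simp add: hermitian_iff)
  obtain d0 b0 where d0: "d0 = 1 \<or> d0 = q" "disc_basis x0 d0 b0" by (rule disc_basis_exists[OF X(1) n q])
  obtain d1 b1 where d1: "d1 = 1 \<or> d1 = q" "disc_basis x1 d1 b1" by (rule disc_basis_exists[OF X(2) n q])
  have nz: "d0 \<noteq> 0" "d1 \<noteq> 0" using d0 d1 q by auto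
  have par: "even (int n * w 2 + 0 - w d0)" "even (int n * w 2 + 1 - w d1)"
    using weight_disc_parity[OF l(1) d0(2)[unfolded x0_def] nz(1)]
      weight_disc_parity[OF l(2) d1(2)[unfolded x1_def] nz(2)] l by simp_all
  have dd: "d0 \<noteq> d1" using par by auto
  have ne: "unitary_orbit \<sigma> G x0 \<noteq> unitary_orbit \<sigma> G x1"
  proof
    assume "unitary_orbit \<sigma> G x0 = unitary_orbit \<sigma> G x1"
    hence "x1 \<in> unitary_orbit \<sigma> G x0" using orbit_refl[OF XM[OF X(2)] one_unitary] by simp
    then obtain g where g: "g \<in> G" "x1 = g * x0 * ct g" by (auto simp: unitary_orbit_def)
    have "disc_basis x1 d0 (\<lambda>i. Mop g (b0 i))"
      unfolding g(2) by (rule disc_basis_action[OF d0(2) g(1) XM[OF X(1)]])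
    hence "even (int n * w 2 + 1 - w d0)"
      using weight_disc_parity[OF l(2), of d0] nz l by (simp add: x1_def)
    thus False using par(1) by presburger
  qed
  have "unitary_orbit \<sigma> G ` X = {unitary_orbit \<sigma> G x0, unitary_orbit \<sigma> G x1}"
  proof
    show "{unitary_orbit \<sigma> G x0, unitary_orbit \<sigma> G x1} \<subseteq> unitary_orbit \<sigma> G ` X" using X by auto
    show "unitary_orbit \<sigma> G ` X \<subseteq> {unitary_orbit \<sigma> G x0, unitary_orbit \<sigma> G x1}"
    proof
      fix Z assume "Z \<in> unitary_orbit \<sigma> G ` X"
      then obtain x where x: "x \<in> X" "Z = unitary_orbit \<sigma> G x" by auto
      obtain d b where d: "d = 1 \<or> d = q" "disc_basis x d b" by (rule disc_basis_exists[OF x(1) n q])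
      have same: "Z = unitary_orbit \<sigma> G y" if y: "y \<in> X" "disc_basis y d c" for y c
      proof -
        have "d \<noteq> 0" using d q by auto
        then obtain g where "g \<in> G" "x = g * y * ct g"
          using disc_basis_same_orbit[OF y(2) d(2) _ XM[OF y(1)] XM[OF x(1)]] by auto
        thus ?thesis using G_orbit_eq[of g y] XM[OF y(1)] x(2) by simp
      qed
      have "d = d0 \<or> d = d1" using d(1) d0(1) d1(1) dd by auto
      thus "Z \<in> {unitary_orbit \<sigma> G x0, unitary_orbit \<sigma> G x1}"
        using same[OF X(1), of b0] same[OF X(2), of b1] d0(2) d1(2) by auto
    qed
  qed
  thus ?thesis using ne by simp
qed

end


section \<open>Even residual characteristic\<close>

context nonarch_local_field
begin

text \<open>Since the residue field is finite, some positive integer lies in the maximal ideal, so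
  \<open>LEAST\<close> is attained. If the least one is \<open>2 * m\<close>, then \<open>m\<close>
  lies outside and primality leaves 2; conversely, 2 in the ideal leaves only the value 2.\<close>

lemma even_residual_char_iff: "even (residual_char v) \<longleftrightarrow> 2 \<in> val_ideal v 1"
proof -
  define P where "P p \<longleftrightarrow> p > 0 \<and> of_nat p \<in> val_ideal v 1" for p :: nat
  obtain r where r: "finite (r ` val_ring v)"
    "\<And>x. x \<in> val_ring v \<Longrightarrow> r x \<in> val_ring v"
    "\<And>x. x \<in> val_ring v \<Longrightarrow> x - r x \<in> val_ideal v 1"
    "\<And>x y. x \<in> val_ring v \<Longrightarrow> y \<in> val_ring v \<Longrightarrow> r x = r y \<longleftrightarrow> x - y \<in> val_ideal v 1"
    "\<And>x. x \<in> val_ring v \<Longrightarrow> r (r x) = r x"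
    using residue_representatives by blast
  have "finite (range (\<lambda>m::nat. r (of_nat m)))" by (rule finite_subset[OF _ r(1)]) auto
  hence "\<not> inj (\<lambda>m::nat. r (of_nat m))" using finite_imageD by blast
  then obtain a b :: nat where ab: "r (of_nat a) = r (of_nat b)" "a < b"
    unfolding inj_def by (metis linorder_neqE_nat)
  have "of_nat b - of_nat a \<in> val_ideal v 1" using r(4)[of "of_nat b" "of_nat a"] ab by simp
  hence "P (b - a)" using ab(2) by (simp add: P_def of_nat_diff)
  hence p: "P (residual_char v)" unfolding residual_char_def P_def[symmetric] by (rule LeastI)
  have least: "residual_char v \<le> m" if "P m" for m
    unfolding residual_char_def P_def[symmetric] using that by (rule Least_le)
  show ?thesis
  proof
    assume "even (residual_char v)"
    then obtain m where m: "residual_char v = 2 * m" by blast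
    have "m > 0" "m < residual_char v" using p m by (auto simp: P_def)
    hence "of_nat m \<notin> val_ideal v 1" using least[of m] by (auto simp: P_def)
    moreover have "2 * of_nat m \<in> val_ideal v 1" using p by (simp add: P_def m)
    ultimately show "2 \<in> val_ideal v 1" using ideal_prime[of 2 "of_nat m"] by auto
  next
    assume "2 \<in> val_ideal v 1"
    hence "residual_char v \<le> 2" by (intro least) (simp add: P_def)
    moreover have "residual_char v > 0" "residual_char v \<noteq> 1" using p by (auto simp: P_def)
    ultimately have "residual_char v = 2" by linarith
    thus "even (residual_char v)" by simp
  qed
qed

end

section \<open>The integral unitary group and an orbit without diagonal matrices\<close>

context unitary_setting
begin

abbreviation K :: "'l mat set" where "K \<equiv> integral_unitary_group w \<sigma> n"

definition integral_mat :: "'l mat \<Rightarrow> bool" where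
  "integral_mat A \<longleftrightarrow> (\<forall>i<N. \<forall>j<N. A $$ (i, j) \<in> val_ring w)"

lemma elements_integral: "A \<in> M \<Longrightarrow> elements_mat A \<subseteq> val_ring w \<longleftrightarrow> integral_mat A"
  unfolding integral_mat_def by (auto dest!: elements_matD)

lemma integral_mat_mult:
  assumes A: "A \<in> M" "integral_mat A" and B: "B \<in> M" "integral_mat B"
  shows "integral_mat (A * B)"
  unfolding integral_mat_def
proof (intro allI impI)
  fix i j assume ij: "i < N" "j < N"
  have "A $$ (i, r) * B $$ (r, j) \<in> val_ring w" if "r < N" for r
    by (rule k'.ideal_mult_left) (use A B ij that in \<open>simp_all add: integral_mat_def\<close>)
  thus "(A * B) $$ (i, j) \<in> val_ring w"
    unfolding index_mult_sum[OF A(1) B(1) ij] by (intro k'.ideal_sum) simp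
qed

lemma integral_mat_J: "integral_mat J"
  by (auto simp: integral_mat_def antidiag_mat_def)

lemma integral_mat_ct: "A \<in> M \<Longrightarrow> integral_mat A \<Longrightarrow> integral_mat (ct A)"
  by (auto simp: integral_mat_def ct_index)

text \<open>The inverse \<open>J * ct g * J\<close> of a unitary matrix is integral along with
  \<open>g\<close>.\<close>

lemma K_iff: "g \<in> K \<longleftrightarrow> g \<in> G \<and> integral_mat g"
proof
  assume "g \<in> K"
  thus "g \<in> G \<and> integral_mat g"
    using elements_integral by (auto simp: integral_unitary_group_def GL_over_def)
next
  assume g: "g \<in> G \<and> integral_mat g"
  note g' = unitary_inverse[OF conjunct1[OF g]]
  have "integral_mat (J * ct g * J)"
    using g g'(1) by (intro integral_mat_mult integral_mat_J integral_mat_ct) auto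
  moreover have "J * ct g * J \<in> M" using g' by simp
  ultimately have "g \<in> GL_over (val_ring w) N"
    unfolding GL_over_def using g g' elements_integral by auto
  thus "g \<in> K" using g by (simp add: integral_unitary_group_def)
qed

lemma one_K: "1\<^sub>m N \<in> K"
  using one_unitary by (auto simp: K_iff integral_mat_def)

lemma K_mult: "g \<in> K \<Longrightarrow> g' \<in> K \<Longrightarrow> g * g' \<in> K"
  using unitary_mult unitary_iff integral_mat_mult by (simp add: K_iff)

lemma K_inverse: "g \<in> K \<Longrightarrow> J * ct g * J \<in> K"
  using unitary_inverse(1,5)[of g] by (auto simp: K_iff intro!: integral_mat_mult integral_mat_J integral_mat_ct)

lemma K_orbit_eq: "g \<in> K \<Longrightarrow> x \<in> M \<Longrightarrow> unitary_orbit \<sigma> K (g * x * ct g) = unitary_orbit \<sigma> K x"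
  by (rule orbit_eq) (use K_mult K_inverse K_iff in blast)+

lemma even_residual_orbit:
  assumes n: "n \<noteq> 0" and two: "2 \<in> val_ideal w 1"
  shows "\<exists>Y\<in>unitary_orbit \<sigma> K ` X. \<forall>y\<in>Y. \<not> diagonal_mat y"
proof -
  obtain \<theta> where \<theta>: "\<theta> \<in> val_ring w" "\<theta> + \<sigma> \<theta> = 1" by (rule trace_one)
  have s\<theta>: "\<sigma> \<theta> = 1 - \<theta>" using \<theta>(2) by (simp add: eq_diff_eq add.commute)
  \<comment> \<open>For \<open>i < n\<close> the plane of the coordinates \<open>i\<close> and
    \<open>N - Suc i\<close> gets the block with rows \<open>2, 1 - 2 * \<theta>\<close> and
    \<open>2 * \<theta> - 1, 2 * (\<theta> * \<sigma> \<theta>)\<close>. As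
    \<open>\<sigma> \<theta> = 1 - \<theta>\<close>, it is hermitian of determinant \<open>4 *
    \<theta> * (1 - \<theta>) + (1 - 2 * \<theta>)\<^sup>2 = 1\<close>, and congruent to the
    antidiagonal block modulo 2.\<close>
  define P where "P i = (if i < n then 2 else 2 * (\<theta> * \<sigma> \<theta>))" for i
  define Q where "Q i = (if i < n then 1 - 2 * \<theta> else 2 * \<theta> - 1)" for i
  define x where "x = mat N N (\<lambda>(i, j). if j = i then P i else if j = N - Suc i then Q i else 0)"
  have xM: "x \<in> M" by (simp add: x_def)
  have flip: "N - Suc i < n \<longleftrightarrow> \<not> i < n" "N - Suc i < N" "N - Suc (N - Suc i) = i"
    "N - Suc i \<noteq> i" if "i < N" for i using that by presburger+
  have sP: "\<sigma> (P i) = P i" for i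
    by (simp add: P_def \<sigma>.hom_mult \<sigma>.hom_numeral mult.commute)
  have sQ: "\<sigma> (Q i) = - Q i" for i
    by (simp add: Q_def \<sigma>.hom_mult \<sigma>.hom_minus \<sigma>.hom_numeral s\<theta> algebra_simps)
  have QQ: "Q (N - Suc i) = - Q i" if "i < N" for i
    using flip(1)[OF that] by (simp add: Q_def)
  have QP: "Q i * Q i + P i * P (N - Suc i) = 1" if "i < N" for i
    using flip(1)[OF that] by (simp add: Q_def P_def s\<theta> algebra_simps)
  have xi: "x $$ (i, j) = (if j = i then P i else if j = N - Suc i then Q i else 0)"
    if "i < N" "j < N" for i j using that by (simp add: x_def)
  have herm: "ct x = x"
  proof (rule eq_matI)
    fix i j assume "i < dim_row x" "j < dim_col x"
    hence ij: "i < N" "j < N" by (simp_all add: x_def)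
    show "ct x $$ (i, j) = x $$ (i, j)"
      using flip[OF ij(1)] flip[OF ij(2)] QQ[OF ij(1)]
      by (auto simp: ct_index[OF xM] xi ij sP sQ \<sigma>.hom_uminus)
  qed (simp_all add: x_def)
  have invol: "x * J * x = J"
  proof (rule eq_matI)
    fix i j assume "i < dim_row J" "j < dim_col J"
    hence ij: "i < N" "j < N" by (simp_all add: antidiag_mat_def)
    have "(x * J * x) $$ (i, j) = (\<Sum>k<N. (x * J) $$ (i, k) * x $$ (k, j))"
      by (rule index_mult_sum[of _ "N" "N" _ "N"]) (use xM ij in auto)
    also have "\<dots> = (\<Sum>k<N. (if k = i then Q i * x $$ (i, j) else 0) +
        (if k = N - Suc i then P i * x $$ (N - Suc i, j) else 0))"
    proof (rule sum.cong[OF refl])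
      fix k assume k: "k \<in> {..<N}"
      have e: "N - Suc k = i \<longleftrightarrow> k = N - Suc i" "N - Suc k = N - Suc i \<longleftrightarrow> k = i"
        using k ij by auto
      have "(x * J) $$ (i, k) = (if k = N - Suc i then P i else if k = i then Q i else 0)"
        using k ij flip(2)[of k] by (simp add: mult_J_index[OF xM] xi e)
      thus "(x * J) $$ (i, k) * x $$ (k, j) = (if k = i then Q i * x $$ (i, j) else 0) +
        (if k = N - Suc i then P i * x $$ (N - Suc i, j) else 0)"
        using flip(4)[OF ij(1)] by auto
    qed
    also have "\<dots> = Q i * x $$ (i, j) + P i * x $$ (N - Suc i, j)"
      using ij flip(2)[OF ij(1)] by (simp add: sum.distrib)
    also have "\<dots> = (if j = N - Suc i then 1 else 0)"
      unfolding xi[OF ij] xi[OF flip(2)[OF ij(1)] ij(2)]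
      using flip[OF ij(1)] QQ[OF ij(1)] QP[OF ij(1)] by (auto simp: mult.commute[of "P i"])
    also have "\<dots> = J $$ (i, j)" using ij by (auto simp: antidiag_mat_def)
    finally show "(x * J * x) $$ (i, j) = J $$ (i, j)" .
  qed (simp_all add: x_def antidiag_mat_def)
  have trace: "tr (Mop (x * J)) = 0"
  proof -
    have "tr (Mop (x * J)) = (\<Sum>i<N. Q i)"
      unfolding tr_Mop
    proof (rule sum.cong[OF refl])
      fix i assume i: "i \<in> {..<N}"
      hence "i < N" by simp
      note f = flip[OF this]
      show "(x * J) $$ (i, i) = Q i"
        using i f by (simp add: mult_J_index[OF xM] xi)
    qed
    moreover have "2 * (\<Sum>i<N. Q i) = 0"
    proof -
      have a: "(\<Sum>i<N. Q (N - Suc i)) = (\<Sum>i<N. Q i)" by (rule sum.nat_diff_reindex)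
      have b: "(\<Sum>i<N. Q (N - Suc i)) = - (\<Sum>i<N. Q i)" by (simp add: QQ sum_negf)
      show ?thesis unfolding mult_2[of "sum Q _"] using trans[OF a[symmetric] b] by (simp only: eq_neg_iff_add_eq_0)
    qed
    ultimately have "2 * tr (Mop (x * J)) = 0" by simp
    thus ?thesis using two_neq_0 by (simp only: mult_eq_0_iff) auto
  qed
  have xX: "x \<in> X" using xM herm invol trace by (simp add: hermitian_iff)
  have near: "(x - J) $$ (i, j) \<in> val_ideal w 1" if ij: "i < N" "j < N" for i j
  proof -
    have "2 * (\<theta> * \<sigma> \<theta>) \<in> val_ideal w 1"
      by (rule k'.ideal_mult_right[OF two k'.ideal_mult_left]) (use \<theta>(1) in simp_all)
    hence P1: "P i \<in> val_ideal w 1" using two by (simp add: P_def)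
    have "2 * \<theta> \<in> val_ideal w 1" by (rule k'.ideal_mult_right[OF two \<theta>(1)])
    moreover have "Q i - 1 = (if i < n then - (2 * \<theta>) else 2 * \<theta> - 2)" by (simp add: Q_def)
    ultimately have Q1: "Q i - 1 \<in> val_ideal w 1" using two by (auto intro: k'.ideal_diff)
    have "J $$ (i, j) = (if j = N - Suc i then 1 else 0)" using ij by (auto simp: antidiag_mat_def)
    moreover have "(x - J) $$ (i, j) = x $$ (i, j) - J $$ (i, j)" using ij by (simp add: antidiag_mat_def)
    ultimately show ?thesis using P1 Q1 flip(4)[OF ij(1)] by (auto simp: xi ij)
  qed
  \<comment> \<open>The action fixes \<open>J\<close>, so \<open>y - J = g * (x - J) * ct g\<close>
    keeps the congruence for integral \<open>g\<close>. The corner entry of \<open>y\<close> is then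
    congruent to 1, and it lies off the diagonal.\<close>
  have "\<not> diagonal_mat y" if "y \<in> unitary_orbit \<sigma> K x" for y
  proof -
    obtain g where g: "g \<in> K" "y = g * x * ct g" using \<open>y \<in> _\<close> by (auto simp: unitary_orbit_def)
    have gG: "g \<in> G" "integral_mat g" using g by (auto simp: K_iff)
    have gM: "g \<in> M" using gG by (simp add: unitary_iff)
    have dM: "x - J \<in> M" by (rule minus_carrier_mat) simp
    have "g * (x - J) * ct g = (g * x - g * J) * ct g"
      using gM xM by (simp add: mult_minus_distrib_mat[of _ "N" "N"])
    also have "\<dots> = y - g * J * ct g" unfolding g(2)
      using gM xM by (intro minus_mult_distrib_mat) auto
    also have "g * J * ct g = J" by (rule unitary_inverse(4)[OF gG(1)])
    finally have e: "g * (x - J) * ct g = y - J" .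
    have "(g * (x - J)) $$ (i, j) \<in> val_ideal w 1" if "i < N" "j < N" for i j
    proof -
      have "(g * (x - J)) $$ (i, j) = (\<Sum>r<N. g $$ (i, r) * (x - J) $$ (r, j))"
        by (rule index_mult_sum[OF gM dM that])
      thus ?thesis using near gG(2) that by (auto simp: integral_mat_def intro!: k'.ideal_sum k'.ideal_mult_left simp del: index_minus_mat(1))
    qed
    note 1 = this
    have c: "integral_mat (ct g)" by (rule integral_mat_ct[OF gM gG(2)])
    have i: "0 < N" "N - 1 < N" using n by auto
    have "(g * (x - J) * ct g) $$ (0, N - 1) = (\<Sum>r<N. (g * (x - J)) $$ (0, r) * ct g $$ (r, N - 1))"
      by (rule index_mult_sum[of _ "N" "N" _ "N"]) (use gM dM i in auto)
    also have "\<dots> \<in> val_ideal w 1"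
      using 1 c i by (auto simp: integral_mat_def intro!: k'.ideal_sum k'.ideal_mult_right)
    finally have "(y - J) $$ (0, N - 1) \<in> val_ideal w 1" unfolding e .
    hence "y $$ (0, N - 1) - 1 \<in> val_ideal w 1" using i by (simp add: antidiag_mat_def)
    hence "y $$ (0, N - 1) \<noteq> 0" using k'.one_notin_ideal[of 1] by auto
    moreover have "y \<in> M" using g gM xM by simp
    ultimately show ?thesis using i n unfolding diagonal_mat_def by force
  qed
  thus ?thesis using xX by blast
qed

end


section \<open>Hyperbolic pairs\<close>

locale odd_hermitian_involution = hermitian_involution v w \<iota> \<sigma> n Y
  for v :: "'k :: field_char_0 \<Rightarrow> int" and w :: "'l :: field \<Rightarrow> int" and \<iota> \<sigma> n Y +
  fixes q :: 'l
  assumes q: "q \<noteq> 0" "w q = 1" "\<sigma> q = q" and two: "w 2 = 0"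
begin

lemma half_integral: "1 / 2 \<in> val_ring w" "inverse 2 \<in> val_ring w"
  using two two_neq_0 by (simp_all add: val_ideal_def k'.v_divide k'.v_inverse)

definition integral_op :: "((nat \<Rightarrow> 'l) \<Rightarrow> nat \<Rightarrow> 'l) \<Rightarrow> bool" where
  "integral_op T \<longleftrightarrow> (\<forall>x. integral x \<longrightarrow> integral (T x))"

lemma qpow: "q powi m \<noteq> 0" "w (q powi m) = m" "\<sigma> (q powi m) = q powi m"
  using q by (simp_all add: k'.v_power_int \<sigma>_powi)

lemma scal_qpow: "scal (q powi m) (scal (q powi (- m)) x) = x"
  using qpow(1)[of m] by (simp add: scal_scal power_int_minus) (simp add: scal_def)

text \<open>The standard lattice is self-dual: coordinates of \<open>T y\<close> are values of
  \<open>h\<close> at unit vectors, so a bound for the form means divisibility of the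
  operator.\<close>

lemma scale_integral:
  assumes adj: "\<And>x y. h (T x) y = h x (T y)" and supp: "supp (T y)"
    and m: "\<And>x y. integral x \<Longrightarrow> integral y \<Longrightarrow> h x (T y) \<in> val_ideal w m"
    and y: "integral y"
  shows "T y i \<in> val_ideal w m" "integral (scal (q powi (- m)) (T y))"
proof -
  have 1: "T y i \<in> val_ideal w m" for i
  proof (cases "i < N")
    case True
    have "T y i = h (unit_fun (N - Suc i)) (T y)" using True by (simp add: h_unit_left)
    thus ?thesis using m[OF integral_unit y] by simp
  qed (use supp in \<open>simp add: supp_def\<close>)
  thus "T y i \<in> val_ideal w m" .
  have "q powi (- m) * T y i \<in> val_ideal w (- m + m)" for i
    by (rule k'.ideal_mult[OF _ 1]) (simp add: val_ideal_def qpow)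
  thus "integral (scal (q powi (- m)) (T y))" by (simp add: integral_def scal_def)
qed

text \<open>If \<open>T\<close> is divisible by \<open>q\<^sup>m\<close>, then \<open>T\<^sup>2\<close> is divisible by \<open>q\<^sup>2\<^sup>m\<close>.\<close>

lemma minimum_nonpos:
  assumes lin: "lin_op T" and adj: "\<And>x y. h (T x) y = h x (T y)" and supp: "\<And>y. supp (T y)"
    and x: "integral x" "h x (T x) \<noteq> 0" "w (h x (T x)) = m"
    and m: "\<And>x y. integral x \<Longrightarrow> integral y \<Longrightarrow> h x (T y) \<in> val_ideal w m"
    and sq: "h x (T (T x)) = c * h x (T x)" and c: "c \<noteq> 0" "w c = 0"
  shows "m \<le> 0"
proof -
  define z where "z = scal (q powi (- m)) (T x)"
  have z: "integral z" unfolding z_def by (rule scale_integral(2)[where T = T, OF adj supp m x(1)])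
  have Tx: "T x = scal (q powi m) z" by (simp add: z_def scal_qpow)
  have "h x (T (T x)) = q powi m * h x (T z)" by (simp add: Tx lin_op_scal[OF lin] h_scal_right)
  also have "\<dots> \<in> val_ideal w (m + m)"
    by (intro k'.ideal_mult m x z) (simp add: val_ideal_def qpow)
  finally have "c * h x (T x) \<in> val_ideal w (m + m)" by (simp add: sq)
  thus ?thesis using c x by (simp add: val_ideal_def k'.v_mult)
qed

text \<open>A nonzero idempotent is not divisible by the prime: divisibility of \<open>E\<close>
  would pass to a higher power through \<open>E (E x) = E x\<close>.\<close>

lemma projection_minimum_nonpos:
  assumes E: "projection E" and ne: "tr E \<noteq> 0"
    and m: "\<And>x y. integral x \<Longrightarrow> integral y \<Longrightarrow> h x (E y) \<in> val_ideal w m"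
  shows "m \<le> 0"
proof -
  note P = projectionD[OF E]
  have "\<exists>x. E x \<noteq> (\<lambda>_. 0)"
  proof (rule ccontr)
    assume "\<not> ?thesis"
    thus False using ne by (simp add: tr_def)
  qed
  then obtain x0 where x0: "E x0 \<noteq> (\<lambda>_. 0)" by blast
  obtain l x where x: "integral x" "h x (E x) \<noteq> 0" "w (h x (E x)) = l"
    "\<And>x y. integral x \<Longrightarrow> integral y \<Longrightarrow> h x (E y) \<in> val_ideal w l"
    by (rule hermitian_minimum[OF P(1) P(5) P(2) x0]) blast
  have "l \<le> 0" by (rule minimum_nonpos[where T = E and c = 1 and x = x]) (use P x in auto)
  moreover have "m \<le> l" using m[OF x(1) x(1)] x(2,3) by (simp add: val_ideal_def)
  ultimately show ?thesis by simp
qed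

text \<open>\<open>g\<close> and \<open>f\<close> behave like the unit vectors at \<open>k\<close>
  and \<open>N - Suc k\<close> under the operator of a weight matrix whose weight in place
  \<open>k\<close> is \<open>l\<close>.\<close>

definition hyperbolic_pair :: "int \<Rightarrow> (nat \<Rightarrow> 'l) \<Rightarrow> (nat \<Rightarrow> 'l) \<Rightarrow> bool" where
  "hyperbolic_pair l f g \<longleftrightarrow> integral f \<and> integral g \<and> supp f \<and> supp g \<and>
     h f f = 0 \<and> h g g = 0 \<and> h f g = 1 \<and>
     Y f = scal (q powi l) g \<and> Y g = scal (q powi (- l)) f"

text \<open>\<open>vp\<close> and \<open>vm\<close> are orthogonal of opposite norms, so their sum
  and difference are isotropic. Splitting them off divides by norms of valuation \<open>l\<close>,
  but they span the same plane as \<open>f\<close> and \<open>g\<close>, where the denominators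
  cancel. The trace of \<open>Y\<close> is unchanged, as 1 and -1 leave together.\<close>

lemma hyperbolic_pair_split:
  assumes E: "projection E" and int: "integral_op E"
    and p: "E vp = vp" "Y vp = vp" "h vp vp = 2 * q powi l"
    and m: "E vm = vm" "Y vm = scal (-1) vm" "h vm vm = - (2 * q powi l)"
    and f_def: "f = comb (1 / 2) vp (1 / 2) vm"
    and g_def: "g = comb (1 / (2 * q powi l)) vp (- (1 / (2 * q powi l))) vm"
    and fg: "integral f" "integral g"
  shows "hyperbolic_pair l f g \<and> E f = f \<and> E g = g \<and>
    (\<exists>E'. projection E' \<and> integral_op E' \<and> tr E' = tr E - 2 \<and> tr (\<lambda>x. Y (E' x)) = tr (\<lambda>x. Y (E x)) \<and>
      E' f = (\<lambda>_. 0) \<and> E' g = (\<lambda>_. 0) \<and> (\<forall>x. E x = (\<lambda>_. 0) \<longrightarrow> E' x = (\<lambda>_. 0)))"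
proof -
  define r where "r = q powi l"
  have r: "r \<noteq> 0" "\<sigma> r = r" "w r = l" by (simp_all add: r_def qpow q(1))
  note P = projectionD[OF E]
  have nz: "h vp vp \<noteq> 0" "h vm vm \<noteq> 0" using p(3) m(3) two_neq_0 q(1) by simp_all
  have p': "Y vp = scal 1 vp" using p by (simp add: scal_def)
  have sp: "supp vp" "supp vm" using P(2)[of vp] P(2)[of vm] p m by simp_all
  have o: "h vp vm = 0" "h vm vp = 0"
  proof -
    have "h vp vm = h (Y vp) vm" by (simp add: p)
    also have "\<dots> = h vp (Y vm)" by (rule Y_adj)
    also have "\<dots> = - h vp vm" by (simp add: m h_scal_right)
    finally have "2 * h vp vm = 0" by (simp only: mult_2 eq_neg_iff_add_eq_0)
    thus "h vp vm = 0" using two_neq_0 by (simp only: mult_eq_0_iff) auto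
    thus "h vm vp = 0" using h_hermitian[of vp vm] by simp
  qed
  have s2: "\<sigma> 2 = 2" by (simp add: \<sigma>.hom_numeral)
  have ssf: "\<sigma> (1 / 2) = 1 / 2" "\<sigma> (1 / (2 * r)) = 1 / (2 * r)" "\<sigma> (- (1 / (2 * r))) = - (1 / (2 * r))"
    by (simp_all add: \<sigma>_div \<sigma>.hom_mult \<sigma>.hom_uminus s2 r)
  have hf: "h f x = (h vp x + h vm x) / 2" for x
    unfolding f_def h_comb_left ssf by (simp add: add_divide_distrib)
  have hg: "h g x = (h vp x - h vm x) / (2 * r)" for x
    unfolding g_def r_def[symmetric] h_comb_left ssf by (simp add: diff_divide_distrib)
  have hvf: "h vp f = r" "h vm f = - r" "h vp g = 1" "h vm g = 1"
    using r two_neq_0 by (simp_all add: f_def g_def r_def[symmetric] h_comb_right o p m)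
  have "h f f = 0" "h g g = 0" "h f g = 1" using two_neq_0 by (simp_all add: hf hg hvf)
  moreover have "Y f = scal (q powi l) g"
    unfolding f_def g_def r_def[symmetric] lin_opD[OF Y_lin] p m
    using r two_neq_0 by (simp add: comb_def scal_def fun_eq_iff field_simps)
  moreover have "Y g = scal (q powi (- l)) f"
    unfolding f_def g_def power_int_minus r_def[symmetric] lin_opD[OF Y_lin] p m
    using r two_neq_0 by (simp add: comb_def scal_def fun_eq_iff field_simps)
  moreover have "supp f" "supp g" unfolding f_def g_def by (intro supp_comb sp)+
  ultimately have pair: "hyperbolic_pair l f g" using fg by (simp add: hyperbolic_pair_def)
  have Efg: "E f = f" "E g = g" by (simp_all add: f_def g_def lin_opD[OF P(1)] p m)
  note S1 = E p(1) nz(1) p'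
  define E1 where "E1 = split_off E vp"
  have E1: "projection E1" unfolding E1_def by (rule projection_split_off[OF S1]) simp
  have E1m: "E1 vm = vm" by (simp add: E1_def split_off_def o m comb_def)
  note S2 = E1 E1m nz(2) m(2)
  define E2 where "E2 = split_off E1 vm"
  have E2: "projection E2" unfolding E2_def by (rule projection_split_off[OF S2]) simp
  have t: "tr E2 = tr E - 2"
  proof -
    have "tr E2 = tr E1 - 1" unfolding E2_def by (rule tr_split_off[OF S2]) simp
    moreover have "tr E1 = tr E - 1" unfolding E1_def by (rule tr_split_off[OF S1]) simp
    ultimately show ?thesis by simp
  qed
  have tY: "tr (\<lambda>x. Y (E2 x)) = tr (\<lambda>x. Y (E x))"
  proof -
    have "tr (\<lambda>x. Y (E2 x)) = tr (\<lambda>x. Y (E1 x)) - (-1)" unfolding E2_def by (rule tr_Y_split_off[OF S2]) simp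
    moreover have "tr (\<lambda>x. Y (E1 x)) = tr (\<lambda>x. Y (E x)) - 1" unfolding E1_def by (rule tr_Y_split_off[OF S1]) simp
    ultimately show ?thesis by simp
  qed
  have k1: "E1 x = (\<lambda>_. 0)" if "E x = (\<lambda>_. 0)" for x
    unfolding E1_def by (rule split_off_kernel[OF S1 _ that]) simp
  have k2: "E2 x = (\<lambda>_. 0)" if "E1 x = (\<lambda>_. 0)" for x
    unfolding E2_def by (rule split_off_kernel[OF S2 _ that]) simp
  have "E1 vp = (\<lambda>_. 0)" unfolding E1_def by (rule split_off_self[OF S1]) simp
  hence "E2 vp = (\<lambda>_. 0)" by (rule k2)
  moreover have "E2 vm = (\<lambda>_. 0)" unfolding E2_def by (rule split_off_self[OF S2]) simp
  ultimately have E2fg: "E2 f = (\<lambda>_. 0)" "E2 g = (\<lambda>_. 0)"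
    unfolding f_def g_def lin_opD[OF projectionD(1)[OF E2]] by (simp_all add: comb_def)
  \<comment> \<open>The complement in terms of \<open>f\<close> and \<open>g\<close>, which are dual
    to each other: the coefficients are \<open>h g x\<close> and \<open>h f x\<close>, integral for
    integral \<open>x\<close>, in place of quotients by \<open>h vp vp\<close> and
    \<open>h vm vm\<close>.\<close>
  have formula: "E2 x = comb 1 (comb 1 (E x) (- h g x) f) (- h f x) g" for x
  proof
    fix i
    have "E2 x i = E x i - h vp x / (2 * r) * vp i + h vm x / (2 * r) * vm i"
      by (simp add: E2_def E1_def split_off_def comb_def p m r_def)
    also have "\<dots> = E x i - (h vp x - h vm x) / (2 * r) * ((vp i + vm i) / 2) - (h vp x + h vm x) / 2 * ((vp i - vm i) / (2 * r))"
    proof -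
      define e where "e = (1 / 2 :: 'l)"
      define d where "d = 1 / (2 * r)"
      have "(h vp x - h vm x) * d * ((vp i + vm i) * e) + (h vp x + h vm x) * e * ((vp i - vm i) * d) =
          (e + e) * (h vp x * d * vp i - h vm x * d * vm i)"
        by (simp add: algebra_simps)
      moreover have "e + e = 1" using two_neq_0 by (simp add: e_def)
      ultimately have "(h vp x - h vm x) * d * ((vp i + vm i) * e) + (h vp x + h vm x) * e * ((vp i - vm i) * d) =
          h vp x * d * vp i - h vm x * d * vm i" by simp
      hence "(h vp x - h vm x) / (2 * r) * ((vp i + vm i) / 2) + (h vp x + h vm x) / 2 * ((vp i - vm i) / (2 * r)) =
          h vp x / (2 * r) * vp i - h vm x / (2 * r) * vm i" by (simp add: d_def e_def)
      thus ?thesis unfolding diff_diff_eq by simp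
    qed
    also have "\<dots> = comb 1 (comb 1 (E x) (- h g x) f) (- h f x) g i"
    proof -
      have "(vp i + vm i) / 2 = f i" "(vp i - vm i) / (2 * r) = g i"
        by (simp_all add: f_def g_def r_def comb_def add_divide_distrib diff_divide_distrib)
      thus ?thesis unfolding hf[symmetric] hg[symmetric] by (simp add: comb_apply)
    qed
    finally show "E2 x i = comb 1 (comb 1 (E x) (- h g x) f) (- h f x) g i" .
  qed
  have "integral_op E2"
    unfolding integral_op_def formula
  proof (intro allI impI)
    fix x assume x: "integral x"
    have xi: "x i \<in> val_ring w" for i using x by (simp add: integral_def)
    show "integral (comb 1 (comb 1 (E x) (- h g x) f) (- h f x) g)"
      using int x fg h_ideal[OF fg(1), of x 0] h_ideal[OF fg(2), of x 0] xi
      by (intro integral_comb) (auto simp: integral_op_def)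
  qed
  thus ?thesis using pair Efg E2 t tY E2fg k1 k2 by blast
qed

lemma hyperbolic_pair_exists:
  assumes E: "projection E" and int: "integral_op E" and ne: "tr E \<noteq> 0" and tY: "tr (\<lambda>x. Y (E x)) = 0"
  obtains l f g E' where "l \<ge> 0" "hyperbolic_pair l f g" "E f = f" "E g = g"
    "projection E'" "integral_op E'" "tr E' = tr E - 2" "tr (\<lambda>x. Y (E' x)) = 0"
    "E' f = (\<lambda>_. 0)" "E' g = (\<lambda>_. 0)" "\<And>x. E x = (\<lambda>_. 0) \<Longrightarrow> E' x = (\<lambda>_. 0)"
proof -
  note out = that
  note P = projectionD[OF E]
  \<comment> \<open>Both cases below only have to supply eigenvectors of norms
    \<open>2 * q powi l\<close> and its negative whose half sum and scaled half difference are
    integral.\<close>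
  have goal: thesis if hyps: "l \<ge> 0" "E vp = vp" "Y vp = vp" "h vp vp = 2 * q powi l"
    "E vm = vm" "Y vm = scal (-1) vm" "h vm vm = - (2 * q powi l)"
    "integral (comb (1 / 2) vp (1 / 2) vm)"
    "integral (comb (1 / (2 * q powi l)) vp (- (1 / (2 * q powi l))) vm)" for l vp vm
  proof -
    let ?f = "comb (1 / 2) vp (1 / 2) vm"
    let ?g = "comb (1 / (2 * q powi l)) vp (- (1 / (2 * q powi l))) vm"
    obtain E' where E': "projection E'" "integral_op E'" "tr E' = tr E - 2" "tr (\<lambda>x. Y (E' x)) = tr (\<lambda>x. Y (E x))"
      "E' ?f = (\<lambda>_. 0)" "E' ?g = (\<lambda>_. 0)" "\<And>x. E x = (\<lambda>_. 0) \<Longrightarrow> E' x = (\<lambda>_. 0)"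
      and fg: "hyperbolic_pair l ?f ?g" "E ?f = ?f" "E ?g = ?g"
      using hyperbolic_pair_split[OF E int hyps(2-7) refl refl hyps(8,9)] by blast
    show thesis
      by (rule out[OF hyps(1) fg E'(1,2,3) _ E'(5,6,7)]) (simp add: E'(4) tY)
  qed
  define T where "T x = Y (E x)" for x
  have Tlin: "lin_op T" by (simp add: T_def lin_op_def lin_opD[OF P(1)] lin_opD[OF Y_lin])
  have Tadj: "h (T x) y = h x (T y)" for x y by (simp add: T_def Y_adj P)
  have Tsupp: "supp (T x)" for x by (simp add: T_def Y_supp)
  have TT: "T (T x) = E x" for x by (simp add: T_def P Y_Y[OF P(2)])
  have "\<exists>x. E x \<noteq> (\<lambda>_. 0)"
  proof (rule ccontr)
    assume "\<not> ?thesis"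
    thus False using ne by (simp add: tr_def)
  qed
  then obtain x0 where x0: "E x0 \<noteq> (\<lambda>_. 0)" by blast
  have "T x0 \<noteq> (\<lambda>_. 0)"
  proof
    assume "T x0 = (\<lambda>_. 0)"
    hence "E x0 = T (scal 0 x0)" using TT[of x0] by (simp add: scal_def)
    hence "E x0 = (\<lambda>_. 0)" by (simp add: lin_op_scal[OF Tlin]) (simp add: scal_def)
    thus False using x0 by simp
  qed
  then obtain m u where u: "integral u" "h u (T u) \<noteq> 0" "w (h u (T u)) = m"
    and m: "\<And>x y. integral x \<Longrightarrow> integral y \<Longrightarrow> h x (T y) \<in> val_ideal w m"
    by (rule hermitian_minimum[OF Tlin Tadj Tsupp]) blast
  \<comment> \<open>\<open>T\<close> is a square root of \<open>E\<close>: if \<open>T\<close> were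
    divisible by \<open>q powi m\<close> with \<open>m > 0\<close>, then \<open>E\<close> would be
    divisible by \<open>q powi (m + m)\<close>.\<close>
  have "m \<le> 0"
  proof (rule ccontr)
    assume "\<not> m \<le> 0"
    have "h x (E y) \<in> val_ideal w (m + m)" if xy: "integral x" "integral y" for x y
    proof -
      define z where "z = scal (q powi (- m)) (T y)"
      have z: "integral z" unfolding z_def by (rule scale_integral(2)[where T = T, OF Tadj Tsupp m xy(2)])
      have "T y = scal (q powi m) z" by (simp add: z_def scal_qpow)
      hence "h x (E y) = q powi m * h x (T z)" by (simp add: TT[symmetric] lin_op_scal[OF Tlin] h_scal_right)
      also have "\<dots> \<in> val_ideal w (m + m)"
        by (intro k'.ideal_mult m xy z) (simp add: val_ideal_def qpow)
      finally show ?thesis .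
    qed
    hence "m + m \<le> 0" by (rule projection_minimum_nonpos[OF E ne])
    thus False using \<open>\<not> m \<le> 0\<close> by simp
  qed
  show thesis
  proof (cases "m = 0")
    case False
    define l where "l = - m"
    have l: "l \<ge> 1" using False \<open>m \<le> 0\<close> by (simp add: l_def)
    define r where "r = q powi l"
    have r: "r \<noteq> 0" "\<sigma> r = r" "w r = l" by (simp_all add: r_def qpow q(1))
    have rP: "r \<in> val_ideal w l" using r by (simp add: val_ideal_def)
    define a where "a = E u"
    define z where "z = scal r (T u)"
    have ai: "integral a" using int u by (simp add: a_def integral_op_def)
    have zi: "integral z" unfolding z_def r_def l_def by (rule scale_integral(2)[where T = T, OF Tadj Tsupp m u(1)])
    have Ea: "E a = a" "E z = z" by (simp_all add: a_def z_def lin_op_scal[OF P(1)] T_def P)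
    have Ya: "scal r (Y a) = z" by (simp add: a_def z_def T_def)
    have Yz: "Y z = scal r a" by (simp add: z_def lin_op_scal[OF Y_lin] T_def Y_Y[OF P(2)] a_def)
    define c where "c = h a a"
    have c: "c \<in> val_ring w" "\<sigma> c = c" unfolding c_def
      using h_ideal[OF ai, of a 0] ai by (simp_all add: integral_def h_hermitian)
    define e where "e = r * h u (T u)"
    have hua: "h a (T u) = h u (T u)"
      by (simp add: a_def P(5)) (simp add: T_def P)
    have haz: "h a z = e" by (simp add: z_def h_scal_right hua e_def)
    have e: "e \<noteq> 0" "w e = 0" using u r by (simp_all add: e_def k'.v_mult l_def)
    have "\<sigma> (h u (T u)) = h u (T u)" by (simp add: h_hermitian Tadj)
    hence se: "\<sigma> e = e" by (simp add: e_def \<sigma>.hom_mult r)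
    have hza: "h z a = e" using h_hermitian[of a z] by (simp add: haz se)
    have hzz: "h z z = r * r * c"
    proof -
      have "h z z = r * (r * h (T u) (T u))" by (simp add: z_def h_scal_left h_scal_right r)
      also have "h (T u) (T u) = c" by (simp add: Tadj TT c_def a_def P(5)) (simp add: P)
      finally show ?thesis by simp
    qed
    have rc: "r * c \<in> val_ideal w l" by (rule k'.ideal_mult_right[OF rP c(1)])
    \<comment> \<open>\<open>z + r a\<close> and \<open>z - r a\<close> are eigenvectors for 1 and
      -1, of norms \<open>2 * r * ep\<close> and \<open>- (2 * r * em)\<close>. As
      \<open>l \<ge> 1\<close>, both \<open>ep\<close> and \<open>em\<close> are congruent to the
      unit \<open>e\<close>, so their inverses are norms of units.\<close>
    define ep where "ep = e + r * c"
    define em where "em = e - r * c"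
    have ep: "ep \<noteq> 0" "w ep = 0" "\<sigma> ep = ep"
      using k'.v_add_eq[of e "r * c"] e k'.ideal_mono[OF rc, of 1] l
      by (simp_all add: ep_def \<sigma>.hom_add \<sigma>.hom_mult se r c)
    have em: "em \<noteq> 0" "w em = 0" "\<sigma> em = em"
      using k'.v_add_eq[of e "- (r * c)"] e k'.ideal_mono[OF rc, of 1] l
      by (simp_all add: em_def \<sigma>.hom_minus \<sigma>.hom_mult se r c)
    obtain \<beta> where \<beta>: "\<beta> * \<sigma> \<beta> = 1 / em" "\<beta> \<noteq> 0" "w \<beta> = 0"
      by (rule unit_norm[of "1 / em"]) (use em in \<open>simp_all add: \<sigma>_div k'.v_divide\<close>)
    \<comment> \<open>The second vector of the pair has the coefficient
      \<open>(\<alpha> - \<beta>) / (2 * r)\<close>, so scalings of norms \<open>1 / ep\<close> and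
      \<open>1 / em\<close> must agree modulo \<open>q powi l\<close>. These norms do agree, and
      Newton iteration started at \<open>\<beta>\<close> yields an \<open>\<alpha>\<close> that
      close to it.\<close>
    have close: "1 / ep - \<beta> * \<sigma> \<beta> \<in> val_ideal w l"
    proof -
      have "1 / ep - \<beta> * \<sigma> \<beta> = r * c * (- (2 / (ep * em)))"
      proof -
        have "1 / ep - 1 / em = (em - ep) / (ep * em)" using ep em by (simp add: field_simps)
        also have "em - ep = r * c * (- 2)" by (simp add: ep_def em_def)
        finally show ?thesis by (simp add: \<beta>)
      qed
      also have "\<dots> \<in> val_ideal w l"
        by (rule k'.ideal_mult_right[OF rc])
          (use ep em two two_neq_0 in \<open>simp add: val_ideal_def k'.v_divide k'.v_mult\<close>)
      finally show ?thesis .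
    qed
    obtain \<alpha> where \<alpha>: "\<alpha> * \<sigma> \<alpha> = 1 / ep" "\<alpha> - \<beta> \<in> val_ideal w l"
      by (rule norm_Hensel[OF _ \<beta>(2,3) l close]) (use ep in \<open>simp add: \<sigma>_div\<close>)
    have \<beta>r: "\<beta> \<in> val_ring w" using \<beta> by (simp add: val_ideal_def)
    have \<alpha>r: "\<alpha> \<in> val_ring w"
      using k'.ideal_add[OF \<beta>r k'.ideal_mono[OF \<alpha>(2), of 0]] l by simp
    define vp where "vp = comb \<alpha> z (\<alpha> * r) a"
    define vm where "vm = comb \<beta> z (- (\<beta> * r)) a"
    show thesis
    proof (rule goal[of l vp vm])
      show "l \<ge> 0" using l by simp
      show "E vp = vp" "E vm = vm" by (simp_all add: vp_def vm_def lin_opD[OF P(1)] Ea)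
      have rYa: "r * Y a i = z i" for i using fun_cong[OF Ya, of i] by (simp add: scal_def)
      show "Y vp = vp"
        unfolding vp_def lin_opD[OF Y_lin] Yz by (simp add: comb_def scal_def fun_eq_iff rYa mult.assoc)
      show "Y vm = scal (-1) vm"
        unfolding vm_def lin_opD[OF Y_lin] Yz by (simp add: comb_def scal_def fun_eq_iff rYa mult.assoc)
      have "h vp vp = (\<alpha> * \<sigma> \<alpha>) * (2 * r * ep)"
        by (simp add: vp_def h_comb_left h_comb_right haz hza hzz c_def[symmetric] \<sigma>.hom_mult r ep_def algebra_simps)
      thus "h vp vp = 2 * q powi l" using ep by (simp add: \<alpha> r_def)
      have "h vm vm = - ((\<beta> * \<sigma> \<beta>) * (2 * r * em))"
        by (simp add: vm_def h_comb_left h_comb_right haz hza hzz c_def[symmetric] \<sigma>.hom_mult \<sigma>.hom_uminus r em_def algebra_simps)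
      thus "h vm vm = - (2 * q powi l)" using em by (simp add: \<beta> r_def)
      have ab: "(\<alpha> - \<beta>) / r \<in> val_ring w"
        using \<alpha>(2) r by (cases "\<alpha> = \<beta>") (simp_all add: val_ideal_def k'.v_divide)
      have rr: "r \<in> val_ring w" using k'.ideal_mono[OF rP] l by simp
      have c1: "1 / 2 * (\<alpha> + \<beta>) \<in> val_ring w"
        by (intro k'.ideal_mult_left[OF half_integral(1)] k'.ideal_add \<alpha>r \<beta>r)
      have c2: "1 / 2 * (r * (\<alpha> - \<beta>)) \<in> val_ring w"
        by (intro k'.ideal_mult_left[OF half_integral(1)] k'.ideal_mult_left[OF rr] k'.ideal_diff \<alpha>r \<beta>r)
      have c3: "1 / 2 * ((\<alpha> - \<beta>) / r) \<in> val_ring w"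
        by (rule k'.ideal_mult_left[OF half_integral(1) ab])
      have e1: "comb (1 / 2) vp (1 / 2) vm = comb (1 / 2 * (\<alpha> + \<beta>)) z (1 / 2 * (r * (\<alpha> - \<beta>))) a"
        by (simp add: vp_def vm_def comb_def fun_eq_iff field_simps two_neq_0)
      show "integral (comb (1 / 2) vp (1 / 2) vm)"
        unfolding e1 by (intro integral_comb c1 c2 zi ai)
      have e2: "comb (1 / (2 * q powi l)) vp (- (1 / (2 * q powi l))) vm =
          comb (1 / 2 * ((\<alpha> - \<beta>) / r)) z (1 / 2 * (\<alpha> + \<beta>)) a"
        using r(1) of_nat_eq_0_iff_ext[of 4]
        by (simp add: vp_def vm_def r_def[symmetric] comb_def fun_eq_iff field_simps two_neq_0)
      show "integral (comb (1 / (2 * q powi l)) vp (- (1 / (2 * q powi l))) vm)"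
        unfolding e2 by (intro integral_comb c3 c1 zi ai)
    qed
  next
    case True
    \<comment> \<open>Trace 0 of \<open>Y\<close> on the nonzero range of \<open>E\<close> leaves
      both eigenvalues present. As \<open>m = 0\<close>, \<open>T\<close> and hence the eigenpart
      are integral; the eigenpart squares to a unit multiple of itself, so its minimum
      \<open>k\<close> is 0, and the eigenvector has unit norm, adjustable to
      \<open>2 * \<epsilon>\<close>.\<close>
    have eig: "\<exists>b. E b = b \<and> Y b = scal \<epsilon> b \<and> integral b \<and> h b b = 2 * \<epsilon>" if \<epsilon>: "\<epsilon> = 1 \<or> \<epsilon> = -1" for \<epsilon>
    proof -
      let ?S = "eigenpart E \<epsilon>"
      have "tr (\<lambda>x. Y (E x)) + \<epsilon> * tr E \<noteq> 0" using ne \<epsilon> by (auto simp: tY)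
      then obtain x0 where x0: "?S x0 \<noteq> (\<lambda>_. 0)" by (rule eigenpart_nonzero[OF E \<epsilon>])
      obtain k s where s: "integral s" "h s (?S s) \<noteq> 0" "w (h s (?S s)) = k"
        and k: "\<And>x y. integral x \<Longrightarrow> integral y \<Longrightarrow> h x (?S y) \<in> val_ideal w k"
        by (rule hermitian_minimum[OF eigenpart_lin[OF E \<epsilon>] eigenpart_adj[OF E \<epsilon>] eigenpart_supp[OF E \<epsilon>] x0]) blast
      have we: "\<epsilon> \<noteq> 0" "w \<epsilon> = 0" using \<epsilon> by auto
      have sS: "integral (?S s)"
      proof -
        have Ti: "integral (T s)" using scale_integral(1)[where T = T, OF Tadj Tsupp m s(1)] True
          by (simp add: integral_def)
        have "integral (E s)" using int s by (simp add: integral_op_def)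
        thus ?thesis unfolding eigenpart_def T_def[symmetric] using Ti we by (intro integral_comb) (auto simp: val_ideal_def)
      qed
      have "h s (?S s) \<in> val_ring w" using h_ideal[OF s(1), of "?S s" 0] sS by (simp add: integral_def)
      hence k0: "k \<ge> 0" using s by (simp add: val_ideal_def)
      have nrm: "h (?S s) (?S s) = 2 * \<epsilon> * h s (?S s)" by (rule eigenpart_norm[OF E \<epsilon>])
      have "k \<le> 0"
        by (rule minimum_nonpos[where T = ?S and c = "2 * \<epsilon>" and x = s,
              OF eigenpart_lin[OF E \<epsilon>] eigenpart_adj[OF E \<epsilon>] eigenpart_supp[OF E \<epsilon>] s k])
          (use nrm we two two_neq_0 in \<open>simp_all add: eigenpart_adj[OF E \<epsilon>] k'.v_mult\<close>)
      hence k: "k = 0" using k0 by simp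
      define b where "b = ?S s"
      have sb: "\<sigma> (h b b) = h b b" by (rule h_hermitian)
      have b: "E b = b" "Y b = scal \<epsilon> b" "h b b \<noteq> 0" "w (h b b) = 0"
        using eigenpart_range[OF E \<epsilon>] eigenpart_eigen[OF E \<epsilon>] nrm s two two_neq_0 we k
        by (simp_all add: b_def k'.v_mult)
      obtain d where d: "d * \<sigma> d = 2 * \<epsilon> / h b b" "d \<noteq> 0" "w d = 0"
      proof (rule unit_norm[of "2 * \<epsilon> / h b b"])
        show "\<sigma> (2 * \<epsilon> / h b b) = 2 * \<epsilon> / h b b"
          using \<epsilon> by (auto simp: \<sigma>_div \<sigma>.hom_mult \<sigma>.hom_numeral sb \<sigma>.hom_uminus)
      qed (use b we two two_neq_0 in \<open>simp_all add: k'.v_divide k'.v_mult\<close>)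
      have "h (scal d b) (scal d b) = d * \<sigma> d * h b b" by (simp add: h_scal_left h_scal_right)
      hence "h (scal d b) (scal d b) = 2 * \<epsilon>" using b(3) by (simp add: d)
      moreover have "integral (scal d b)" using d sS by (intro integral_scal) (simp_all add: val_ideal_def b_def)
      ultimately show ?thesis using eigen_scal[OF b(1,2) P(1), of d] by blast
    qed
    obtain vp where vp: "E vp = vp" "Y vp = scal 1 vp" "integral vp" "h vp vp = 2 * 1" using eig[of 1] by blast
    obtain vm where vm: "E vm = vm" "Y vm = scal (-1) vm" "integral vm" "h vm vm = 2 * (-1)" using eig[of "-1"] by blast
    show thesis
    proof (rule goal[of 0 vp vm])
      show "Y vp = vp" using vp by (simp add: scal_def)
      have "integral (comb (1 / 2) vp (1 / 2) vm)" "integral (comb (1 / 2) vp (- (1 / 2)) vm)"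
        by (intro integral_comb vp vm half_integral; simp only: k'.ideal_minus half_integral)+
      thus "integral (comb (1 / 2) vp (1 / 2) vm)"
        "integral (comb (1 / (2 * q powi 0)) vp (- (1 / (2 * q powi 0))) vm)" by simp_all
    qed (use vp vm in simp_all)
  qed
qed

end

context odd_hermitian_involution
begin

lemma kernel_orthogonal:
  assumes "projection E" "E z = (\<lambda>_. 0)" "E b = b"
  shows "h z b = 0" "h b z = 0"
proof -
  have "h b z = h b (E z)" using projectionD(5)[OF assms(1), of b z] assms(3) by simp
  thus *: "h b z = 0" by (simp add: assms(2))
  show "h z b = 0" using h_hermitian[of b z] * by simp
qed

text \<open>Each pair lowers \<open>tr E\<close> by 2 and keeps the trace of \<open>Y\<close> at 0,
  so \<open>n\<close> pairs can be split off. Their exponents come in no recorded order.\<close>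

lemma hyperbolic_system:
  assumes tY: "tr Y = 0"
  obtains f g l where "\<And>i. i < n \<Longrightarrow> l i \<ge> 0 \<and> hyperbolic_pair (l i) (f i) (g i)"
    "\<And>i k. i < n \<Longrightarrow> k < n \<Longrightarrow> i \<noteq> k \<Longrightarrow>
       h (f i) (f k) = 0 \<and> h (f i) (g k) = 0 \<and> h (g i) (f k) = 0 \<and> h (g i) (g k) = 0"
proof -
  have "\<exists>E f g l. projection E \<and> integral_op E \<and> tr E = of_nat N - of_nat (2 * r) \<and>
      tr (\<lambda>x. Y (E x)) = 0 \<and>
      (\<forall>i<r. l i \<ge> 0 \<and> hyperbolic_pair (l i) (f i) (g i) \<and> E (f i) = (\<lambda>_. 0) \<and> E (g i) = (\<lambda>_. 0)) \<and>
      (\<forall>i<r. \<forall>k<r. i \<noteq> k \<longrightarrow>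
         h (f i) (f k) = 0 \<and> h (f i) (g k) = 0 \<and> h (g i) (f k) = 0 \<and> h (g i) (g k) = 0)" if "r \<le> n" for r
    using that
  proof (induction r)
    case 0
    have "integral_op cutoff" by (simp add: integral_op_def integral_def cutoff_def)
    thus ?case using projection_cutoff tr_cutoff tY by (intro exI[of _ cutoff]) simp
  next
    case (Suc r)
    then obtain E f g l where IH: "projection E" "integral_op E" "tr E = of_nat N - of_nat (2 * r)"
      "tr (\<lambda>x. Y (E x)) = 0"
      "\<And>i. i < r \<Longrightarrow> l i \<ge> 0 \<and> hyperbolic_pair (l i) (f i) (g i) \<and> E (f i) = (\<lambda>_. 0) \<and> E (g i) = (\<lambda>_. 0)"
      "\<And>i k. i < r \<Longrightarrow> k < r \<Longrightarrow> i \<noteq> k \<Longrightarrow>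
         h (f i) (f k) = 0 \<and> h (f i) (g k) = 0 \<and> h (g i) (f k) = 0 \<and> h (g i) (g k) = 0"
      using Suc_leD[OF Suc.prems] by blast
    have "tr E = of_nat (N - 2 * r)" unfolding IH(3) using Suc.prems by (subst of_nat_diff) auto
    moreover have "of_nat (N - 2 * r) \<noteq> (0 :: 'l)" using Suc.prems by (simp only: of_nat_eq_0_iff_ext)
    ultimately have ne: "tr E \<noteq> 0" by metis
    obtain l' f' g' E' where new: "l' \<ge> 0" "hyperbolic_pair l' f' g'" "E f' = f'" "E g' = g'"
      "projection E'" "integral_op E'" "tr E' = tr E - 2" "tr (\<lambda>x. Y (E' x)) = 0"
      "E' f' = (\<lambda>_. 0)" "E' g' = (\<lambda>_. 0)" "\<And>x. E x = (\<lambda>_. 0) \<Longrightarrow> E' x = (\<lambda>_. 0)"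
      by (rule hyperbolic_pair_exists[OF IH(1,2) ne IH(4)]) blast
    have t: "tr E' = of_nat N - of_nat (2 * Suc r)" by (simp add: new(7) IH(3))
    have 1: "(l(r := l')) i \<ge> 0 \<and> hyperbolic_pair ((l(r := l')) i) ((f(r := f')) i) ((g(r := g')) i) \<and>
        E' ((f(r := f')) i) = (\<lambda>_. 0) \<and> E' ((g(r := g')) i) = (\<lambda>_. 0)" if i: "i < Suc r" for i
    proof (cases "i = r")
      case True
      thus ?thesis using new by simp
    next
      case False
      hence "i < r" using i by simp
      thus ?thesis using IH(5)[of i] new(11)[of "f i"] new(11)[of "g i"] by auto
    qed
    have 2: "h ((f(r := f')) i) ((f(r := f')) k) = 0 \<and> h ((f(r := f')) i) ((g(r := g')) k) = 0 \<and>
        h ((g(r := g')) i) ((f(r := f')) k) = 0 \<and> h ((g(r := g')) i) ((g(r := g')) k) = 0"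
      if ik: "i < Suc r" "k < Suc r" "i \<noteq> k" for i k
    proof -
      have "h z f' = 0 \<and> h z g' = 0 \<and> h f' z = 0 \<and> h g' z = 0" if "E z = (\<lambda>_. 0)" for z
        using kernel_orthogonal[OF IH(1) that new(3)] kernel_orthogonal[OF IH(1) that new(4)] by simp
      hence o: "h (f j) f' = 0 \<and> h (f j) g' = 0 \<and> h f' (f j) = 0 \<and> h g' (f j) = 0 \<and>
          h (g j) f' = 0 \<and> h (g j) g' = 0 \<and> h f' (g j) = 0 \<and> h g' (g j) = 0" if "j < r" for j
        using IH(5)[OF that] by blast
      consider "i < r" "k < r" | "i = r" "k < r" | "i < r" "k = r" using ik by linarith
      thus ?thesis
        by cases (use ik o[of i] o[of k] IH(6)[of i k] in auto)
    qed
    show ?case using new(5,6,8) t 1 2 by blast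
  qed
  from this[OF order.refl] obtain f g l where
    "\<And>i. i < n \<Longrightarrow> l i \<ge> 0 \<and> hyperbolic_pair (l i) (f i) (g i)"
    "\<And>i k. i < n \<Longrightarrow> k < n \<Longrightarrow> i \<noteq> k \<Longrightarrow>
       h (f i) (f k) = 0 \<and> h (f i) (g k) = 0 \<and> h (g i) (f k) = 0 \<and> h (g i) (g k) = 0" by blast
  thus thesis by (rule that)
qed

end

section \<open>Diagonalisation in an integral hyperbolic basis\<close>

context unitary_uniformized
begin

lemma odd_diagonalisation:
  assumes two: "w 2 = 0" and x: "x \<in> X"
  shows "\<exists>l\<in>dominant_weights n. x \<in> unitary_orbit \<sigma> K (weight_mat q l)"
proof -
  have x': "x \<in> M" "ct x = x" "x * J * x = J" "tr (Mop (x * J)) = 0" using x by (simp_all add: hermitian_iff)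
  interpret HI: hermitian_involution v w \<iota> \<sigma> n "Mop (x * J)"
    by (rule hermitian_involutionI[OF x'(1,2,3)])
  interpret OI: odd_hermitian_involution v w \<iota> \<sigma> n "Mop (x * J)" q
    by unfold_locales (use q two in auto)
  obtain f g ls where ls: "\<And>i. i < n \<Longrightarrow> ls i \<ge> 0 \<and> OI.hyperbolic_pair (ls i) (f i) (g i)"
    and orth: "\<And>i k. i < n \<Longrightarrow> k < n \<Longrightarrow> i \<noteq> k \<Longrightarrow>
       h (f i) (f k) = 0 \<and> h (f i) (g k) = 0 \<and> h (g i) (f k) = 0 \<and> h (g i) (g k) = 0"
    by (rule OI.hyperbolic_system[OF x'(4)]) blast
  \<comment> \<open>Sorting by the negated exponents makes the weights descend, as
    \<open>dominant_weights\<close> demands; the pairs are permuted along.\<close>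
  define xs where "xs = sort_key (\<lambda>i. - ls i) [0..<n]"
  have xs: "length xs = n" "distinct xs" "set xs = {..<n}" "sorted (map (\<lambda>i. - ls i) xs)"
    by (simp_all add: xs_def lessThan_atLeast0)
  define L where "L = map ls xs"
  have len: "length L = n" by (simp add: L_def xs)
  have "sorted_wrt (\<ge>) L"
    using xs(4) by (simp add: L_def sorted_wrt_map)
  hence dom: "L \<in> dominant_weights n"
    using len ls xs(3) by (auto simp: dominant_weights_def L_def)
  have pn: "xs ! i < n" if "i < n" for i using nth_mem[of i xs] that xs by auto
  have pinj: "xs ! i = xs ! k \<longleftrightarrow> i = k" if "i < n" "k < n" for i k
    using xs that by (simp add: nth_eq_iff_index_eq)
  define F where "F i = f (xs ! i)" for i
  define H where "H i = g (xs ! i)" for i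
  have FH: "integral (F i)" "integral (H i)" "supp (F i)" "supp (H i)"
    "Mop (x * J) (F i) = scal (q powi (L ! i)) (H i)" "Mop (x * J) (H i) = scal (q powi (- L ! i)) (F i)"
    if "i < n" for i
    using ls[OF pn[OF that]] that xs(1) by (simp_all add: F_def H_def OI.hyperbolic_pair_def L_def)
  have hFH: "h (F i) (F k) = 0" "h (H i) (H k) = 0" "h (F i) (H k) = (if i = k then 1 else 0)"
    "h (H i) (F k) = (if i = k then 1 else 0)" if ik: "i < n" "k < n" for i k
  proof -
    note a = ls[OF pn[OF ik(1)]] orth[OF pn[OF ik(1)] pn[OF ik(2)]] pinj[OF ik]
    have "h (g (xs ! i)) (f (xs ! i)) = 1"
      using a(1) h_hermitian[of "f (xs ! i)" "g (xs ! i)"] by (simp add: OI.hyperbolic_pair_def)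
    thus "h (F i) (F k) = 0" "h (H i) (H k) = 0" "h (F i) (H k) = (if i = k then 1 else 0)"
      "h (H i) (F k) = (if i = k then 1 else 0)"
      using a by (auto simp: F_def H_def OI.hyperbolic_pair_def)
  qed
  \<comment> \<open>The order \<open>H 0, ..., H (n-1), F (n-1), ..., F 0\<close> has Gram matrix
    \<open>J\<close>, so the matrix \<open>B\<close> of these integral columns lies in
    \<open>K\<close>. In this basis \<open>x * J\<close> acts as \<open>W * J\<close>, whence
    \<open>x = B * W * ct B\<close>.\<close>
  define b where "b i = (if i < n then H i else F (N - Suc i))" for i
  have flip: "N - Suc i < n \<longleftrightarrow> \<not> i < n" "N - Suc (N - Suc i) = i" if "i < N" for i
    using that by presburger+
  have b: "integral (b i)" "supp (b i)" "Mop (x * J) (b i) = scal (entry L (N - Suc i)) (b (N - Suc i))"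
    if i: "i < N" for i
  proof -
    show "integral (b i)" "supp (b i)" using FH flip[OF i] by (auto simp: b_def)
    show "Mop (x * J) (b i) = scal (entry L (N - Suc i)) (b (N - Suc i))"
    proof (cases "i < n")
      case True
      have "entry L (N - Suc i) = q powi (- L ! i)"
        unfolding entry_def symmetric_list_nth[OF len i] using True len by (simp add: nth_append)
      thus ?thesis using True FH(6)[OF True] flip[OF i] by (simp add: b_def)
    next
      case False
      hence j: "N - Suc i < n" using flip[OF i] by simp
      hence "entry L (N - Suc i) = q powi (L ! (N - Suc i))"
        using len by (simp add: entry_def nth_append)
      thus ?thesis using False FH(5)[OF j] j by (simp add: b_def)
    qed
  qed
  have hb: "h (b i) (b k) = (if i + k + 1 = N then 1 else 0)" if ik: "i < N" "k < N" for i k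
  proof -
    have c: "i + k + 1 = N \<longleftrightarrow> i = N - Suc k" "i + k + 1 = N \<longleftrightarrow> N - Suc i = k" using ik by auto
    consider "i < n" "k < n" | "i < n" "\<not> k < n" | "\<not> i < n" "k < n" | "\<not> i < n" "\<not> k < n" by blast
    thus ?thesis
    proof cases
      case 1
      thus ?thesis using hFH[OF 1] by (simp add: b_def)
    next
      case 2
      thus ?thesis using hFH(4)[of i "N - Suc k"] flip[OF ik(2)] c(1) by (simp add: b_def)
    next
      case 3
      thus ?thesis using hFH(3)[of "N - Suc i" k] flip[OF ik(1)] c(2) by (simp add: b_def)
    next
      case 4
      thus ?thesis using hFH(1)[of "N - Suc i" "N - Suc k"] flip[OF ik(1)] flip[OF ik(2)] by (simp add: b_def)
    qed
  qed
  define B where "B = of_cols b"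
  have BM: "B \<in> M" by (simp add: B_def)
  have cB: "colf B i = b i" if "i < N" for i using b(2)[OF that] that by (simp add: B_def colf_of_cols)
  have "ct B * J * B = J"
  proof (rule eq_matI)
    fix i k assume "i < dim_row J" "k < dim_col J"
    hence ik: "i < N" "k < N" by (simp_all add: antidiag_mat_def)
    show "(ct B * J * B) $$ (i, k) = J $$ (i, k)"
      unfolding h_matrix[OF BM BM ik] cB[OF ik(1)] cB[OF ik(2)] hb[OF ik] using ik by (simp add: antidiag_mat_def)
  qed (use BM in \<open>auto simp: antidiag_mat_def\<close>)
  hence BG: "B \<in> G" using BM by (simp add: unitary_iff)
  have BK: "B \<in> K" using BG b(1) by (auto simp: K_iff integral_mat_def B_def of_cols_def integral_def)
  define W where "W = weight_mat q L"
  have WM: "W \<in> M" by (simp add: W_def weight_mat_entry[OF len])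
  have xJB: "x * J * B = B * W * J"
  proof (rule eq_matI)
    fix i k assume "i < dim_row (B * W * J)" "k < dim_col (B * W * J)"
    hence ik: "i < N" "k < N" using BM by (simp_all add: antidiag_mat_def)
    have k': "N - Suc k < N" using ik by simp
    have "(x * J * B) $$ (i, k) = colf (x * J * B) k i" using ik by (simp add: colf_def)
    also have "\<dots> = Mop (x * J) (b k) i" using colf_mult[of "x * J" B k] x'(1) BM ik cB by simp
    also have "\<dots> = entry L (N - Suc k) * b (N - Suc k) i" unfolding b(3)[OF ik(2)] by (simp add: scal_def)
    also have "\<dots> = (B * W) $$ (i, N - Suc k)"
      unfolding W_def weight_mat_entry[OF len] mat_diag_mult_right[OF BM]
      using ik k' by (simp add: B_def of_cols_def)
    also have "\<dots> = (B * W * J) $$ (i, k)" using mult_J_index[of "B * W" i k] ik BM WM by simp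
    finally show "(x * J * B) $$ (i, k) = (B * W * J) $$ (i, k)" .
  qed (use BM WM x'(1) in \<open>auto simp: antidiag_mat_def\<close>)
  have "x = x * J * (B * J * ct B)" unfolding unitary_inverse(4)[OF BG] using x'(1) by (simp add: M_assoc)
  also have "\<dots> = x * J * B * (J * ct B)" using x'(1) BM by (simp add: M_assoc)
  also have "\<dots> = B * W * ct B" unfolding xJB using BM WM by (simp add: M_assoc)
  finally have "x \<in> unitary_orbit \<sigma> K W" using BK by (auto simp: unitary_orbit_def)
  thus ?thesis using dom unfolding W_def by blast
qed

end

section \<open>Disjointness of the orbits of weight matrices\<close>

context unitary_setting
begin

lemma signof_integral: "(signof p :: 'l) \<in> val_ring w"
  by (cases p rule: sign_cases) simp_all

lemma det_integral: assumes A: "A \<in> M" "integral_mat A" shows "det A \<in> val_ring w"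
  unfolding det_def'[OF A(1)]
proof (intro k'.ideal_sum k'.ideal_mult_left[OF signof_integral] k'.ring_prod)
  fix p i assume "p \<in> {p. p permutes {0..<N}}" "i \<in> {0..<N}"
  hence "i < N" "p i < N" using permutes_in_image[of p "{0..<N}" i] by auto
  thus "A $$ (i, p i) \<in> val_ring w" using A by (simp add: integral_mat_def)
qed

text \<open>Every permutation meets a block of \<open>2n - k\<close> rows and \<open>k + 1\<close> columns.\<close>

lemma det_block_divisible:
  assumes A: "A \<in> M" "integral_mat A" and k: "k < N"
    and block: "\<And>i j. k \<le> i \<Longrightarrow> i < N \<Longrightarrow> j \<le> k \<Longrightarrow> A $$ (i, j) \<in> val_ideal w 1"
  shows "det A \<in> val_ideal w 1"
  unfolding det_def'[OF A(1)]
proof (intro k'.ideal_sum k'.ideal_mult_left[OF signof_integral])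
  fix p assume "p \<in> {p. p permutes {0..<N}}"
  hence p: "p permutes {0..<N}" by simp
  have pi: "p i < N" if "i < N" for i using permutes_in_image[OF p, of i] that by simp
  have "\<exists>i. k \<le> i \<and> i < N \<and> p i \<le> k"
  proof (rule ccontr)
    assume "\<not> ?thesis"
    hence "p ` {k..<N} \<subseteq> {Suc k..<N}" using pi by fastforce
    hence "card (p ` {k..<N}) \<le> card {Suc k..<N}" by (intro card_mono) auto
    moreover have "card (p ` {k..<N}) = card {k..<N}"
      by (rule card_image) (rule inj_on_subset[OF permutes_inj[OF p]], simp)
    ultimately show False using k by simp
  qed
  then obtain i where i: "k \<le> i" "i < N" "p i \<le> k" by blast
  have "(\<Prod>i = 0..<N. A $$ (i, p i)) = A $$ (i, p i) * (\<Prod>i\<in>{0..<N} - {i}. A $$ (i, p i))"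
    using i by (intro prod.remove) auto
  also have "\<dots> \<in> val_ideal w 1"
    by (intro k'.ideal_mult_right block i k'.ring_prod) (use A pi in \<open>auto simp: integral_mat_def\<close>)
  finally show "(\<Prod>i = 0..<N. A $$ (i, p i)) \<in> val_ideal w 1" .
qed

end

context unitary_uniformized
begin

text \<open>With \<open>H\<close> the inverse of \<open>ct g\<close>, the hypothesis reads
  \<open>entry l' i * H_ij = g_ij * entry l j\<close>. Were the claim false at \<open>k\<close>,
  monotonicity of both weight lists would make \<open>H_ij\<close> divisible by the prime for all
  \<open>i \<ge> k \<ge> j\<close>; this block forces \<open>det H\<close> into the maximal ideal,
  although \<open>ct g\<close> is an integral inverse.\<close>

lemma weight_valuations_le:
  assumes g: "g \<in> K" and l: "l \<in> dominant_weights n" "l' \<in> dominant_weights n"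
    and e: "weight_mat q l' = g * weight_mat q l * ct g" and k: "k < N"
  shows "(l @ rev (map uminus l)) ! k \<le> (l' @ rev (map uminus l')) ! k"
proof (rule ccontr)
  assume "\<not> ?thesis"
  hence less: "(l' @ rev (map uminus l')) ! k < (l @ rev (map uminus l)) ! k" by simp
  have len: "length l = n" "length l' = n" using l by (simp_all add: dominant_weights_def)
  have sorted: "(m @ rev (map uminus m)) ! j \<le> (m @ rev (map uminus m)) ! i"
    if m: "m \<in> dominant_weights n" and ij: "i \<le> j" "j < N" for m i j
  proof -
    have s: "sorted_wrt (\<ge>) m" "\<forall>a\<in>set m. a \<ge> 0" "length m = n" using m by (simp_all add: dominant_weights_def)
    have "sorted_wrt (\<ge>) (m @ rev (map uminus m))"
      using s by (auto simp: sorted_wrt_append sorted_wrt_rev sorted_wrt_map intro: order_trans[of _ 0])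
    thus ?thesis using sorted_wrt_nth_less[of "(\<ge>)" "m @ rev (map uminus m)" i j] ij s(3)
      by (cases "i = j") auto
  qed
  have gG: "g \<in> G" "integral_mat g" and gM: "g \<in> M" using g by (auto simp: K_iff unitary_iff)
  have WM: "weight_mat q l \<in> M" "weight_mat q l' \<in> M" using len by (simp_all add: weight_mat_entry)
  define H where "H = J * g * J"
  have HM: "H \<in> M" "integral_mat H"
    using gM gG by (auto simp: H_def intro!: integral_mat_mult integral_mat_J)
  have HcG: "H * ct g = 1\<^sub>m N"
  proof -
    have "H * ct g = J * (g * J * ct g)" using gM by (simp add: H_def M_assoc)
    thus ?thesis unfolding unitary_inverse(4)[OF gG(1)] by simp
  qed
  have cgH: "ct g * H = 1\<^sub>m N" by (rule inverse_matrix[OF HM(1) _ HcG]) (simp add: gM)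
  have "weight_mat q l' * H = g * weight_mat q l * (ct g * H)"
    unfolding e using gM WM HM by (simp add: M_assoc)
  hence eq: "weight_mat q l' * H = g * weight_mat q l" unfolding cgH using gM WM by simp
  have ent: "entry l' i * H $$ (i, j) = g $$ (i, j) * entry l j" if ij: "i < N" "j < N" for i j
  proof -
    have "entry l' i * H $$ (i, j) = (weight_mat q l' * H) $$ (i, j)"
      unfolding weight_mat_entry[OF len(2)] mat_diag_mult_left[OF HM(1)] using ij by simp
    also have "\<dots> = g $$ (i, j) * entry l j"
      unfolding eq weight_mat_entry[OF len(1)] mat_diag_mult_right[OF gM] using ij by simp
    finally show ?thesis .
  qed
  have "det H \<in> val_ideal w 1"
  proof (rule det_block_divisible[OF HM k])
    fix i j assume ij: "k \<le> i" "i < N" "j \<le> k"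
    hence j: "j < N" using k by simp
    have "w (entry l' i) < w (entry l j)"
      unfolding w_entry using sorted[OF l(2) ij(1,2)] sorted[OF l(1) ij(3) k] less by linarith
    hence "entry l j / entry l' i \<in> val_ideal w 1" by (simp add: val_ideal_def k'.v_divide entry_nz)
    moreover have "g $$ (i, j) \<in> val_ring w" using gG ij j by (simp add: integral_mat_def)
    ultimately have "g $$ (i, j) * (entry l j / entry l' i) \<in> val_ideal w 1" by (rule k'.ideal_mult_left[rotated])
    also have "g $$ (i, j) * (entry l j / entry l' i) = H $$ (i, j)"
      using ent[OF ij(2) j] entry_nz[of l' i] by (simp add: field_simps)
    finally show "H $$ (i, j) \<in> val_ideal w 1" .
  qed
  moreover have "det (ct g) \<in> val_ring w"
    by (rule det_integral) (use gM gG integral_mat_ct in auto)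
  ultimately have "det H * det (ct g) \<in> val_ideal w 1" by (rule k'.ideal_mult_right)
  also have "det H * det (ct g) = det (H * ct g)"
    by (rule det_mult[symmetric, OF HM(1)]) (use gM in simp)
  finally show False using HcG by simp
qed

lemma weight_orbits_disjoint:
  assumes l: "l \<in> dominant_weights n" "l' \<in> dominant_weights n"
    and y: "y \<in> unitary_orbit \<sigma> K (weight_mat q l)" "y \<in> unitary_orbit \<sigma> K (weight_mat q l')"
  shows "l = l'"
proof -
  have len: "length l = n" "length l' = n" using l by (simp_all add: dominant_weights_def)
  have WM: "weight_mat q l \<in> M" "weight_mat q l' \<in> M" using len by (simp_all add: weight_mat_entry)
  have orbs: "unitary_orbit \<sigma> K (weight_mat q l) = unitary_orbit \<sigma> K (weight_mat q l')"
  proof -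
    have "unitary_orbit \<sigma> K y = unitary_orbit \<sigma> K x" if yx: "y \<in> unitary_orbit \<sigma> K x" "x \<in> M" for x
    proof -
      obtain g where "g \<in> K" "y = g * x * ct g" using yx(1) by (auto simp: unitary_orbit_def)
      thus ?thesis using K_orbit_eq yx(2) by simp
    qed
    thus ?thesis using y WM by metis
  qed
  have "weight_mat q l' \<in> unitary_orbit \<sigma> K (weight_mat q l)"
    unfolding orbs by (rule orbit_refl[OF WM(2) one_K])
  then obtain g where g: "g \<in> K" "weight_mat q l' = g * weight_mat q l * ct g" by (auto simp: unitary_orbit_def)
  have "weight_mat q l \<in> unitary_orbit \<sigma> K (weight_mat q l')"
    unfolding orbs[symmetric] by (rule orbit_refl[OF WM(1) one_K])
  then obtain g' where g': "g' \<in> K" "weight_mat q l = g' * weight_mat q l' * ct g'" by (auto simp: unitary_orbit_def)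
  show ?thesis
  proof (rule nth_equalityI)
    fix k assume k: "k < length l"
    hence "k < N" using len by simp
    hence "(l @ rev (map uminus l)) ! k = (l' @ rev (map uminus l')) ! k"
      using weight_valuations_le[OF g(1) l g(2)] weight_valuations_le[OF g'(1) l(2,1) g'(2)] by (simp add: order_antisym)
    thus "l ! k = l' ! k" using k len by (simp add: nth_append)
  qed (simp add: len)
qed

end

theorem theorem1:
  fixes v :: "'k :: field_char_0 \<Rightarrow> int"
    and w :: "'l :: field \<Rightarrow> int"
    and \<iota> :: "'k \<Rightarrow> 'l"
    and \<sigma> :: "'l \<Rightarrow> 'l"
    and \<pi> :: 'k
    and n :: nat
  assumes "unramified_quadratic_extension v w \<iota> \<sigma>"
    and "prime_element v \<pi>"
    and "n \<ge> 1"
  shows "let G = unitary_group \<sigma> n;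
             K = integral_unitary_group w \<sigma> n;
             X = unitary_hermitian \<sigma> n;
             \<Lambda> = dominant_weights n;
             x = weight_mat (\<iota> \<pi>)
         in (odd (residual_char v) \<longrightarrow>
               (\<forall>l \<in> \<Lambda>. x l \<in> X) \<and>
               X = (\<Union>l \<in> \<Lambda>. unitary_orbit \<sigma> K (x l)) \<and>
               disjoint_family_on (\<lambda>l. unitary_orbit \<sigma> K (x l)) \<Lambda>) \<and>
            (even (residual_char v) \<longrightarrow>
               (\<exists>Y \<in> unitary_orbit \<sigma> K ` X. \<forall>y \<in> Y. \<not> diagonal_mat y)) \<and>
            card (unitary_orbit \<sigma> G ` X) = 2"
proof -
  interpret unramified_quadratic_extension v w \<iota> \<sigma> by fact
  interpret S: unitary_setting v w \<iota> \<sigma> n ..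
  have q: "\<iota> \<pi> \<noteq> 0" "w (\<iota> \<pi>) = 1" "\<sigma> (\<iota> \<pi>) = \<iota> \<pi>"
    using assms(2) by (simp_all add: prime_element_def unramified \<sigma>_fixes)
  interpret U: unitary_uniformized v w \<iota> \<sigma> n "\<iota> \<pi>"
    by unfold_locales (use q assms(3) in auto)
  have even_iff: "even (residual_char v) \<longleftrightarrow> 2 \<in> val_ideal w 1"
    using k.even_residual_char_iff \<iota>_ideal[of 2 1] by (simp add: \<iota>.hom_numeral)
  have odd: "(\<forall>l\<in>dominant_weights n. weight_mat (\<iota> \<pi>) l \<in> S.X) \<and>
      S.X = (\<Union>l\<in>dominant_weights n. unitary_orbit \<sigma> S.K (weight_mat (\<iota> \<pi>) l)) \<and>
      disjoint_family_on (\<lambda>l. unitary_orbit \<sigma> S.K (weight_mat (\<iota> \<pi>) l)) (dominant_weights n)"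
    if "odd (residual_char v)"
  proof (intro conjI ballI)
    have two: "w 2 = 0" using that k'.ideal_1_iff[of 2] by (simp add: even_iff)
    show wX: "weight_mat (\<iota> \<pi>) l \<in> S.X" if "l \<in> dominant_weights n" for l
      using that U.weight_hermitian by (simp add: dominant_weights_def)
    show "S.X = (\<Union>l\<in>dominant_weights n. unitary_orbit \<sigma> S.K (weight_mat (\<iota> \<pi>) l))"
    proof (intro equalityI subsetI)
      fix x assume "x \<in> S.X"
      thus "x \<in> (\<Union>l\<in>dominant_weights n. unitary_orbit \<sigma> S.K (weight_mat (\<iota> \<pi>) l))"
        using U.odd_diagonalisation[OF two] by blast
    next
      fix x assume "x \<in> (\<Union>l\<in>dominant_weights n. unitary_orbit \<sigma> S.K (weight_mat (\<iota> \<pi>) l))"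
      then obtain l g where "l \<in> dominant_weights n" "g \<in> S.K"
        "x = g * weight_mat (\<iota> \<pi>) l * conj_transpose \<sigma> g" by (auto simp: unitary_orbit_def)
      thus "x \<in> S.X" using S.action_hermitian wX S.K_iff by blast
    qed
    show "disjoint_family_on (\<lambda>l. unitary_orbit \<sigma> S.K (weight_mat (\<iota> \<pi>) l)) (dominant_weights n)"
      unfolding disjoint_family_on_def using U.weight_orbits_disjoint by blast
  qed
  have "\<exists>Y\<in>unitary_orbit \<sigma> S.K ` S.X. \<forall>y\<in>Y. \<not> diagonal_mat y" if "even (residual_char v)"
    using S.even_residual_orbit assms(3) that by (simp add: even_iff)
  with odd U.two_unitary_orbits show ?thesis unfolding Let_def by blast
qed

end
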